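(* Consider the lattice $z=x(s):=4\beta s^2+\mathfrak{c}_5s$, with $\beta,\mathfrak{c}_5\in\mathbb{C}$, $(\beta,\mathfrak{c}_5)\neq(0,0)$. Let $(P_n)_{n\ge0}$ be a monic OPS with respect to ${\bf u}\in\mathcal{P}^*$, with recurrence coefficients $B_n$, $C_n$. Assume that, for some complex constants $a,b,c$ and complex sequences $a_n,b_n,c_n$ with $c_n\neq0$ for $n=0,1,\ldots$, $$(az^2+bz+c)\,\mathrm{D}_xP_n=a_n\,\mathrm{S}_xP_{n+1}+b_n\,\mathrm{S}_xP_n+c_n\,\mathrm{S}_xP_{n-1},\qquad n=0,1,\ldots,$$ where $a,b,c$ are such that $$6aC_2C_3+2(1+a^{-1})r_3\Big(C_1-\frac{\mathfrak{c}_5^2}{4}\Big)+r_3\Big((B_1-B_0)^2-8\beta(B_0+B_1-2\beta)-2C_2\Big)=0\quad\text{whenever }a\neq0,$$ and $$aC_2C_3\big(b_2+2aB_2+b'\big)-r_3\Big(a(B_2+B_1)C_2+b'C_2-\frac{r_2}{2}(B_1-B_0)\Big)=0,$$ with $r_i=c_i+2aC_i$ ($i=2,3$) and $b'=b+2a\beta$. Then the $P_n$ are multiples of continuous dual Hahn polynomials or Wilson polynomials, or special or limiting cases of them. Moreover, for every $n$, $Y=P_n$ satisfies $$\phi(z)\,\mathrm{D}_x^2Y(z)+\psi(z)\,\mathrm{S}_x\mathrm{D}_xY(z)=\lambda_n\,Y(z)$$ with $$\phi(z)=(B_0-z)(\mathfrak{a}z+\mathfrak{b}-\mathfrak{a}B_1)-(\mathfrak{a}+1)C_1,\qquad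 \psi(z)=z-B_0,\qquad \lambda_n=n\big(1+(n-1)\mathfrak{a}\big),$$ where $$\mathfrak{a}:=\frac{aC_3}{r_3C_1},\qquad \mathfrak{b}:=\frac12(B_1-B_0+4\beta).$$
   Context: $\mathcal{P}$ is the vector space of polynomials with complex coefficients and $\mathcal{P}^*$ its algebraic dual. A sequence $(P_n)_{n\ge0}$ with $\deg P_n=n$ is an orthogonal polynomial sequence (OPS) with respect to ${\bf u}\in\mathcal{P}^*$ if $\langle{\bf u},P_nP_m\rangle=h_n\delta_{n,m}$ with $h_n\ne0$. A monic OPS satisfies a three-term recurrence $P_{-1}=0$, $P_0=1$, $P_{n+1}(z)=(z-B_n)P_n(z)-C_nP_{n-1}(z)$ with $C_n\neq0$; the $B_n$ ($n\ge 0$) and $C_n$ ($n\ge1$) are its recurrence coefficients. The operators on polynomials are defined by $$\mathrm{D}_xf(x(s))=\frac{f(x(s+\tfrac12))-f(x(s-\tfrac12))}{x(s+\tfrac12)-x(s-\tfrac12)},\qquad \mathrm{S}_xf(x(s))=\frac{f(x(s+\tfrac12))+f(x(s-\tfrac12))}{2}.$$ The Wilson polynomials are, up to a multiplicative constant, the polynomials in $y^2$ given by ${}_4F_3\left(-n,\,n+a_1+a_2+a_3+a_4-1,\,a_1+iy,\,a_1-iy;\ a_1+a_2,\,a_1+a_3,\,a_1+a_4;\ 1\right)$, and the continuous dual Hahn polynomials are, up to a multiplicative constant, the polynomials in $y^2$ given by ${}_3F_2\left(-n,\,a_1+iy,\,a_1-iy;\ a_1+a_2,\,a_1+a_3;\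 1\right)$, with complex parameters $a_i$. Here they are understood up to a multiplicative constant and an affine change of the variable $z$; "special or limiting cases" means, in the usual sense of the Askey scheme, sequences obtained from these by specializing the parameters or by taking limits in the parameters and in the affine change of variable. *)

theory Defs
  imports "HOL-Analysis.Analysis"
begin

definition lattice :: "complex \<Rightarrow> complex \<Rightarrow> complex \<Rightarrow> complex" where
  "lattice \<beta> c5 s = 4 * \<beta> * s\<^sup>2 + c5 * s"

text \<open>
  The operators are maps on polynomials in \<open>z = x(s)\<close>. \<open>Dx \<beta> c5 f\<close> is the polynomial whose value
  at \<open>x(s)\<close> is the divided difference of \<open>f\<close>, wherever its denominator does not vanish; the
  lemmas below show that these polynomials exist and are unique if \<open>\<beta>\<close> and \<open>c5\<close> are not both 0.
\<close>

definition Dx :: "complex \<Rightarrow> complex \<Rightarrow> complex poly \<Rightarrow> complex poly" where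
  "Dx \<beta> c5 f = (THE g. \<forall>s. lattice \<beta> c5 (s + 1/2) \<noteq> lattice \<beta> c5 (s - 1/2) \<longrightarrow>
     poly g (lattice \<beta> c5 s) =
       (poly f (lattice \<beta> c5 (s + 1/2)) - poly f (lattice \<beta> c5 (s - 1/2)))
         / (lattice \<beta> c5 (s + 1/2) - lattice \<beta> c5 (s - 1/2)))"

definition Sx :: "complex \<Rightarrow> complex \<Rightarrow> complex poly \<Rightarrow> complex poly" where
  "Sx \<beta> c5 f = (THE g. \<forall>s. poly g (lattice \<beta> c5 s) =
     (poly f (lattice \<beta> c5 (s + 1/2)) + poly f (lattice \<beta> c5 (s - 1/2))) / 2)"

lemma lattice_shift:
  "lattice \<beta> c5 (s + 1/2) = (lattice \<beta> c5 s + \<beta>) + (4 * \<beta> * s + c5/2)"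
  "lattice \<beta> c5 (s - 1/2) = (lattice \<beta> c5 s + \<beta>) - (4 * \<beta> * s + c5/2)"
  "(4 * \<beta> * s + c5/2)\<^sup>2 = 4 * \<beta> * lattice \<beta> c5 s + c5\<^sup>2/4"
  by (simp_all add: lattice_def power2_eq_square field_simps)

lemma lattice_diff_zero_iff:
  "lattice \<beta> c5 (s + 1/2) = lattice \<beta> c5 (s - 1/2) \<longleftrightarrow> 8 * \<beta> * s + c5 = 0"
proof -
  have "lattice \<beta> c5 (s + 1/2) - lattice \<beta> c5 (s - 1/2) = 8 * \<beta> * s + c5"
    by (simp add: lattice_def power2_eq_square field_simps)
  then show ?thesis by (metis eq_iff_diff_eq_0)
qed

lemma shifted_values_exist:
  "\<exists>\<sigma> \<delta>. \<forall>s.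
     poly f (lattice \<beta> c5 (s + 1/2)) =
       poly \<sigma> (lattice \<beta> c5 s) + (4 * \<beta> * s + c5/2) * poly \<delta> (lattice \<beta> c5 s) \<and>
     poly f (lattice \<beta> c5 (s - 1/2)) =
       poly \<sigma> (lattice \<beta> c5 s) - (4 * \<beta> * s + c5/2) * poly \<delta> (lattice \<beta> c5 s)"
proof (induction f)
  case 0
  show ?case by (rule exI[of _ 0], rule exI[of _ 0]) simp
next
  case (pCons k p)
  then obtain \<sigma> \<delta> where *: "\<And>s. poly p (lattice \<beta> c5 (s + 1/2)) =
       poly \<sigma> (lattice \<beta> c5 s) + (4 * \<beta> * s + c5/2) * poly \<delta> (lattice \<beta> c5 s)"
     "\<And>s. poly p (lattice \<beta> c5 (s - 1/2)) =
       poly \<sigma> (lattice \<beta> c5 s) - (4 * \<beta> * s + c5/2) * poly \<delta> (lattice \<beta> c5 s)" by blast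
  show ?case
  proof (rule exI[of _ "[:k:] + [:\<beta>, 1:] * \<sigma> + [:c5\<^sup>2/4, 4 * \<beta>:] * \<delta>"],
      rule exI[of _ "\<sigma> + [:\<beta>, 1:] * \<delta>"], intro allI)
    fix s
    define w where "w = 4 * \<beta> * s + c5/2"
    define X where "X = lattice \<beta> c5 s"
    have w2: "w * w = 4 * \<beta> * X + c5\<^sup>2/4"
      using lattice_shift(3)[of \<beta> s c5] by (simp add: w_def X_def power2_eq_square)
    have pl: "poly (pCons k p) (lattice \<beta> c5 (s + 1/2)) =
        k + (X + \<beta> + w) * (poly \<sigma> X + w * poly \<delta> X)"
      using *(1)[of s] lattice_shift(1)[of \<beta> c5 s] by (simp add: w_def X_def)
    have mi: "poly (pCons k p) (lattice \<beta> c5 (s - 1/2)) =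
        k + (X + \<beta> - w) * (poly \<sigma> X - w * poly \<delta> X)"
      using *(2)[of s] lattice_shift(2)[of \<beta> c5 s] by (simp add: w_def X_def)
    have S: "poly ([:k:] + [:\<beta>, 1:] * \<sigma> + [:c5\<^sup>2/4, 4 * \<beta>:] * \<delta>) X =
        k + (X + \<beta>) * poly \<sigma> X + (w * w) * poly \<delta> X"
      unfolding w2 by (simp add: algebra_simps)
    have D: "poly (\<sigma> + [:\<beta>, 1:] * \<delta>) X = poly \<sigma> X + (X + \<beta>) * poly \<delta> X"
      by (simp add: algebra_simps)
    show "poly (pCons k p) (lattice \<beta> c5 (s + 1/2)) =
       poly ([:k:] + [:\<beta>, 1:] * \<sigma> + [:c5\<^sup>2/4, 4 * \<beta>:] * \<delta>) (lattice \<beta> c5 s) +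
         (4 * \<beta> * s + c5/2) * poly (\<sigma> + [:\<beta>, 1:] * \<delta>) (lattice \<beta> c5 s) \<and>
     poly (pCons k p) (lattice \<beta> c5 (s - 1/2)) =
       poly ([:k:] + [:\<beta>, 1:] * \<sigma> + [:c5\<^sup>2/4, 4 * \<beta>:] * \<delta>) (lattice \<beta> c5 s) -
         (4 * \<beta> * s + c5/2) * poly (\<sigma> + [:\<beta>, 1:] * \<delta>) (lattice \<beta> c5 s)"
      unfolding pl mi w_def[symmetric] X_def[symmetric] S D by (simp add: algebra_simps)
  qed
qed

lemma poly_eqI_lattice:
  assumes "(\<beta>, c5) \<noteq> (0, 0)" and "finite A"
    and eq: "\<And>s. s \<notin> A \<Longrightarrow> poly g (lattice \<beta> c5 s) = poly h (lattice \<beta> c5 s)"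
  shows "g = h"
proof -
  define l where "l = [:0, c5, 4 * \<beta>:]"
  have l: "poly l s = lattice \<beta> c5 s" for s
    by (simp add: l_def lattice_def power2_eq_square algebra_simps)
  have deg: "degree l \<noteq> 0" using assms(1) by (auto simp: l_def)
  have "(g - h) \<circ>\<^sub>p l = 0"
  proof (rule ccontr)
    assume nz: "(g - h) \<circ>\<^sub>p l \<noteq> 0"
    have "- A \<subseteq> {s. poly ((g - h) \<circ>\<^sub>p l) s = 0}"
      using eq by (auto simp: poly_pcompose l)
    then have "finite (- A)" using poly_roots_finite[OF nz] finite_subset by blast
    then have "finite (UNIV :: complex set)" using \<open>finite A\<close> by (metis finite_compl)
    then show False using infinite_UNIV_char_0 by blast
  qed
  then have "g - h = 0" using deg pcompose_eq_0[of "g - h" l] by auto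
  then show ?thesis by simp
qed

lemma finite_lattice_diff_zero:
  assumes "(\<beta>, c5) \<noteq> (0, 0)"
  shows "finite {s. lattice \<beta> c5 (s + 1/2) = lattice \<beta> c5 (s - 1/2)}"
proof -
  have "[:c5, 8 * \<beta>:] \<noteq> 0" using assms by auto
  then have "finite {s. poly [:c5, 8 * \<beta>:] s = 0}" by (rule poly_roots_finite)
  then show ?thesis unfolding lattice_diff_zero_iff by (simp add: algebra_simps)
qed

lemma poly_Dx:
  assumes "(\<beta>, c5) \<noteq> (0, 0)"
    and "lattice \<beta> c5 (s + 1/2) \<noteq> lattice \<beta> c5 (s - 1/2)"
  shows "poly (Dx \<beta> c5 f) (lattice \<beta> c5 s) =
       (poly f (lattice \<beta> c5 (s + 1/2)) - poly f (lattice \<beta> c5 (s - 1/2)))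
         / (lattice \<beta> c5 (s + 1/2) - lattice \<beta> c5 (s - 1/2))"
proof -
  let ?R = "\<lambda>g. \<forall>s. lattice \<beta> c5 (s + 1/2) \<noteq> lattice \<beta> c5 (s - 1/2) \<longrightarrow>
     poly g (lattice \<beta> c5 s) =
       (poly f (lattice \<beta> c5 (s + 1/2)) - poly f (lattice \<beta> c5 (s - 1/2)))
         / (lattice \<beta> c5 (s + 1/2) - lattice \<beta> c5 (s - 1/2))"
  obtain \<sigma> \<delta> where *: "\<And>s. poly f (lattice \<beta> c5 (s + 1/2)) =
       poly \<sigma> (lattice \<beta> c5 s) + (4 * \<beta> * s + c5/2) * poly \<delta> (lattice \<beta> c5 s)"
     "\<And>s. poly f (lattice \<beta> c5 (s - 1/2)) =
       poly \<sigma> (lattice \<beta> c5 s) - (4 * \<beta> * s + c5/2) * poly \<delta> (lattice \<beta> c5 s)"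
    using shifted_values_exist[of f \<beta> c5] by blast
  have "?R \<delta>"
  proof (intro allI impI)
    fix s assume "lattice \<beta> c5 (s + 1/2) \<noteq> lattice \<beta> c5 (s - 1/2)"
    moreover have "lattice \<beta> c5 (s + 1/2) - lattice \<beta> c5 (s - 1/2) = 2 * (4 * \<beta> * s + c5/2)"
      unfolding lattice_shift by simp
    ultimately show "poly \<delta> (lattice \<beta> c5 s) =
       (poly f (lattice \<beta> c5 (s + 1/2)) - poly f (lattice \<beta> c5 (s - 1/2)))
         / (lattice \<beta> c5 (s + 1/2) - lattice \<beta> c5 (s - 1/2))"
      unfolding * using lattice_diff_zero_iff[of \<beta> c5 s] by (simp add: eq_divide_eq mult.assoc)
  qed
  moreover have "g = \<delta>" if "?R g" for g
    by (rule poly_eqI_lattice[OF assms(1) finite_lattice_diff_zero[OF assms(1)]])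
       (use that \<open>?R \<delta>\<close> in auto)
  ultimately have "?R (Dx \<beta> c5 f)" unfolding Dx_def by (rule theI)
  then show ?thesis using assms(2) by blast
qed

lemma poly_Sx:
  assumes "(\<beta>, c5) \<noteq> (0, 0)"
  shows "poly (Sx \<beta> c5 f) (lattice \<beta> c5 s) =
     (poly f (lattice \<beta> c5 (s + 1/2)) + poly f (lattice \<beta> c5 (s - 1/2))) / 2"
proof -
  let ?R = "\<lambda>g. \<forall>s. poly g (lattice \<beta> c5 s) =
     (poly f (lattice \<beta> c5 (s + 1/2)) + poly f (lattice \<beta> c5 (s - 1/2))) / 2"
  obtain \<sigma> \<delta> where *: "\<And>s. poly f (lattice \<beta> c5 (s + 1/2)) =
       poly \<sigma> (lattice \<beta> c5 s) + (4 * \<beta> * s + c5/2) * poly \<delta> (lattice \<beta> c5 s)"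
     "\<And>s. poly f (lattice \<beta> c5 (s - 1/2)) =
       poly \<sigma> (lattice \<beta> c5 s) - (4 * \<beta> * s + c5/2) * poly \<delta> (lattice \<beta> c5 s)"
    using shifted_values_exist[of f \<beta> c5] by blast
  have "?R \<sigma>" unfolding * by simp
  moreover have "g = \<sigma>" if "?R g" for g
    by (rule poly_eqI_lattice[OF assms finite.emptyI]) (use that \<open>?R \<sigma>\<close> in metis)
  ultimately have "?R (Sx \<beta> c5 f)" unfolding Sx_def by (rule theI)
  then show ?thesis by blast
qed

definition monic_OPS :: "(complex poly \<Rightarrow> complex) \<Rightarrow> (nat \<Rightarrow> complex poly) \<Rightarrow> bool" where
  "monic_OPS u P \<longleftrightarrow>
     Vector_Spaces.linear smult (*) u \<and>
     (\<forall>n. degree (P n) = n \<and> lead_coeff (P n) = 1) \<and>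
     (\<exists>h. \<forall>n m. h n \<noteq> 0 \<and> u (P n * P m) = (if n = m then h n else 0))"

text \<open>\<open>shift_seq P n\<close> is \<open>P\<^sub>n\<^sub>-\<^sub>1\<close> with the convention \<open>P\<^sub>-\<^sub>1 = 0\<close>.\<close>

definition shift_seq :: "(nat \<Rightarrow> complex poly) \<Rightarrow> nat \<Rightarrow> complex poly" where
  "shift_seq P n = (case n of 0 \<Rightarrow> 0 | Suc m \<Rightarrow> P m)"

text \<open>\<open>C 0\<close> is irrelevant, because it is multiplied by \<open>P\<^sub>-\<^sub>1\<close>.\<close>

definition recurrence_coeffs ::
    "(nat \<Rightarrow> complex poly) \<Rightarrow> (nat \<Rightarrow> complex) \<Rightarrow> (nat \<Rightarrow> complex) \<Rightarrow> bool" where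
  "recurrence_coeffs P B C \<longleftrightarrow>
     P 0 = 1 \<and> (\<forall>n. P (Suc n) = [:- B n, 1:] * P n - smult (C n) (shift_seq P n)) \<and>
     (\<forall>n\<ge>1. C n \<noteq> 0)"

text \<open>
  The hypergeometric forms; both series terminate. The sets \<open>wilson_seqs\<close> and
  \<open>cont_dual_hahn_seqs\<close> allow a multiplicative constant for each \<open>n\<close> and one affine change of
  variable \<open>z = p y\<^sup>2 + q\<close>. The denominator parameters must not be nonpositive integers, as
  the series is not meaningful otherwise; the remaining parameter values are only reached as limits.
  The degree condition excludes Wilson parameters for which the leading coefficient vanishes.
\<close>

definition wilson_fun ::
    "complex \<Rightarrow> complex \<Rightarrow> complex \<Rightarrow> complex \<Rightarrow> nat \<Rightarrow> complex \<Rightarrow> complex" where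
  "wilson_fun a1 a2 a3 a4 n y =
     eval_fps (fps_hypergeo
       [- of_nat n, of_nat n + a1 + a2 + a3 + a4 - 1, a1 + \<i> * y, a1 - \<i> * y]
       [a1 + a2, a1 + a3, a1 + a4] 1) 1"

definition cont_dual_hahn_fun ::
    "complex \<Rightarrow> complex \<Rightarrow> complex \<Rightarrow> nat \<Rightarrow> complex \<Rightarrow> complex" where
  "cont_dual_hahn_fun a1 a2 a3 n y =
     eval_fps (fps_hypergeo
       [- of_nat n, a1 + \<i> * y, a1 - \<i> * y] [a1 + a2, a1 + a3] 1) 1"

definition wilson_seqs :: "(nat \<Rightarrow> complex poly) set" where
  "wilson_seqs = {Q. (\<forall>n. degree (Q n) = n) \<and>
     (\<exists>a1 a2 a3 a4 p q. p \<noteq> 0 \<and>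
        a1 + a2 \<notin> \<int>\<^sub>\<le>\<^sub>0 \<and> a1 + a3 \<notin> \<int>\<^sub>\<le>\<^sub>0 \<and> a1 + a4 \<notin> \<int>\<^sub>\<le>\<^sub>0 \<and>
        (\<forall>n. \<exists>\<kappa>. \<kappa> \<noteq> 0 \<and>
           (\<forall>y. poly (Q n) (p * y\<^sup>2 + q) = \<kappa> * wilson_fun a1 a2 a3 a4 n y)))}"

definition cont_dual_hahn_seqs :: "(nat \<Rightarrow> complex poly) set" where
  "cont_dual_hahn_seqs = {Q. (\<forall>n. degree (Q n) = n) \<and>
     (\<exists>a1 a2 a3 p q. p \<noteq> 0 \<and>
        a1 + a2 \<notin> \<int>\<^sub>\<le>\<^sub>0 \<and> a1 + a3 \<notin> \<int>\<^sub>\<le>\<^sub>0 \<and>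
        (\<forall>n. \<exists>\<kappa>. \<kappa> \<noteq> 0 \<and>
           (\<forall>y. poly (Q n) (p * y\<^sup>2 + q) = \<kappa> * cont_dual_hahn_fun a1 a2 a3 n y)))}"

text \<open>
  Limits are taken coefficientwise for each \<open>n\<close>. The parameters and the affine change vary with \<open>m\<close>
  but are common to all members of the sequence \<open>Q m\<close>. A constant sequence gives the cases obtained
  by mere specialization.
\<close>

definition limiting_case :: "(nat \<Rightarrow> complex poly) set \<Rightarrow> (nat \<Rightarrow> complex poly) \<Rightarrow> bool" where
  "limiting_case F P \<longleftrightarrow>
     (\<exists>Q :: nat \<Rightarrow> nat \<Rightarrow> complex poly. (\<forall>m. Q m \<in> F) \<and>
        (\<forall>n k. (\<lambda>m. coeff (Q m n) k) \<longlonglongrightarrow> coeff (P n) k))"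

end

theory Submission
  imports Defs
begin

text \<open>
  With \<open>w\<^sup>2 = 4\<beta>z + c\<^sub>5\<^sup>2/4\<close> one has \<open>x(s \<plusminus> 1/2) = z + \<beta> \<plusminus> w\<close>. Put \<open>\<sigma> = az\<^sup>2 + bz + c\<close> and let \<open>A\<close> be the
  operator with \<open>S A = \<sigma> D\<close>; the structure relation says that \<open>A\<close>, like the multiplication \<open>X\<close> by \<open>z\<close>,
  is tridiagonal in the basis \<open>P\<^sub>n\<close>.

  The case \<open>a \<noteq> 0\<close> is impossible. The adjoint of \<open>A\<close> yields, after lifting \<open>u\<close> to polynomials in \<open>s\<close>,
  first-order equations for \<open>u\<close>, one for each \<open>n\<close>. As \<open>u\<close> is regular, any two of them are proportional,
  which is a difference equation for \<open>P\<^sub>n\<close> and \<open>\<Theta>\<^sub>n = k P\<^sub>1 P\<^sub>n - A\<^sup>* P\<^sub>n\<close>. Its leading coefficients give two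
  expressions for the second coefficient of \<open>P\<^sub>n\<close>, asymptotic to \<open>-\<beta>n\<^sup>3/3\<close> and \<open>-4\<beta>n\<^sup>3/3\<close>, unless the
  equation degenerates; the degenerate case is a one-parameter family, which the relations for
  \<open>n \<le> 3\<close> exclude.

  So \<open>a = 0\<close> and \<open>\<aa> = 0\<close>. The relations for \<open>n \<le> 4\<close> and the second side condition show that \<open>\<sigma>\<close> is a
  multiple of \<open>w\<^sup>2\<close>. If \<open>\<sigma> = w\<^sup>2\<close>, then \<open>[A, X] = 4\<beta>(X - A - \<beta>) + c\<^sub>5\<^sup>2/4 - A\<^sup>2\<close>, and this determines \<open>B\<^sub>n\<close>
  and \<open>C\<^sub>n\<close>: they belong to continuous dual Hahn polynomials with one parameter equal to \<open>1/2\<close>, or to their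
  limit for \<open>\<beta> \<rightarrow> 0\<close>. The operator \<open>L = \<phi>D\<^sup>2 + \<psi>SD\<close> satisfies
  \<open>[[L, X], X] = 8\<beta>[L, X] + 4(w\<^sup>2 - 4\<beta>\<^sup>2)L + 2\<phi> - 4\<beta>\<psi>\<close>, from which \<open>L P\<^sub>n = n P\<^sub>n\<close> follows by induction.
\<close>

section \<open>The operators on polynomials\<close>

locale quadratic_lattice =
  fixes \<beta> c5 :: complex
  assumes nontrivial: "(\<beta>, c5) \<noteq> (0, 0)"
begin

abbreviation S :: "complex poly \<Rightarrow> complex poly" where "S \<equiv> Sx \<beta> c5"
abbreviation D :: "complex poly \<Rightarrow> complex poly" where "D \<equiv> Dx \<beta> c5"

definition \<omega> :: complex where "\<omega> = c5\<^sup>2 / 4"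

definition w2 :: "complex poly" where "w2 = [:\<omega>, 4 * \<beta>:]"

definition w :: "complex \<Rightarrow> complex" where "w s = 4 * \<beta> * s + c5 / 2"
abbreviation x :: "complex \<Rightarrow> complex" where "x \<equiv> lattice \<beta> c5"

lemma \<omega>_nonzero: "\<beta> = 0 \<Longrightarrow> \<omega> \<noteq> 0"
  using nontrivial by (auto simp: \<omega>_def)

lemma w_sq: "w s * w s = poly w2 (x s)"
  using lattice_shift(3)[of \<beta> s c5] by (simp add: w2_def \<omega>_def w_def power2_eq_square algebra_simps)

lemma x_shift: "x (s + 1/2) = x s + \<beta> + w s" "x (s - 1/2) = x s + \<beta> - w s"
  by (simp_all only: lattice_shift w_def)

text \<open>Where \<open>w s\<close> vanishes, the quotient behind \<open>D\<close> says nothing,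
  but then the two shifted points coincide. So the identities, with \<open>w s\<close> multiplied
  in, hold for every \<open>s\<close>.\<close>

lemma shift_plus: "poly f (x (s + 1/2)) = poly (S f) (x s) + w s * poly (D f) (x s)"
  and shift_minus: "poly f (x (s - 1/2)) = poly (S f) (x s) - w s * poly (D f) (x s)"
proof -
  have S: "poly (S f) (x s) = (poly f (x (s + 1/2)) + poly f (x (s - 1/2))) / 2"
    by (rule poly_Sx[OF nontrivial])
  have diff: "x (s + 1/2) - x (s - 1/2) = 2 * w s"
    unfolding x_shift by simp
  have D: "poly f (x (s + 1/2)) - poly f (x (s - 1/2)) = 2 * w s * poly (D f) (x s)"
  proof (cases "x (s + 1/2) = x (s - 1/2)")
    case True
    then show ?thesis using diff by simp
  next
    case False
    then have "w s \<noteq> 0" using diff by auto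
    then show ?thesis
      using poly_Dx[OF nontrivial False, of f] by (simp add: diff)
  qed
  show "poly f (x (s + 1/2)) = poly (S f) (x s) + w s * poly (D f) (x s)"
    using D unfolding S by algebra
  show "poly f (x (s - 1/2)) = poly (S f) (x s) - w s * poly (D f) (x s)"
    using D unfolding S by algebra
qed

lemma finite_w_zero: "finite {s. w s = 0}"
proof -
  have "[:c5 / 2, 4 * \<beta>:] \<noteq> 0" using nontrivial by auto
  then have "finite {s. poly [:c5 / 2, 4 * \<beta>:] s = 0}" by (rule poly_roots_finite)
  then show ?thesis by (simp add: w_def algebra_simps)
qed

text \<open>\<open>S\<close> and \<open>D\<close> are the components that are even and odd in the
  sign of \<open>w\<close>. Sum and difference of the hypotheses isolate them, and \<open>w\<close>
  has only finitely many zeros.\<close>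

lemma SD_eqI:
  assumes "\<And>s. poly f (x (s + 1/2)) = poly g (x s) + w s * poly h (x s)"
    and "\<And>s. poly f (x (s - 1/2)) = poly g (x s) - w s * poly h (x s)"
  shows "S f = g \<and> D f = h"
proof
  show "S f = g"
  proof (rule poly_eqI_lattice[OF nontrivial finite.emptyI])
    fix s
    show "poly (S f) (x s) = poly g (x s)"
      by (simp only: poly_Sx[OF nontrivial] assms) simp
  qed
  show "D f = h"
  proof (rule poly_eqI_lattice[OF nontrivial finite_w_zero])
    fix s assume "s \<notin> {s. w s = 0}"
    moreover have "2 * w s * poly (D f) (x s) = 2 * w s * poly h (x s)"
      using assms[of s] shift_plus[of f s] shift_minus[of f s] by algebra
    ultimately show "poly (D f) (x s) = poly h (x s)" by simp
  qed
qed

lemma SD_add: "S (f + g) = S f + S g \<and> D (f + g) = D f + D g"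
proof (rule SD_eqI)
  fix s
  show "poly (f + g) (x (s + 1/2)) = poly (S f + S g) (x s) + w s * poly (D f + D g) (x s)"
    unfolding poly_add shift_plus[of f] shift_plus[of g] by algebra
  show "poly (f + g) (x (s - 1/2)) = poly (S f + S g) (x s) - w s * poly (D f + D g) (x s)"
    unfolding poly_add shift_minus[of f] shift_minus[of g] by algebra
qed

text \<open>\<open>S f + w * D f\<close> is the value of \<open>f\<close> at a shifted point, hence
  multiplicative in \<open>f\<close>; replacing \<open>w * w\<close> by \<open>w2\<close> sorts the
  product into its two components.\<close>

lemma SD_mult: "S (f * g) = S f * S g + w2 * D f * D g \<and> D (f * g) = D f * S g + S f * D g"
proof (rule SD_eqI)
  fix s
  show "poly (f * g) (x (s + 1/2)) = poly (S f * S g + w2 * D f * D g) (x s)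
      + w s * poly (D f * S g + S f * D g) (x s)"
    unfolding poly_add poly_mult shift_plus[of f] shift_plus[of g] w_sq[symmetric] by algebra
  show "poly (f * g) (x (s - 1/2)) = poly (S f * S g + w2 * D f * D g) (x s)
      - w s * poly (D f * S g + S f * D g) (x s)"
    unfolding poly_add poly_mult shift_minus[of f] shift_minus[of g] w_sq[symmetric] by algebra
qed

lemma SD_const: "S [:k:] = [:k:] \<and> D [:k:] = 0"
  by (rule SD_eqI) simp_all

lemma SD_var: "S [:0, 1:] = [:\<beta>, 1:] \<and> D [:0, 1:] = 1"
  by (rule SD_eqI) (simp_all add: x_shift del: divide_inverse)

lemmas S_add [simp] = SD_add[THEN conjunct1]
lemmas D_add [simp] = SD_add[THEN conjunct2]
lemmas S_mult = SD_mult[THEN conjunct1]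
lemmas D_mult = SD_mult[THEN conjunct2]

lemma S_const [simp]: "S [:k:] = [:k:]" "S 0 = 0" "S 1 = 1"
  using SD_const[of k] SD_const[of 0] SD_const[of 1] by (simp_all add: one_pCons)

lemma D_const [simp]: "D [:k:] = 0" "D 0 = 0" "D 1 = 0"
  using SD_const[of k] SD_const[of 0] SD_const[of 1] by (simp_all add: one_pCons)

lemma S_smult [simp]: "S (smult k f) = smult k (S f)"
  using SD_mult[of "[:k:]" f] by simp

lemma D_smult [simp]: "D (smult k f) = smult k (D f)"
  using SD_mult[of "[:k:]" f] by simp

lemma S_uminus [simp]: "S (- f) = - S f"
  using S_smult[of "-1" f] by simp

lemma D_uminus [simp]: "D (- f) = - D f"
  using D_smult[of "-1" f] by simp

lemma S_diff [simp]: "S (f - g) = S f - S g"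
  using S_add[of f "- g"] by simp

lemma D_diff [simp]: "D (f - g) = D f - D g"
  using D_add[of f "- g"] by simp

lemma S_sum: "S (sum f I) = (\<Sum>i\<in>I. S (f i))"
  by (induction I rule: infinite_finite_induct) simp_all

lemma D_sum: "D (sum f I) = (\<Sum>i\<in>I. D (f i))"
  by (induction I rule: infinite_finite_induct) simp_all

lemma S_var_mult: "S ([:0, 1:] * p) = [:\<beta>, 1:] * S p + w2 * D p"
  and D_var_mult: "D ([:0, 1:] * p) = S p + [:\<beta>, 1:] * D p"
  using SD_mult[of "[:0, 1:]" p] SD_var by simp_all

lemma S_pCons: "S (pCons k p) = [:k:] + [:\<beta>, 1:] * S p + w2 * D p"
  and D_pCons: "D (pCons k p) = S p + [:\<beta>, 1:] * D p"
proof -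
  have "pCons k p = [:k:] + [:0, 1:] * p" by simp
  then show "S (pCons k p) = [:k:] + [:\<beta>, 1:] * S p + w2 * D p"
      "D (pCons k p) = S p + [:\<beta>, 1:] * D p"
    by (simp_all only: S_add D_add S_var_mult D_var_mult S_const D_const) simp_all
qed

lemma SD_w2: "S w2 = w2 + [:4 * \<beta>\<^sup>2:]" "D w2 = [:4 * \<beta>:]"
  by (simp_all add: w2_def S_pCons D_pCons power2_eq_square)

text \<open>Both identities go through one induction, because the rules for multiplication by the
  variable mix \<open>S\<close> and \<open>D\<close>.\<close>

lemma commute: "D (S f) = S (D f) + smult (2 * \<beta>) (D (D f)) \<and>
    S (S f) = f + smult (2 * \<beta>) (S (D f)) + w2 * D (D f)"
proof (induction f)
  case 0
  show ?case by simp
next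
  case (pCons k p)
  have bS: "S [:\<beta>, 1:] = [:2*\<beta>, 1:]" and bD: "D [:\<beta>, 1:] = 1"
    by (simp_all add: S_pCons D_pCons one_pCons)
  have w2: "poly w2 t = \<omega> + 4 * \<beta> * t" for t by (simp add: w2_def)
  have IH1: "poly (D (S p)) t = poly (S (D p)) t + 2 * \<beta> * poly (D (D p)) t" for t
    using pCons(2) by simp
  have IH2: "poly (S (S p)) t = poly p t + 2 * \<beta> * poly (S (D p)) t + poly w2 t * poly (D (D p)) t" for t
    using pCons(2) by simp
  show ?case
    by (simp only: poly_eq_poly_eq_iff[symmetric] fun_eq_iff S_pCons D_pCons S_add D_add S_mult D_mult
        bS bD SD_w2 S_const D_const poly_add poly_mult poly_smult poly_pCons poly_0 poly_1 IH1 IH2 w2)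
      (intro conjI allI; algebra)
qed

lemmas D_S = commute[THEN conjunct1]
lemmas S_S = commute[THEN conjunct2]

text \<open>Second coefficients: \<open>S\<close> maps z^n to z^n + \<open>s1 n\<close> z^(n-1) +
  ..., and \<open>D\<close> maps it to n z^(n-1) + \<open>d1 n\<close> z^(n-2) + ....\<close>

definition s1 :: "nat \<Rightarrow> complex" where "s1 n = \<beta> * of_nat n * (2 * of_nat n - 1)"
definition d1 :: "nat \<Rightarrow> complex" where "d1 n = \<beta> * of_nat n * (2 * of_nat n - 1) * (of_nat n - 1) / 3"

lemma coeff_lin_mult: "coeff ([:a, b:] * p) 0 = a * coeff p 0"
  "coeff ([:a, b:] * p) (Suc n) = a * coeff p (Suc n) + b * coeff p n"
  by simp_all

lemma coeff_SD_high: "degree f \<le> n \<Longrightarrow> (\<forall>m>n. coeff (S f) m = 0) \<and> (\<forall>m\<ge>n. coeff (D f) m = 0)"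
proof (induction f arbitrary: n)
  case 0
  then show ?case by simp
next
  case (pCons k p)
  show ?case
  proof (cases "p = 0")
    case True
    then show ?thesis by (auto simp: coeff_pCons split: nat.split)
  next
    case False
    then obtain m where n: "n = Suc m" and m: "degree p \<le> m"
      using pCons.prems by (cases n) (auto split: if_splits)
    note IH = pCons.IH[OF m]
    have "coeff (S (pCons k p)) j = 0" if j: "j > n" for j
    proof -
      obtain i where i: "j = Suc i" "i > m" using j n by (cases j) auto
      then show ?thesis using IH by (simp add: S_pCons w2_def coeff_lin_mult)
    qed
    moreover have "coeff (D (pCons k p)) j = 0" if j: "j \<ge> n" for j
    proof -
      obtain i where i: "j = Suc i" "i \<ge> m" using j n by (cases j) auto
      then show ?thesis using IH by (simp add: D_pCons coeff_lin_mult)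
    qed
    ultimately show ?thesis by blast
  qed
qed

lemma coeff_SD:
  assumes "degree f \<le> n"
  shows "coeff (S f) n = coeff f n"
    and "n > 0 \<Longrightarrow> coeff (S f) (n - 1) = coeff f (n - 1) + s1 n * coeff f n"
    and "n > 0 \<Longrightarrow> coeff (D f) (n - 1) = of_nat n * coeff f n"
    and "n > 1 \<Longrightarrow> coeff (D f) (n - 2) = (of_nat n - 1) * coeff f (n - 1) + d1 n * coeff f n"
proof -
  have "coeff (S f) n = coeff f n \<and>
    (n > 0 \<longrightarrow> coeff (S f) (n - 1) = coeff f (n - 1) + s1 n * coeff f n) \<and>
    (n > 0 \<longrightarrow> coeff (D f) (n - 1) = of_nat n * coeff f n) \<and>
    (n > 1 \<longrightarrow> coeff (D f) (n - 2) = (of_nat n - 1) * coeff f (n - 1) + d1 n * coeff f n)"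
    using assms
  proof (induction f arbitrary: n)
    case 0
    then show ?case by simp
  next
    case (pCons k p)
    show ?case
    proof (cases n)
      case 0
      then show ?thesis using pCons.prems by (auto split: if_splits)
    next
      case (Suc m)
      have m: "degree p \<le> m"
        using pCons.prems Suc by (auto split: if_splits)
      note IH = pCons.IH[OF m]
      note hi = coeff_SD_high[OF m]
      show ?thesis
      \<comment> \<open>The degree bounds \<open>n = 1\<close> and \<open>n = 2\<close> are computed
        by hand, since the induction hypothesis yields the second coefficient of \<open>D p\<close>
        only for \<open>m > 1\<close>.\<close>
      proof (cases m)
        case 0
        with m have "degree p = 0" by simp
        then obtain q where "p = [:q:]" by (rule degree_eq_zeroE)
        then show ?thesis using Suc 0 by (simp add: S_pCons D_pCons w2_def s1_def algebra_simps)
      next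
        case (Suc i)
        show ?thesis
        proof (cases i)
          case 0
          with m Suc have "degree p \<le> 1" by simp
          then have "p = [:coeff p 0, coeff p 1:]"
            by (intro poly_eqI) (auto simp: coeff_pCons coeff_eq_0 split: nat.split)
          then obtain q r where "p = [:q, r:]" by blast
          then show ?thesis using Suc 0 \<open>n = Suc m\<close>
            by (simp add: S_pCons D_pCons w2_def s1_def d1_def algebra_simps)
        next
          case (Suc j)
          note ms = \<open>n = Suc m\<close> \<open>m = Suc i\<close> Suc
          have *: "coeff (S p) m = coeff p m" "coeff (S p) i = coeff p i + s1 m * coeff p m"
            "coeff (D p) i = of_nat m * coeff p m" "coeff (D p) m = 0"
            "coeff (S p) n = 0" "coeff (D p) n = 0"
            "coeff (D p) j = (of_nat m - 1) * coeff p i + d1 m * coeff p m"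
            using IH hi ms by auto
          show ?thesis
            using * ms
            by (simp add: S_pCons D_pCons w2_def coeff_lin_mult s1_def d1_def field_simps)
        qed
      qed
    qed
  qed
  then show "coeff (S f) n = coeff f n"
    and "n > 0 \<Longrightarrow> coeff (S f) (n - 1) = coeff f (n - 1) + s1 n * coeff f n"
    and "n > 0 \<Longrightarrow> coeff (D f) (n - 1) = of_nat n * coeff f n"
    and "n > 1 \<Longrightarrow> coeff (D f) (n - 2) = (of_nat n - 1) * coeff f (n - 1) + d1 n * coeff f n"
    by blast+
qed

text \<open>\<open>S\<close> preserves leading coefficients. This makes the operator
  \<open>A\<close> with S A = \<sigma> D unique.\<close>

lemma S_inj: "S f = S g \<Longrightarrow> f = g"
proof -
  assume "S f = S g"
  then have "S (f - g) = 0" by simp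
  then have "lead_coeff (f - g) = 0"
    using coeff_SD(1)[of "f - g" "degree (f - g)"] by (metis coeff_0 order_refl)
  then show "f = g" by (metis eq_iff_diff_eq_0 leading_coeff_0_iff)
qed

end

section \<open>Functionals on polynomials in the lattice variable\<close>

lemma linear_functional:
  assumes "Vector_Spaces.linear smult (*) (u :: complex poly \<Rightarrow> complex)"
  shows "u (f + g) = u f + u g" "u (smult k f) = k * u f" "u 0 = 0" "u (- f) = - u f" "u (f - g) = u f - u g"
    "u (sum p I) = (\<Sum>i\<in>I. u (p i))"
proof -
  interpret Vector_Spaces.linear "smult :: complex \<Rightarrow> complex poly \<Rightarrow> complex poly" "(*)" u by fact
  show "u (f + g) = u f + u g" "u (smult k f) = k * u f" "u 0 = 0" "u (- f) = - u f" "u (f - g) = u f - u g"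
    "u (sum p I) = (\<Sum>i\<in>I. u (p i))"
    by (rule add scale zero neg diff sum)+
qed

context quadratic_lattice
begin

definition lift :: "complex poly \<Rightarrow> complex poly" where "lift f = f \<circ>\<^sub>p [:0, c5, 4 * \<beta>:]"
definition W :: "complex poly" where "W = [:c5 / 2, 4 * \<beta>:]"

lemma poly_lift [simp]: "poly (lift f) s = poly f (x s)"
  by (simp add: lift_def poly_pcompose lattice_def power2_eq_square algebra_simps)

lemma poly_W [simp]: "poly W s = w s"
  by (simp add: W_def w_def)

lemma lift_simps: "lift (f + g) = lift f + lift g" "lift (f * g) = lift f * lift g"
  "lift (smult k f) = smult k (lift f)" "lift 0 = 0"
  by (simp_all add: lift_def pcompose_add pcompose_mult pcompose_smult)

lemma lift_inj: "lift f = lift g \<Longrightarrow> f = g"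
  by (rule poly_eqI_lattice[OF nontrivial finite.emptyI]) (metis poly_lift)

lemma w_half: "w (s + 1/2) = w s + 2 * \<beta>" "w (s - 1/2) = w s - 2 * \<beta>" "w (s + 1) = w s + 4 * \<beta>"
  by (simp_all add: w_def algebra_simps)

text \<open>A polynomial in \<open>s\<close> splits into an even and an odd part with respect to the symmetry
  of the lattice, unless \<open>\<beta> = 0\<close>, where every polynomial in \<open>s\<close> is one in \<open>z\<close>.\<close>

lemma lift_decomposition:
  assumes "\<beta> \<noteq> 0" shows "\<exists>f g. p = lift f + W * lift g"
proof (induction p)
  case 0
  show ?case by (rule exI[of _ 0], rule exI[of _ 0]) (simp add: lift_simps)
next
  case (pCons k p)
  then obtain f g where p: "p = lift f + W * lift g" by blast
  \<comment> \<open>Multiplication by s = (w - c5/2) / (4\<beta>) acts on the pair \<open>f\<close>,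
    \<open>g\<close> in this way, because w * w = \<open>w2\<close>.\<close>
  have "pCons k p = lift ([:k:] + smult (- c5 / (8 * \<beta>)) f + smult (1 / (4 * \<beta>)) (w2 * g))
      + W * lift (smult (1 / (4 * \<beta>)) f + smult (- c5 / (8 * \<beta>)) g)"
  proof (rule poly_ext)
    fix s
    have "w s = 4 * \<beta> * s + c5 / 2" by (simp add: w_def)
    then have s: "s = (w s - c5 / 2) / (4 * \<beta>)" using assms by (simp add: field_simps)
    have "poly (pCons k p) s = k + (w s - c5 / 2) / (4 * \<beta>) * (poly f (x s) + w s * poly g (x s))"
      by (subst s[symmetric]) (simp add: p)
    also have "\<dots> = k - c5 / (8 * \<beta>) * poly f (x s) + (w s * w s) / (4 * \<beta>) * poly g (x s)
        + w s * (poly f (x s) / (4 * \<beta>) - c5 / (8 * \<beta>) * poly g (x s))"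
      using assms by (simp add: field_simps)
    finally show "poly (pCons k p) s = poly (lift ([:k:] + smult (- c5 / (8 * \<beta>)) f + smult (1 / (4 * \<beta>)) (w2 * g))
      + W * lift (smult (1 / (4 * \<beta>)) f + smult (- c5 / (8 * \<beta>)) g)) s"
      by (simp add: w_sq)
  qed
  then show ?case by blast
qed

lemma lift_decomposition_unique:
  assumes "\<beta> \<noteq> 0" and "lift f + W * lift g = lift f' + W * lift g'"
  shows "f = f'" and "g = g'"
proof -
  \<comment> \<open>The reflection of the \<open>s\<close>-plane that fixes \<open>x\<close> and
    negates \<open>w\<close>.\<close>
  define r where "r s = - s - c5 / (4 * \<beta>)" for s
  have r: "x (r s) = x s" "w (r s) = - w s" for s
    using assms(1) by (simp_all add: r_def lattice_def w_def field_simps power2_eq_square)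
  have *: "poly f (x s) + w s * poly g (x s) = poly f' (x s) + w s * poly g' (x s)" for s
    using arg_cong[OF assms(2), of "\<lambda>p. poly p s"] by simp
  have **: "poly f (x s) - w s * poly g (x s) = poly f' (x s) - w s * poly g' (x s)" for s
    using *[of "r s"] by (simp add: r)
  show "f = f'"
  proof (rule poly_eqI_lattice[OF nontrivial finite.emptyI])
    fix s
    show "poly f (x s) = poly f' (x s)" using *[of s] **[of s] by algebra
  qed
  show "g = g'"
  proof (rule poly_eqI_lattice[OF nontrivial finite_w_zero])
    fix s assume "s \<notin> {s. w s = 0}"
    moreover have "2 * w s * poly g (x s) = 2 * w s * poly g' (x s)"
      using *[of s] **[of s] by algebra
    ultimately show "poly g (x s) = poly g' (x s)" by simp
  qed
qed

lemma linear_case: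
  assumes "\<beta> = 0" shows "c5 \<noteq> 0" "x s = c5 * s" "w s = c5 / 2"
  unfolding w_def lattice_def using nontrivial assms by auto

lemma lift_surj:
  assumes "\<beta> = 0" shows "\<exists>f. p = lift f"
proof
  show "p = lift (p \<circ>\<^sub>p [:0, 1 / c5:])"
    by (rule poly_ext) (simp add: poly_pcompose linear_case[OF assms])
qed

definition even_part :: "complex poly \<Rightarrow> complex poly" where
  "even_part p = (SOME f. \<exists>g. p = lift f + W * lift g)"
text \<open>The lift of \<open>u\<close> to polynomials in \<open>s\<close> sends \<open>p\<close>
  to \<open>u (odd_part p)\<close>. For \<beta> = 0 the function \<open>w\<close> is the constant
  \<open>c5 / 2\<close> and all of \<open>p\<close> counts as \<open>W * lift g\<close>; hence the
  factor \<open>2 / c5\<close>, and \<open>odd_part (W * lift f) = f\<close> in both cases.\<close>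

definition odd_part :: "complex poly \<Rightarrow> complex poly" where
  "odd_part p = (if \<beta> = 0 then smult (2 / c5) (SOME f. p = lift f)
     else (SOME g. p = lift (even_part p) + W * lift g))"

lemma odd_part_eqI:
  assumes "\<beta> \<noteq> 0" "p = lift f + W * lift g"
  shows "odd_part p = g"
proof -
  have "\<exists>g. p = lift (even_part p) + W * lift g"
    unfolding even_part_def by (rule someI_ex) (use assms(2) in blast)
  then have "p = lift (even_part p) + W * lift (odd_part p)"
    unfolding odd_part_def if_not_P[OF assms(1)] by (rule someI_ex)
  then show ?thesis using lift_decomposition_unique[OF assms(1)] assms(2) by metis
qed

lemma odd_part_eqI_0:
  assumes "\<beta> = 0" "p = lift f"
  shows "odd_part p = smult (2 / c5) f"
proof -
  have "p = lift (SOME f. p = lift f)" by (rule someI[of _ f]) fact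
  then have "(SOME f. p = lift f) = f" using lift_inj assms(2) by metis
  then show ?thesis unfolding odd_part_def if_P[OF assms(1)] by simp
qed

lemma odd_part_W_mult: "odd_part (W * lift f) = f"
proof (cases "\<beta> = 0")
  case True
  have "W * lift f = lift (smult (c5 / 2) f)"
    by (rule poly_ext) (simp add: linear_case[OF True])
  with odd_part_eqI_0[OF True this] show ?thesis using linear_case(1)[OF True] by simp
next
  case False
  show ?thesis by (rule odd_part_eqI[OF False, of _ 0]) (simp add: lift_simps)
qed

lemma odd_part_add: "odd_part (p + q) = odd_part p + odd_part q"
proof (cases "\<beta> = 0")
  case True
  then obtain f g where "p = lift f" "q = lift g" using lift_surj by meson
  moreover from this have "p + q = lift (f + g)" by (simp add: lift_simps)
  ultimately show ?thesis
    by (metis odd_part_eqI_0[OF True] smult_add_right)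
next
  case False
  then obtain f f' g g' where "p = lift f + W * lift g" "q = lift f' + W * lift g'"
    using lift_decomposition by meson
  moreover from this have "p + q = lift (f + f') + W * lift (g + g')"
    by (simp add: lift_simps algebra_simps)
  ultimately show ?thesis using odd_part_eqI[OF False] by metis
qed

lemma odd_part_lift: "\<beta> \<noteq> 0 \<Longrightarrow> odd_part (lift f) = 0"
  by (rule odd_part_eqI[of _ f 0]) (simp_all add: lift_simps)

text \<open>The lifted functional inherits regularity: for \<beta> \<noteq> 0, multiples of
  \<open>lift h\<close> detect the odd component of \<open>p\<close>, and then multiples of
  \<open>W * lift h\<close> the even one.\<close>

lemma odd_part_regular:
  assumes u: "Vector_Spaces.linear smult (*) u" "\<And>q. (\<And>g. u (q * g) = 0) \<Longrightarrow> q = 0"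
    and "\<And>h. u (odd_part (p * h)) = (0 :: complex)"
  shows "p = 0"
proof (cases "\<beta> = 0")
  case True
  then obtain f where f: "p = lift f" using lift_surj by blast
  have "u (f * g) = 0" for g
  proof -
    have "p * (W * lift g) = W * lift (f * g)" by (simp add: f lift_simps)
    then show ?thesis using assms(3)[of "W * lift g"] by (simp only: odd_part_W_mult)
  qed
  then have "f = 0" by (rule u(2))
  then show ?thesis by (simp add: f lift_simps)
next
  case False
  then obtain f g where p: "p = lift f + W * lift g" using lift_decomposition by blast
  have "u (g * h) = 0" for h
  proof -
    have "odd_part (p * lift h) = g * h"
      by (rule odd_part_eqI[OF False, of _ "f * h"]) (simp add: p lift_simps algebra_simps)
    then show ?thesis using assms(3)[of "lift h"] by simp
  qed
  then have "g = 0" by (rule u(2))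
  have "u (f * h) = 0" for h
  proof -
    have "odd_part (p * (W * lift h)) = f * h"
      by (rule odd_part_eqI[OF False, of _ 0]) (simp add: p \<open>g = 0\<close> lift_simps algebra_simps)
    then show ?thesis using assms(3)[of "W * lift h"] by simp
  qed
  then have "f = 0" by (rule u(2))
  then show ?thesis by (simp add: p \<open>g = 0\<close> lift_simps)
qed

end

section \<open>A first-order equation for regular functionals\<close>

context quadratic_lattice
begin

definition half :: "complex poly \<Rightarrow> complex poly" where "half p = p \<circ>\<^sub>p [:1/2, 1:]"
definition half' :: "complex poly \<Rightarrow> complex poly" where "half' p = p \<circ>\<^sub>p [:- 1/2, 1:]"

lemma poly_half [simp]: "poly (half p) s = poly p (s + 1/2)" "poly (half' p) s = poly p (s - 1/2)"
  by (simp_all add: half_def half'_def poly_pcompose algebra_simps)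

lemma poly_half_half: "poly (half (half p)) s = poly p (s + 1)" "poly (half' (half' p)) s = poly p (s - 1)"
  by (simp_all add: add.commute)

lemma half_simps: "half (p + q) = half p + half q" "half (p * q) = half p * half q"
  "half' (p + q) = half' p + half' q" "half' (p * q) = half' p * half' q"
  "half (half' p) = p" "half' (half p) = p" "half 0 = 0" "half' 0 = 0"
  by (rule poly_ext; simp add: algebra_simps)+

text \<open>The correction term is dictated by \<open>D_S\<close>: with it, \<open>D\<close> after
  \<open>reduced\<close> equals \<open>S\<close> after \<open>D\<close>.\<close>

definition reduced :: "complex poly \<Rightarrow> complex poly" where "reduced f = S f - smult (2 * \<beta>) (D f)"

lemma D_reduced: "D (reduced f) = S (D f)"
  by (simp add: reduced_def D_S)

text \<open>In the product rule the terms with \<open>S f\<close> cancel, and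
  \<open>S (reduced \<sigma>)\<close> exceeds \<sigma> by exactly the term
  \<open>w2 * D (D \<sigma>)\<close> that \<open>S (D \<sigma> * f)\<close> removes.\<close>

lemma mult_D: "\<sigma> * D f = D (reduced \<sigma> * f) - S (D \<sigma> * f)"
proof -
  have "S (reduced \<sigma>) = \<sigma> + w2 * D (D \<sigma>)"
    by (simp add: reduced_def S_S)
  then show ?thesis by (simp add: D_mult S_mult D_reduced algebra_simps)
qed

text \<open>A first-order equation of Pearson type for \<open>u\<close> in weak form. Quantifying
  over pairs \<open>f\<close>, \<open>g\<close> avoids an inverse of \<open>reduced\<close>.\<close>

definition pearson :: "(complex poly \<Rightarrow> complex) \<Rightarrow> complex poly \<Rightarrow> complex poly \<Rightarrow> complex poly \<Rightarrow> bool" where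
  "pearson u \<tau> R \<pi> \<longleftrightarrow> (\<forall>f g. reduced f = \<tau> * g \<longrightarrow> u (\<pi> * D f) = u (R * g))"

text \<open>The coefficients of the test polynomial at s + 1/2 (\<open>lo\<close>) and at s - 1/2
  (\<open>hi\<close>) in the lifted equation, up to the factors \<tau>(x(s + 1)) and \<tau>(x(s -
  1)).\<close>

definition lo :: "complex poly \<Rightarrow> complex poly \<Rightarrow> complex poly \<Rightarrow> complex poly" where
  "lo \<tau> R \<pi> = (W - [:2 * \<beta>:]) * lift R - lift (\<pi> * \<tau>)"
definition hi :: "complex poly \<Rightarrow> complex poly \<Rightarrow> complex poly \<Rightarrow> complex poly" where
  "hi \<tau> R \<pi> = (W + [:2 * \<beta>:]) * lift R + lift (\<pi> * \<tau>)"

text \<open>Converts the weak equation, whose test pairs are constrained, into an equation for the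
  lifted functional with an arbitrary polynomial \<open>l\<close> in \<open>s\<close>.\<close>

lemma odd_part_pearson:
  assumes u: "Vector_Spaces.linear smult (*) u" and P: "pearson u \<tau> R \<pi>"
  shows "u (odd_part (lo \<tau> R \<pi> * half (half (lift \<tau>)) * half l
      + hi \<tau> R \<pi> * half' (half' (lift \<tau>)) * half' l)) = 0"
proof -
  note lin = linear_functional[OF u]
  \<comment> \<open>Two half-steps: \<tau>(x(s + 1)) and \<tau>(x(s - 1)) are \<open>E0\<close> plus
    and minus w times \<open>E1\<close>.\<close>
  define E0 where "E0 = S (S \<tau>) + smult (2 * \<beta>) (S (D \<tau>)) + w2 * D (D \<tau>)"
  define E1 where "E1 = D (S \<tau>) + S (D \<tau>) + smult (2 * \<beta>) (D (D \<tau>))"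
  have t2: "poly \<tau> (x (s + 1)) = poly E0 (x s) + w s * poly E1 (x s)"
      "poly \<tau> (x (s - 1)) = poly E0 (x s) - w s * poly E1 (x s)" for s
  proof -
    have "poly \<tau> (x (s + 1)) = poly \<tau> (x ((s + 1/2) + 1/2))" by (simp add: add.commute)
    also have "\<dots> = poly (S \<tau>) (x (s + 1/2)) + w (s + 1/2) * poly (D \<tau>) (x (s + 1/2))"
      by (rule shift_plus)
    also have "\<dots> = poly E0 (x s) + w s * poly E1 (x s)"
      unfolding shift_plus[of "S \<tau>"] shift_plus[of "D \<tau>"] w_half E0_def E1_def poly_add poly_mult
        poly_smult w_sq[symmetric] by algebra
    finally show "poly \<tau> (x (s + 1)) = poly E0 (x s) + w s * poly E1 (x s)" .
    have "poly \<tau> (x (s - 1)) = poly \<tau> (x ((s - 1/2) - 1/2))" by simp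
    also have "\<dots> = poly (S \<tau>) (x (s - 1/2)) - w (s - 1/2) * poly (D \<tau>) (x (s - 1/2))"
      by (rule shift_minus)
    also have "\<dots> = poly E0 (x s) - w s * poly E1 (x s)"
      unfolding shift_minus[of "S \<tau>"] shift_minus[of "D \<tau>"] w_half E0_def E1_def poly_add poly_mult
        poly_smult w_sq[symmetric] by algebra
    finally show "poly \<tau> (x (s - 1)) = poly E0 (x s) - w s * poly E1 (x s)" .
  qed
  \<comment> \<open>Both shifts of \<open>G\<close> contain the factor \<tau>(x(s)). Hence
    \<open>reduced (G * m)\<close> and \<open>D (G * m)\<close> are multiples of \<tau> for every
    \<open>m\<close>, and the hypothesis applies to them.\<close>
  define G where "G = S \<tau> * S \<tau> - w2 * D \<tau> * D \<tau>"
  have G: "poly G (x (s + 1/2)) = poly \<tau> (x s) * poly \<tau> (x (s + 1))"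
      "poly G (x (s - 1/2)) = poly \<tau> (x s) * poly \<tau> (x (s - 1))" for s
  proof -
    have *: "poly G (x t) = poly \<tau> (x (t + 1/2)) * poly \<tau> (x (t - 1/2))" for t
      unfolding shift_plus[of \<tau>] shift_minus[of \<tau>] G_def poly_diff poly_mult w_sq[symmetric] by algebra
    show "poly G (x (s + 1/2)) = poly \<tau> (x s) * poly \<tau> (x (s + 1))"
      "poly G (x (s - 1/2)) = poly \<tau> (x s) * poly \<tau> (x (s - 1))"
      using *[of "s + 1/2"] *[of "s - 1/2"] by (simp_all add: mult.commute add.commute)
  qed
  \<comment> \<open>\<open>p m\<close> and \<open>q m\<close> are the even and odd components of
    \<tau>(x(s + 1)) m(x(s + 1/2)).\<close>
  define p where "p m = E0 * S m + w2 * E1 * D m" for m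
  define q where "q m = E0 * D m + E1 * S m" for m
  have pq: "poly \<tau> (x (s + 1)) * poly m (x (s + 1/2)) = poly (p m) (x s) + w s * poly (q m) (x s)"
    "poly \<tau> (x (s - 1)) * poly m (x (s - 1/2)) = poly (p m) (x s) - w s * poly (q m) (x s)" for m s
    unfolding t2 shift_plus[of m] shift_minus[of m] p_def q_def poly_add poly_mult w_sq[symmetric]
    by algebra+
  have "S (G * m) = \<tau> * p m \<and> D (G * m) = \<tau> * q m" for m
    by (rule SD_eqI; simp only: poly_mult G mult.assoc pq; simp only: algebra_simps)
  then have "S (G * m) = \<tau> * p m" and DG: "D (G * m) = \<tau> * q m" for m
    by blast+
  then have SG: "reduced (G * m) = \<tau> * (p m - smult (2 * \<beta>) (q m))" for m
    by (simp add: reduced_def right_diff_distrib)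
  have zero: "u (R * p m - (smult (2 * \<beta>) R + \<pi> * \<tau>) * q m) = 0" for m
  proof -
    have "u (\<pi> * (\<tau> * q m)) = u (R * (p m - smult (2 * \<beta>) (q m)))"
      using P SG DG unfolding pearson_def by metis
    then show ?thesis
      by (simp add: lin algebra_simps)
  qed
  define F where "F l = lo \<tau> R \<pi> * half (half (lift \<tau>)) * half l
      + hi \<tau> R \<pi> * half' (half' (lift \<tau>)) * half' l" for l
  have F_lift: "F (lift m) = W * lift (smult 2 (R * p m - (smult (2 * \<beta>) R + \<pi> * \<tau>) * q m))" for m
  proof (rule poly_ext)
    fix s
    show "poly (F (lift m)) s = poly (W * lift (smult 2 (R * p m - (smult (2 * \<beta>) R + \<pi> * \<tau>) * q m))) s"
      unfolding F_def lo_def hi_def poly_mult poly_add poly_diff poly_half_half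
      unfolding poly_mult poly_add poly_diff poly_smult poly_W poly_lift
        poly_half poly_pCons poly_0
      using pq[where m = m and s = s] by algebra
  qed
  show ?thesis
  proof (cases "\<beta> = 0")
    case True
    then obtain m where "l = lift m" using lift_surj by blast
    then show ?thesis using zero[of m]
      by (simp only: F_def[symmetric] F_lift odd_part_W_mult lin) simp
  next
    case False
    then obtain m n where l: "l = lift m + W * lift n" using lift_decomposition by blast
    \<comment> \<open>For an odd test polynomial the expression is even, so \<open>odd_part\<close>
      kills it; the even component of \<open>l\<close> is governed by \<open>zero\<close>.\<close>
    have "F (W * lift n) = lift (smult 2 ((w2 - [:4 * \<beta>\<^sup>2:]) * R * p n
        - \<pi> * \<tau> * (w2 * q n + smult (2 * \<beta>) (p n))))"
    proof (rule poly_ext)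
      fix s
      show "poly (F (W * lift n)) s = poly (lift (smult 2 ((w2 - [:4 * \<beta>\<^sup>2:]) * R * p n
          - \<pi> * \<tau> * (w2 * q n + smult (2 * \<beta>) (p n))))) s"
        unfolding F_def lo_def hi_def poly_mult poly_add poly_diff poly_half_half
      unfolding poly_mult poly_add poly_diff poly_smult poly_W poly_lift
          poly_half poly_pCons poly_0 w_half w_sq[symmetric] power2_eq_square
        using pq[where m = n and s = s] by algebra
    qed
    moreover have "F l = F (lift m) + F (W * lift n)"
      by (simp add: F_def l half_simps algebra_simps)
    ultimately have "odd_part (F l) = smult 2 (R * p m - (smult (2 * \<beta>) R + \<pi> * \<tau>) * q m)"
      by (simp only: odd_part_add F_lift odd_part_W_mult odd_part_lift[OF False]) simp
    then show ?thesis unfolding F_def[symmetric] using zero[of m] by (simp only: lin) simp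
  qed
qed

text \<open>Test the first equation with \<open>g * half (hi \<tau> R' \<pi>')\<close> and the
  second with \<open>g * half (hi \<tau> R \<pi>)\<close>. The terms shifted by -1/2 then agree and
  cancel; regularity of the lifted functional turns the rest into an identity of
  polynomials.\<close>

lemma pearson_identity:
  assumes u: "Vector_Spaces.linear smult (*) u" "\<And>q. (\<And>g. u (q * g) = 0) \<Longrightarrow> q = 0"
    and P: "pearson u \<tau> R \<pi>" "pearson u \<tau> R' \<pi>'" and "\<tau> \<noteq> 0"
  shows "lo \<tau> R \<pi> * half (half (hi \<tau> R' \<pi>')) = lo \<tau> R' \<pi>' * half (half (hi \<tau> R \<pi>))"
proof -
  note lin = linear_functional[OF u(1)]
  let ?X = "half (half (lift \<tau>)) * (lo \<tau> R \<pi> * half (half (hi \<tau> R' \<pi>')) - lo \<tau> R' \<pi>' * half (half (hi \<tau> R \<pi>)))"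
  have "?X = 0"
  proof (rule odd_part_regular[OF u])
    fix h
    define g where "g = half' h"
    have h: "h = half g" by (simp add: g_def half_simps)
    let ?A = "lo \<tau> R \<pi> * half (half (lift \<tau>)) * half (g * half (hi \<tau> R' \<pi>'))
      + hi \<tau> R \<pi> * half' (half' (lift \<tau>)) * half' (g * half (hi \<tau> R' \<pi>'))"
    let ?B = "lo \<tau> R' \<pi>' * half (half (lift \<tau>)) * half (g * half (hi \<tau> R \<pi>))
      + hi \<tau> R' \<pi>' * half' (half' (lift \<tau>)) * half' (g * half (hi \<tau> R \<pi>))"
    have "?A = ?X * h + ?B"
      by (simp add: h half_simps algebra_simps)
    then have "u (odd_part ?A) = u (odd_part (?X * h)) + u (odd_part ?B)"
      by (simp only: odd_part_add lin)
    then show "u (odd_part (?X * h)) = 0"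
      using odd_part_pearson[OF u(1) P(1)] odd_part_pearson[OF u(1) P(2)] by simp
  qed
  moreover have "half (half (lift \<tau>)) \<noteq> 0"
  proof
    assume "half (half (lift \<tau>)) = 0"
    then have "lift \<tau> = lift 0" by (metis half_simps(6) half_simps(8) lift_simps(4))
    then show False using lift_inj \<open>\<tau> \<noteq> 0\<close> by blast
  qed
  ultimately show ?thesis by simp
qed

text \<open>Evaluating \<open>pearson_identity\<close> at s - 1/2 puts \<open>lo\<close> at s - 1/2
  and \<open>hi\<close> at s + 1/2, where \<open>S\<close> and \<open>D\<close> describe all
  factors. \<open>m\<close> and \<mu> are the even and odd components of
  \<open>hi \<tau> R 1\<close> at s + 1/2. The even terms cancel, leaving a multiple of 2w.\<close>

lemma pearson_difference_equation:
  assumes u: "Vector_Spaces.linear smult (*) u" "\<And>q. (\<And>g. u (q * g) = 0) \<Longrightarrow> q = 0"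
    and P: "pearson u \<tau> R 1" "pearson u \<tau> (\<pi> * R - \<Theta>) \<pi>" and "\<tau> \<noteq> 0"
    and m: "m = S \<tau> + w2 * D R + smult (4 * \<beta>) (S R)" "\<mu> = D \<tau> + S R + smult (4 * \<beta>) (D R)"
  shows "(m - smult (4 * \<beta>) \<mu>) * S \<Theta> + (smult (4 * \<beta>) m - w2 * \<mu>) * D \<Theta> = (m * m - w2 * \<mu> * \<mu>) * D \<pi>"
proof (rule poly_eqI_lattice[OF nontrivial finite_w_zero])
  fix s assume "s \<notin> {s. w s = 0}"
  then have ws: "w s \<noteq> 0" by simp
  have "poly (lo \<tau> (\<pi> * R - \<Theta>) \<pi>) (s - 1/2) * poly (hi \<tau> R 1) (s + 1/2)
      = poly (lo \<tau> R 1) (s - 1/2) * poly (hi \<tau> (\<pi> * R - \<Theta>) \<pi>) (s + 1/2)"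
    using arg_cong[OF pearson_identity[OF u P(2,1) \<open>\<tau> \<noteq> 0\<close>], of "\<lambda>p. poly p (s - 1/2)"] by simp
  moreover have "poly (lo \<tau> (\<pi> * R - \<Theta>) \<pi>) (s - 1/2) =
      (poly (S \<pi>) (x s) - w s * poly (D \<pi>) (x s)) * (w s * poly \<mu> (x s) - poly m (x s))
      - (w s - 4 * \<beta>) * (poly (S \<Theta>) (x s) - w s * poly (D \<Theta>) (x s))"
    unfolding lo_def m poly_diff poly_mult poly_add poly_W poly_lift poly_smult w_half w_sq[symmetric]
      shift_minus[of \<pi>] shift_minus[of R] shift_minus[of \<tau>] shift_minus[of \<Theta>] poly_pCons poly_0
    by algebra
  moreover have "poly (lo \<tau> R 1) (s - 1/2) = w s * poly \<mu> (x s) - poly m (x s)"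
    unfolding lo_def m poly_diff poly_mult poly_add poly_W poly_lift poly_smult w_half w_sq[symmetric]
      shift_minus[of R] shift_minus[of \<tau>] poly_pCons poly_0 poly_1
    by algebra
  moreover have "poly (hi \<tau> (\<pi> * R - \<Theta>) \<pi>) (s + 1/2) =
      (poly (S \<pi>) (x s) + w s * poly (D \<pi>) (x s)) * (poly m (x s) + w s * poly \<mu> (x s))
      - (w s + 4 * \<beta>) * (poly (S \<Theta>) (x s) + w s * poly (D \<Theta>) (x s))"
    unfolding hi_def m poly_diff poly_mult poly_add poly_W poly_lift poly_smult w_half w_sq[symmetric]
      shift_plus[of \<pi>] shift_plus[of R] shift_plus[of \<tau>] shift_plus[of \<Theta>] poly_pCons poly_0
    by algebra
  moreover have "poly (hi \<tau> R 1) (s + 1/2) = poly m (x s) + w s * poly \<mu> (x s)"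
    unfolding hi_def m poly_diff poly_mult poly_add poly_W poly_lift poly_smult w_half w_sq[symmetric]
      shift_plus[of R] shift_plus[of \<tau>] poly_pCons poly_0 poly_1
    by algebra
  ultimately have "2 * w s * poly ((m - smult (4 * \<beta>) \<mu>) * S \<Theta> + (smult (4 * \<beta>) m - w2 * \<mu>) * D \<Theta>) (x s)
      = 2 * w s * poly ((m * m - w2 * \<mu> * \<mu>) * D \<pi>) (x s)"
    unfolding poly_diff poly_mult poly_add poly_smult w_sq[symmetric] by algebra
  then show "poly ((m - smult (4 * \<beta>) \<mu>) * S \<Theta> + (smult (4 * \<beta>) m - w2 * \<mu>) * D \<Theta>) (x s)
      = poly ((m * m - w2 * \<mu> * \<mu>) * D \<pi>) (x s)"
    using ws by simp
qed

end

section \<open>Orthogonal polynomials with a structure relation\<close>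

locale structured_OPS = quadratic_lattice +
  fixes u :: "complex poly \<Rightarrow> complex" and P :: "nat \<Rightarrow> complex poly"
    and B C an bn cn :: "nat \<Rightarrow> complex" and a b c :: complex
  assumes OPS: "monic_OPS u P" and rec: "recurrence_coeffs P B C"
    and cn_nonzero: "\<And>n. cn n \<noteq> 0"
    and structure_rel: "\<And>n. [:c, b, a:] * Dx \<beta> c5 (P n) =
       smult (an n) (Sx \<beta> c5 (P (Suc n))) + smult (bn n) (Sx \<beta> c5 (P n))
         + smult (cn n) (Sx \<beta> c5 (shift_seq P n))"
begin

lemma u_linear: "Vector_Spaces.linear smult (*) u"
  using OPS by (simp add: monic_OPS_def)

lemmas lin = linear_functional[OF u_linear]

definition h :: "nat \<Rightarrow> complex" where "h n = u (P n * P n)"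

lemma h_nonzero: "h n \<noteq> 0" and orth: "u (P n * P m) = (if n = m then h n else 0)"
proof -
  obtain h' where "\<And>n m. h' n \<noteq> 0 \<and> u (P n * P m) = (if n = m then h' n else 0)"
    using OPS unfolding monic_OPS_def by blast
  then show "h n \<noteq> 0" "u (P n * P m) = (if n = m then h n else 0)"
    by (simp_all add: h_def)
qed

lemma degree_P [simp]: "degree (P n) = n" and lead_P [simp]: "coeff (P n) n = 1"
  using OPS unfolding monic_OPS_def by metis+

lemma P_0 [simp]: "P 0 = 1" and C_nonzero: "n \<ge> 1 \<Longrightarrow> C n \<noteq> 0"
  using rec by (auto simp: recurrence_coeffs_def)

lemma P_1: "P 1 = [:- B 0, 1:]" "P (Suc 0) = [:- B 0, 1:]"
  using rec by (simp_all add: recurrence_coeffs_def shift_seq_def)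

lemma P_Suc: "P (Suc (Suc n)) = [:- B (Suc n), 1:] * P (Suc n) - smult (C (Suc n)) (P n)"
  using rec by (simp add: recurrence_coeffs_def shift_seq_def)

lemma var_mult_P: "[:0, 1:] * P (Suc n) = P (Suc (Suc n)) + smult (B (Suc n)) (P (Suc n)) + smult (C (Suc n)) (P n)"
  by (simp add: P_Suc)

text \<open>Compute u(z P_n P_(n+1)) by expanding z P_(n+1) or z P_n. For \<open>n = 0\<close> the
  second expansion is done by hand, as \<open>var_mult_P\<close> covers positive indices
  only.\<close>

lemma h_Suc: "h (Suc n) = C (Suc n) * h n"
proof -
  have "u (P n * ([:0, 1:] * P (Suc n))) = C (Suc n) * h n"
    unfolding var_mult_P by (simp add: distrib_left lin orth)
  moreover have "u (P n * ([:0, 1:] * P (Suc n))) = h (Suc n)"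
  proof (cases n)
    case 0
    have "P n * ([:0, 1:] * P (Suc n)) = P 1 * P 1 + smult (B 0) (P 0 * P 1)"
      by (simp add: 0 P_1)
    then have "u (P n * ([:0, 1:] * P (Suc n))) = u (P 1 * P 1) + B 0 * u (P 0 * P 1)"
      by (simp only: lin)
    then show ?thesis by (simp only: orth 0) simp
  next
    case (Suc m)
    have "P n * ([:0, 1:] * P (Suc n)) = P (Suc n) * ([:0, 1:] * P (Suc m))"
      by (simp add: Suc)
    then show ?thesis unfolding var_mult_P by (simp add: distrib_left lin orth Suc)
  qed
  ultimately show ?thesis by simp
qed

lemma P_expansion: "\<exists>\<alpha>. q = (\<Sum>j\<le>degree q. smult (\<alpha> j) (P j))"
proof -
  have "degree q \<le> n \<Longrightarrow> \<exists>\<alpha>. q = (\<Sum>j\<le>n. smult (\<alpha> j) (P j))" for n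
  proof (induction n arbitrary: q)
    case 0
    then obtain k where "q = [:k:]" using degree_eq_zeroE by blast
    then show ?case by (intro exI[of _ "\<lambda>_. k"]) simp
  next
    case (Suc n)
    have "degree (q - smult (coeff q (Suc n)) (P (Suc n))) \<le> n"
    proof (rule degree_le, intro allI impI)
      fix i assume "n < i"
      then show "coeff (q - smult (coeff q (Suc n)) (P (Suc n))) i = 0"
        using Suc.prems by (cases "i = Suc n") (auto simp: coeff_eq_0)
    qed
    then obtain \<alpha> where *: "q - smult (coeff q (Suc n)) (P (Suc n)) = (\<Sum>j\<le>n. smult (\<alpha> j) (P j))"
      using Suc.IH by blast
    have "q = (\<Sum>j\<le>n. smult (\<alpha> j) (P j)) + smult (coeff q (Suc n)) (P (Suc n))"
      by (simp flip: *)
    also have "\<dots> = (\<Sum>j\<le>Suc n. smult ((\<alpha>(Suc n := coeff q (Suc n))) j) (P j))"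
      by simp
    finally show ?case by blast
  qed
  then show ?thesis by blast
qed

lemma regular:
  assumes "\<And>g. u (q * g) = 0" shows "q = 0"
proof -
  obtain \<alpha> where q: "q = (\<Sum>j\<le>degree q. smult (\<alpha> j) (P j))" using P_expansion by blast
  have "\<alpha> i = 0" if "i \<le> degree q" for i
  proof -
    have "0 = u (q * P i)" using assms by simp
    also have "\<dots> = u (\<Sum>j\<le>degree q. smult (\<alpha> j) (P j * P i))"
      by (subst q) (simp add: sum_distrib_right)
    also have "\<dots> = \<alpha> i * h i" using that by (simp add: lin orth if_distrib cong: if_cong)
    finally show ?thesis using h_nonzero by simp
  qed
  then show ?thesis by (subst q) simp
qed

section \<open>The operator \<open>A\<close>, its adjoint, and the resulting first-order
  equations\<close>

abbreviation \<sigma> :: "complex poly" where "\<sigma> \<equiv> [:c, b, a:]"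
text \<open>\<open>smult k (P 1)\<close> is the adjoint of \<open>A\<close> applied to 1, that is,
  \<open>Q 0\<close>.\<close>

definition k :: complex where "k = cn 1 / C 1"
definition \<tau> :: "complex poly" where "\<tau> = reduced \<sigma>"
definition R :: "complex poly" where "R = smult k (P 1) + D \<sigma>"

lemma an_bn_0: "an 0 = 0" "bn 0 = 0"
proof -
  have *: "0 = smult (an 0) (S (P 1)) + [:bn 0:]"
    using structure_rel[of 0] by (simp add: shift_seq_def)
  have "S (P 1) = [:\<beta> - B 0, 1:]"
    by (simp add: P_1 S_pCons w2_def)
  with * show "an 0 = 0" "bn 0 = 0" by auto
qed

text \<open>Comparison of the coefficients of z^(n+1) in the structure relation.\<close>

lemma an_eq: "an n = a * of_nat n"
proof (cases n)
  case 0
  then show ?thesis by (simp add: an_bn_0)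
next
  case (Suc m)
  have "coeff (\<sigma> * D (P n)) (Suc n) = a * of_nat n"
    using coeff_SD(3)[of "P n" n] coeff_SD_high[of "P n" n] Suc by (simp add: coeff_lin_mult)
  moreover have "coeff (smult (an n) (S (P (Suc n))) + smult (bn n) (S (P n))
         + smult (cn n) (S (shift_seq P n))) (Suc n) = an n"
    using coeff_SD(1)[of "P (Suc n)" "Suc n"] coeff_SD_high[of "P n" n] coeff_SD_high[of "P m" m] Suc
    by (simp add: shift_seq_def)
  ultimately show ?thesis using structure_rel[of n] by metis
qed

definition AP :: "nat \<Rightarrow> complex poly" where
  "AP n = smult (an n) (P (Suc n)) + smult (bn n) (P n) + smult (cn n) (shift_seq P n)"

lemma S_AP: "S (AP n) = \<sigma> * D (P n)"
  by (simp only: AP_def structure_rel S_add S_smult)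

text \<open>By injectivity of \<open>S\<close> the second hypothesis says q = A g, so expanding
  \<open>g\<close> in the \<open>P j\<close> reduces the claim to the basis.\<close>

lemma adjoint:
  assumes "\<And>j. u (\<pi> * AP j) = u (Q * P j)" and "S q = \<sigma> * D g"
  shows "u (\<pi> * q) = u (Q * g)"
proof -
  obtain \<alpha> where g: "g = (\<Sum>j\<le>degree g. smult (\<alpha> j) (P j))" using P_expansion by blast
  have "S q = S (\<Sum>j\<le>degree g. smult (\<alpha> j) (AP j))"
    unfolding assms(2) by (subst g) (simp only: S_sum D_sum S_smult D_smult S_AP sum_distrib_left mult_smult_right)
  then have q: "q = (\<Sum>j\<le>degree g. smult (\<alpha> j) (AP j))" by (rule S_inj)
  have "u (\<pi> * q) = (\<Sum>j\<le>degree g. \<alpha> j * u (\<pi> * AP j))"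
    unfolding q by (simp add: sum_distrib_left lin)
  also have "\<dots> = (\<Sum>j\<le>degree g. \<alpha> j * u (Q * P j))" by (simp add: assms(1))
  also have "\<dots> = u (Q * g)" by (subst (2) g) (simp add: sum_distrib_left lin)
  finally show ?thesis .
qed

text \<open>If \<open>reduced f = \<tau> * g\<close>, then \<open>D_reduced\<close> and
  \<open>mult_D\<close> show that A g = \<open>D f - D \<sigma> * g\<close>; the adjoint relation
  for this pair is the Pearson equation.\<close>

lemma pearsonI:
  assumes "\<And>j. u (\<pi> * AP j) = u (Q * P j)"
  shows "pearson u \<tau> (Q + D \<sigma> * \<pi>) \<pi>"
  unfolding pearson_def
proof (intro allI impI)
  fix f g assume "reduced f = \<tau> * g"
  then have "S (D f) = D (reduced \<sigma> * g)" by (simp add: \<tau>_def flip: D_reduced)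
  then have "S (D f - D \<sigma> * g) = \<sigma> * D g" by (simp only: S_diff mult_D)
  then have "u (\<pi> * (D f - D \<sigma> * g)) = u (Q * g)" by (rule adjoint[OF assms])
  then show "u (\<pi> * D f) = u ((Q + D \<sigma> * \<pi>) * g)"
    by (simp add: algebra_simps lin)
qed

text \<open>The adjoint of \<open>A\<close> applied to \<open>P n\<close>: the transposed
  tridiagonal matrix, rescaled by h_(n+1) / h_n = C_(n+1).\<close>

definition Q :: "nat \<Rightarrow> complex poly" where
  "Q n = smult (cn (Suc n) / C (Suc n)) (P (Suc n)) + smult (bn n) (P n)
     + smult (an (n - 1) * C n) (shift_seq P n)"

lemma u_P_AP: "u (P n * AP j) = u (Q n * P j)"
proof -
  have "u (P n * AP j) = an j * u (P n * P (Suc j)) + bn j * u (P n * P j) + cn j * u (P n * shift_seq P j)"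
    by (simp add: AP_def distrib_left lin)
  moreover have "u (Q n * P j) = cn (Suc n) / C (Suc n) * u (P (Suc n) * P j) + bn n * u (P n * P j)
      + an (n - 1) * C n * u (shift_seq P n * P j)"
    by (simp add: Q_def distrib_right lin)
  moreover have "cn j * u (P n * shift_seq P j) = cn (Suc n) / C (Suc n) * u (P (Suc n) * P j)"
    using C_nonzero[of "Suc j"] C_nonzero[of j]
    by (cases j) (simp_all add: shift_seq_def lin orth h_Suc orth[where m = 0, simplified])
  moreover have "an j * u (P n * P (Suc j)) = an (n - 1) * C n * u (shift_seq P n * P j)"
    by (cases n) (simp_all add: shift_seq_def lin orth h_Suc orth[where n = 0, simplified])
  moreover have "bn j * u (P n * P j) = bn n * u (P n * P j)"
    by (simp add: orth)
  ultimately show ?thesis by simp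
qed

definition \<Theta> :: "nat \<Rightarrow> complex poly" where "\<Theta> n = smult k (P 1) * P n - Q n"

definition m :: "complex poly" where "m = S \<tau> + w2 * D R + smult (4 * \<beta>) (S R)"
definition \<mu> :: "complex poly" where "\<mu> = D \<tau> + S R + smult (4 * \<beta>) (D R)"

text \<open>The two Pearson equations compared are those of \<open>P 0 = 1\<close> and of
  \<open>P n\<close>; \<Theta> is the defect between the second and \<open>P n\<close> times the
  first.\<close>

lemma \<Theta>_equation:
  assumes "\<tau> \<noteq> 0"
  shows "(m - smult (4 * \<beta>) \<mu>) * S (\<Theta> n) + (smult (4 * \<beta>) m - w2 * \<mu>) * D (\<Theta> n)
    = (m * m - w2 * \<mu> * \<mu>) * D (P n)"
proof (rule pearson_difference_equation[OF u_linear regular _ _ assms m_def \<mu>_def])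
  have "Q 0 = smult k (P 1)"
    by (simp add: Q_def an_bn_0 k_def shift_seq_def)
  moreover have "pearson u \<tau> (Q n + D \<sigma> * P n) (P n)" for n
    by (rule pearsonI) (rule u_P_AP)
  note this[of 0]
  ultimately show "pearson u \<tau> R 1" by (simp add: R_def)
  have "P n * R - \<Theta> n = Q n + D \<sigma> * P n"
    by (simp add: \<Theta>_def R_def algebra_simps)
  then show "pearson u \<tau> (P n * R - \<Theta> n) (P n)"
    using \<open>pearson u \<tau> (Q n + D \<sigma> * P n) (P n)\<close> by simp
qed auto

end

section \<open>Quadratic coefficient\<close>

lemma poly_eq_0_if_nat_roots:
  assumes "\<And>n::nat. n \<ge> N \<Longrightarrow> poly p (of_nat n :: complex) = 0"
  shows "p = 0"
proof (rule ccontr)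
  assume "p \<noteq> 0"
  then have "finite {z. poly p z = 0}" by (rule poly_roots_finite)
  moreover have "of_nat ` {N..} \<subseteq> {z. poly p z = 0}" using assms by auto
  ultimately have "finite (of_nat ` {N..} :: complex set)" by (rule finite_subset[rotated])
  then have "finite {N..}" by (rule finite_imageD) (simp add: inj_on_def)
  then show False by (simp add: infinite_Ici)
qed

lemma coeff_quadratic_mult: "coeff ([:a, b, c:] * p) (Suc (Suc n)) = a * coeff p (Suc (Suc n)) + b * coeff p (Suc n) + c * coeff p n"
  and coeff_cubic_mult: "coeff ([:a, b, c, d:] * p) (Suc (Suc (Suc n))) = a * coeff p (Suc (Suc (Suc n)))
    + b * coeff p (Suc (Suc n)) + c * coeff p (Suc n) + d * coeff p n"
  and coeff_quartic_mult: "coeff ([:a, b, c, d, e:] * p) (Suc (Suc (Suc (Suc n)))) = a * coeff p (Suc (Suc (Suc (Suc n))))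
    + b * coeff p (Suc (Suc (Suc n))) + c * coeff p (Suc (Suc n)) + d * coeff p (Suc n) + e * coeff p n"
  by (simp_all add: add.assoc)

text \<open>Dividing the structure relation by a nonzero leading coefficient of \<sigma> leads to
  this normalisation.\<close>

locale quadratic_structure = structured_OPS where a = 1
begin

definition u1 :: complex where "u1 = 8 * \<beta> + 4 * \<beta> * k + b"
text \<open>\<open>V\<close> and \<open>Z\<close> are the coefficients of
  \<open>D (\<Theta> n)\<close> and \<open>D (P n)\<close> once \<open>S_\<Theta>\<close> has been
  substituted in \<open>\<Theta>_equation\<close>; see \<open>main_relation\<close>.\<close>

definition V :: "complex poly" where "V = smult (4 * \<beta>) m - w2 * \<mu>"
definition Z :: "complex poly" where "Z = (m - smult (4 * \<beta>) \<mu>) * \<sigma> - (m * m - w2 * \<mu> * \<mu>)"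

definition \<mu>0 :: complex where "\<mu>0 = 16 * \<beta> + 2 * b + 5 * \<beta> * k - k * B 0"
definition m0 :: complex where
  "m0 = c + \<omega> * k + 4 * \<omega> + 4 * \<beta> * b + 16 * \<beta>\<^sup>2 + 4 * \<beta>\<^sup>2 * k - 4 * \<beta> * k * B 0"
definition m1 :: complex where "m1 = 24 * \<beta> + 8 * \<beta> * k + b"

lemma \<sigma>_SD: "S \<sigma> = [:c + b * \<beta> + \<beta>\<^sup>2 + \<omega>, b + 6 * \<beta>, 1:]" "D \<sigma> = [:b + 2 * \<beta>, 2:]"
  by (simp_all add: S_pCons D_pCons w2_def power2_eq_square algebra_simps)

lemma \<tau>_eq: "\<tau> = [:\<omega> - 3 * \<beta>\<^sup>2 - b * \<beta> + c, 2 * \<beta> + b, 1:]"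
  by (simp add: \<tau>_def reduced_def \<sigma>_SD power2_eq_square algebra_simps)

lemma R_eq: "R = [:2 * \<beta> + b - k * B 0, k + 2:]"
  by (simp add: R_def P_1 \<sigma>_SD)

lemma \<mu>_eq: "\<mu> = [:\<mu>0, 4 + k:]"
  by (simp add: \<mu>_def \<tau>_eq R_eq S_pCons D_pCons w2_def \<mu>0_def algebra_simps)

lemma m_eq: "m = [:m0, m1, 1:]"
  by (simp add: m_def \<tau>_eq R_eq S_pCons D_pCons w2_def m0_def m1_def power2_eq_square algebra_simps)

lemma U_eq: "m - smult (4 * \<beta>) \<mu> = [:m0 - 4 * \<beta> * \<mu>0, u1, 1:]"
  by (simp add: m_eq \<mu>_eq u1_def m1_def algebra_simps)

lemma V_eq: "V = [:4 * \<beta> * m0 - \<omega> * \<mu>0, 4 * \<beta> * m1 - 4 * \<beta> * \<mu>0 - \<omega> * (4 + k), - 4 * \<beta> * (3 + k):]"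
  by (simp add: V_def m_eq \<mu>_eq w2_def algebra_simps)

definition n3 :: complex where "n3 = 2 * m1 - 4 * \<beta> * (4 + k) * (4 + k)"
definition n2 :: complex where "n2 = m1 * m1 + 2 * m0 - \<omega> * (4 + k) * (4 + k) - 8 * \<beta> * \<mu>0 * (4 + k)"
definition n1 :: complex where "n1 = 2 * m0 * m1 - 2 * \<omega> * \<mu>0 * (4 + k) - 4 * \<beta> * \<mu>0 * \<mu>0"
definition n0 :: complex where "n0 = m0 * m0 - \<omega> * \<mu>0 * \<mu>0"

lemma N_eq: "m * m - w2 * \<mu> * \<mu> = [:n0, n1, n2, n3, 1:]"
  by (simp add: m_eq \<mu>_eq w2_def n0_def n1_def n2_def n3_def algebra_simps)

lemma Z_eq: "Z = [:(m0 - 4 * \<beta> * \<mu>0) * c - n0, (m0 - 4 * \<beta> * \<mu>0) * b + u1 * c - n1,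
    m0 - 4 * \<beta> * \<mu>0 + u1 * b + c - n2, u1 + b - n3:]"
  unfolding Z_def U_eq N_eq by (simp add: algebra_simps)

lemma \<tau>_nonzero: "\<tau> \<noteq> 0"
  by (simp add: \<tau>_eq)

lemma degree_\<Theta>: "degree (\<Theta> n) \<le> Suc n"
proof -
  have "degree (shift_seq P n) \<le> n"
    by (cases n) (simp_all add: shift_seq_def)
  then have "degree (Q n) \<le> Suc n"
    unfolding Q_def by (intro degree_add_le order.trans[OF degree_smult_le]) auto
  moreover have "degree (smult k (P 1) * P n) \<le> Suc n"
    by (rule order.trans[OF degree_mult_le]) (simp add: P_1)
  ultimately show ?thesis unfolding \<Theta>_def by (intro degree_diff_le)
qed

lemma coeff_\<Theta>_top: "coeff (\<Theta> n) (Suc n) = k - cn (Suc n) / C (Suc n)"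
proof -
  have "coeff (shift_seq P n) (Suc n) = 0" "coeff (P n) (Suc n) = 0"
    by (cases n) (simp_all add: shift_seq_def coeff_eq_0)
  then show ?thesis by (simp add: \<Theta>_def Q_def P_1)
qed

text \<open>The coefficient of z^(n+3) in \<open>\<Theta>_equation\<close> equates the top
  coefficient of \<open>\<Theta> n\<close> with n, the leading coefficient of
  \<open>D (P n)\<close>. For \<open>n = 0\<close> the definition of \<open>k\<close>
  suffices.\<close>

lemma cn_eq: "cn (Suc n) = C (Suc n) * (k - of_nat n)"
proof -
  have "k - cn (Suc n) / C (Suc n) = of_nat n"
  proof (cases n)
    case 0
    then show ?thesis by (simp add: k_def)
  next
    case (Suc i)
    obtain u0 where U: "m - smult (4 * \<beta>) \<mu> = [:u0, u1, 1:]" using U_eq by blast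
    obtain v0 v1 v2 where V: "smult (4 * \<beta>) m - w2 * \<mu> = [:v0, v1, v2:]" using V_eq V_def by metis
    have "coeff ([:u0, u1, 1:] * S (\<Theta> n) + [:v0, v1, v2:] * D (\<Theta> n)) (Suc (Suc (Suc n)))
        = coeff ([:n0, n1, n2, n3, 1:] * D (P n)) (Suc (Suc (Suc (Suc i))))"
      using \<Theta>_equation[OF \<tau>_nonzero, of n] unfolding U V N_eq by (simp only: Suc)
    then show ?thesis
      unfolding coeff_add coeff_quadratic_mult coeff_quartic_mult
      using coeff_SD(1)[OF degree_\<Theta>, of n] coeff_SD_high[OF degree_\<Theta>, of n]
        coeff_SD_high[of "P n" n] coeff_SD(3)[of "P n" n] Suc
      by (simp add: coeff_\<Theta>_top)
  qed
  then show ?thesis using C_nonzero[of "Suc n"] by (simp add: field_simps)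
qed

text \<open>The diagonal discrepancy between A plus its adjoint and multiplication by
  \<open>smult k (P 1)\<close>.\<close>

definition e :: "nat \<Rightarrow> complex" where "e n = 2 * bn n - k * (B n - B 0)"

text \<open>With \<open>an_eq\<close> and \<open>cn_eq\<close> the off-diagonal entries of
  multiplication by \<open>smult k (P 1)\<close> minus the adjoint are those of \<open>A\<close>, so
  only a diagonal term remains.\<close>

lemma \<Theta>_eq: "\<Theta> (Suc n) = AP (Suc n) - smult (e (Suc n)) (P (Suc n))"
proof -
  have "P 1 * P (Suc n) = [:0, 1:] * P (Suc n) - smult (B 0) (P (Suc n))"
    by (simp add: P_1)
  then have 1: "P 1 * P (Suc n) = P (Suc (Suc n)) + smult (B (Suc n)) (P (Suc n)) + smult (C (Suc n)) (P n)
      - smult (B 0) (P (Suc n))"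
    by (simp only: var_mult_P)
  have 2: "cn (Suc (Suc n)) / C (Suc (Suc n)) = k - of_nat (Suc n)"
    using C_nonzero[of "Suc (Suc n)"] by (simp add: cn_eq)
  show ?thesis
    unfolding \<Theta>_def Q_def AP_def mult_smult_left 1 2 e_def an_eq cn_eq[of n] shift_seq_def
    by (intro poly_eqI) (simp add: algebra_simps)
qed

lemma S_\<Theta>: "S (\<Theta> (Suc n)) = \<sigma> * D (P (Suc n)) - smult (e (Suc n)) (S (P (Suc n)))"
  by (simp only: \<Theta>_eq S_diff S_smult S_AP)

lemma main_relation:
  "V * D (\<Theta> (Suc n)) + Z * D (P (Suc n)) = smult (e (Suc n)) ((m - smult (4 * \<beta>) \<mu>) * S (P (Suc n)))"
proof -
  have "X * (\<sigma>' * q - E) + Y * p = N * q \<Longrightarrow> Y * p + (X * \<sigma>' - N) * q = X * E" for X Y p q E N \<sigma>' :: "complex poly"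
    by algebra
  from this[OF \<Theta>_equation[OF \<tau>_nonzero, of "Suc n", unfolded S_\<Theta>]] show ?thesis
    unfolding V_def Z_def mult_smult_right .
qed

section \<open>Two relations for the second coefficient of \<open>P n\<close>\<close>

definition f :: "nat \<Rightarrow> complex" where "f n = coeff (P n) (n - 1)"

lemma f_Suc: "f (Suc (Suc n)) = f (Suc n) - B (Suc n)"
  by (simp add: f_def P_Suc coeff_eq_0)

lemma coeff_D_\<Theta>: "coeff (D (\<Theta> (Suc n))) (Suc n) = of_nat (Suc (Suc n)) * of_nat (Suc n)"
  "coeff (D (\<Theta> (Suc n))) n = of_nat (Suc n) * coeff (\<Theta> (Suc n)) (Suc n) + d1 (Suc (Suc n)) * of_nat (Suc n)"
proof -
  have "coeff (\<Theta> (Suc n)) (Suc (Suc n)) = of_nat (Suc n)"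
    using C_nonzero[of "Suc (Suc n)"] by (simp add: coeff_\<Theta>_top cn_eq)
  then show "coeff (D (\<Theta> (Suc n))) (Suc n) = of_nat (Suc (Suc n)) * of_nat (Suc n)"
    "coeff (D (\<Theta> (Suc n))) n = of_nat (Suc n) * coeff (\<Theta> (Suc n)) (Suc n) + d1 (Suc (Suc n)) * of_nat (Suc n)"
    using coeff_SD(3,4)[OF degree_\<Theta>, of "Suc n"] by simp_all
qed

lemma coeff_SD_P: "coeff (S (P (Suc n))) (Suc n) = 1" "coeff (S (P (Suc n))) n = f (Suc n) + s1 (Suc n)"
  "coeff (D (P (Suc n))) n = of_nat (Suc n)" "j > Suc n \<Longrightarrow> coeff (S (P (Suc n))) j = 0"
  "j > n \<Longrightarrow> coeff (D (P (Suc n))) j = 0"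
  "coeff (D (P (Suc (Suc n)))) n = of_nat (Suc n) * f (Suc (Suc n)) + d1 (Suc (Suc n))"
  using coeff_SD[of "P (Suc n)" "Suc n"] coeff_SD[of "P (Suc (Suc n))" "Suc (Suc n)"] coeff_SD_high[of "P (Suc n)" "Suc n"]
  by (simp_all add: f_def)

lemma high_D_\<Theta>: "j > Suc n \<Longrightarrow> coeff (D (\<Theta> (Suc n))) j = 0"
  using coeff_SD_high[OF degree_\<Theta>, of "Suc n"] by simp

text \<open>The top coefficient, that of z^(n+3), in \<open>main_relation\<close>.\<close>

lemma e_eq:
  assumes V: "V = [:v0, v1, v2:]" and Z: "Z = [:z0, z1, z2, z3:]"
  shows "e (Suc n) = of_nat (Suc n) * (v2 * of_nat (Suc (Suc n)) + z3)"
proof -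
  obtain u0 where U: "m - smult (4 * \<beta>) \<mu> = [:u0, u1, 1:]" using U_eq by blast
  have "coeff (V * D (\<Theta> (Suc n)) + Z * D (P (Suc n))) (Suc (Suc (Suc n)))
    = coeff (smult (e (Suc n)) ((m - smult (4 * \<beta>) \<mu>) * S (P (Suc n)))) (Suc (Suc (Suc n)))"
    by (simp only: main_relation)
  then show ?thesis
    unfolding coeff_add coeff_smult V Z U coeff_quadratic_mult coeff_cubic_mult
    by (simp add: coeff_D_\<Theta> coeff_SD_P high_D_\<Theta>) (simp add: algebra_simps)?
qed

text \<open>The coefficient of z^(n+2) in \<open>S_\<Theta>\<close>.\<close>

lemma theta_eq: "coeff (\<Theta> (Suc (Suc n))) (Suc (Suc n)) + s1 (Suc (Suc (Suc n))) * of_nat (Suc (Suc n))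
    = b * of_nat (Suc (Suc n)) + of_nat (Suc n) * f (Suc (Suc n)) + d1 (Suc (Suc n)) - e (Suc (Suc n))"
proof -
  let ?n = "Suc (Suc n)"
  have "coeff (\<Theta> ?n) (Suc ?n) = of_nat ?n"
    using C_nonzero[of "Suc ?n"] by (simp add: coeff_\<Theta>_top cn_eq)
  then have "coeff (S (\<Theta> ?n)) ?n = coeff (\<Theta> ?n) ?n + s1 (Suc ?n) * of_nat ?n"
    using coeff_SD(2)[OF degree_\<Theta>, of ?n] by simp
  moreover have "coeff (S (\<Theta> ?n)) ?n = coeff (\<sigma> * D (P ?n)) ?n - e ?n"
    unfolding S_\<Theta>[of "Suc n"] coeff_diff coeff_smult coeff_SD_P by simp
  moreover have "coeff (\<sigma> * D (P ?n)) ?n = b * of_nat ?n + of_nat (Suc n) * f ?n + d1 ?n"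
    unfolding coeff_quadratic_mult by (simp add: coeff_SD_P)
  ultimately show ?thesis by algebra
qed

text \<open>The same coefficient of \<Theta>, now read off from \<open>\<Theta>_eq\<close>;
  \<open>bn\<close> is eliminated by means of \<open>e\<close> and \<open>f_Suc\<close>.\<close>

lemma theta_eq2: "2 * coeff (\<Theta> (Suc n)) (Suc n) = 2 * of_nat (Suc n) * f (Suc (Suc n))
    + k * (f (Suc n) - f (Suc (Suc n)) - B 0) - e (Suc n)"
proof -
  have "coeff (\<Theta> (Suc n)) (Suc n) = of_nat (Suc n) * f (Suc (Suc n)) + bn (Suc n) - e (Suc n)"
    unfolding \<Theta>_eq by (simp add: AP_def an_eq f_def shift_seq_def coeff_eq_0)
  then show ?thesis unfolding e_def f_Suc by algebra
qed

text \<open>Eliminates the coefficient of \<Theta> from the two preceding lemmas. Cubic growth of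
  \<open>f\<close> is compatible with this only with leading term -\<beta>n^3/3.\<close>

lemma f_recurrence:
  "(2 * of_nat (Suc (Suc n)) - k) * f (Suc (Suc (Suc n))) = (2 * of_nat (Suc n) - k) * f (Suc (Suc n))
     + 2 * b * of_nat (Suc (Suc n)) + 2 * d1 (Suc (Suc n)) - 2 * of_nat (Suc (Suc n)) * s1 (Suc (Suc (Suc n)))
     - e (Suc (Suc n)) + k * B 0"
  using theta_eq[of n] theta_eq2[of "Suc n"] unfolding of_nat_Suc by algebra

text \<open>One coefficient below the top in \<open>main_relation\<close>. Substituting
  \<open>e_eq\<close> in the product of \<open>e\<close> and \<open>f\<close> makes the equation
  linear in \<open>f\<close>; for \<open>v2\<close> or \<open>z3\<close> nonzero it gives the
  leading term -4\<beta>n^3/3.\<close>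

lemma f_closed:
  assumes V: "V = [:v0, v1, v2:]" and Z: "Z = [:z0, z1, z2, z3:]"
  shows "f (Suc (Suc n)) * (2 * v2 * of_nat (Suc (Suc n)) + z3)
    = v2 * of_nat (Suc (Suc n)) * (d1 (Suc (Suc n)) + b * of_nat (Suc (Suc n)) - e (Suc (Suc n))
        - of_nat (Suc (Suc n)) * s1 (Suc (Suc (Suc n))) + d1 (Suc (Suc (Suc n))))
      + v1 * of_nat (Suc (Suc n)) * of_nat (Suc (Suc (Suc n))) + z3 * d1 (Suc (Suc n)) + z2 * of_nat (Suc (Suc n))
      - e (Suc (Suc n)) * (s1 (Suc (Suc n)) + u1)"
proof -
  let ?n = "Suc (Suc n)"
  obtain u0 where U: "m - smult (4 * \<beta>) \<mu> = [:u0, u1, 1:]" using U_eq by blast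
  have "coeff (V * D (\<Theta> ?n) + Z * D (P ?n)) (Suc ?n)
    = coeff (smult (e ?n) ((m - smult (4 * \<beta>) \<mu>) * S (P ?n))) (Suc ?n)"
    by (simp only: main_relation)
  then have *: "v1 * (of_nat (Suc ?n) * of_nat ?n) + v2 * (of_nat ?n * coeff (\<Theta> ?n) ?n + d1 (Suc ?n) * of_nat ?n)
     + z2 * of_nat ?n + z3 * (of_nat (Suc n) * f ?n + d1 ?n) = e ?n * (u1 + (f ?n + s1 ?n))"
    unfolding coeff_add coeff_smult V Z U coeff_quadratic_mult coeff_cubic_mult
    by (simp add: coeff_D_\<Theta> coeff_SD_P high_D_\<Theta> del: of_nat_Suc) (simp add: algebra_simps)?
  have th: "coeff (\<Theta> ?n) ?n = b * of_nat ?n + of_nat (Suc n) * f ?n + d1 ?n - e ?n - s1 (Suc ?n) * of_nat ?n"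
    using theta_eq[of n] by (simp add: algebra_simps)
  have e: "e ?n * f ?n = of_nat ?n * (v2 * of_nat (Suc ?n) + z3) * f ?n"
    using e_eq[OF V Z, of "Suc n"] by simp
  from * th e show ?thesis unfolding of_nat_Suc by algebra
qed


lemma v2_zero: "\<beta> = 0 \<or> k = - 3" and z3_zero: "u1 + b - n3 = 0"
proof -
  define v0 where "v0 = 4 * \<beta> * m0 - \<omega> * \<mu>0"
  define v1 where "v1 = 4 * \<beta> * m1 - 4 * \<beta> * \<mu>0 - \<omega> * (4 + k)"
  define v2 where "v2 = - 4 * \<beta> * (3 + k)"
  define z0 where "z0 = (m0 - 4 * \<beta> * \<mu>0) * c - n0"
  define z1 where "z1 = (m0 - 4 * \<beta> * \<mu>0) * b + u1 * c - n1"
  define z2 where "z2 = m0 - 4 * \<beta> * \<mu>0 + u1 * b + c - n2"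
  define z3 where "z3 = u1 + b - n3"
  have V: "V = [:v0, v1, v2:]" unfolding V_eq v0_def v1_def v2_def ..
  have Z: "Z = [:z0, z1, z2, z3:]" unfolding Z_eq z0_def z1_def z2_def z3_def ..
  \<comment> \<open>The quantities above as polynomials in n; a prime denotes the value at n + 1.
    \<open>G\<close> is the right-hand side of \<open>f_closed\<close>, \<open>H\<close> the
    inhomogeneous part of \<open>f_recurrence\<close>.\<close>
  define sp where "sp = [:0, - \<beta>, 2 * \<beta>:]"
  define sp' where "sp' = [:\<beta>, 3 * \<beta>, 2 * \<beta>:]"
  define dp where "dp = [:0, \<beta> / 3, - \<beta>, 2 * \<beta> / 3:]"
  define dp' where "dp' = [:0, \<beta> / 3, \<beta>, 2 * \<beta> / 3:]"
  define ep where "ep = [:0, v2 + z3, v2:]"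
  define G where "G = smult v2 ([:0, 1:] * (dp + [:0, b:] - ep - [:0, 1:] * sp' + dp'))
    + [:0, v1 + z2, v1:] + smult z3 dp - ep * (sp + [:u1:])"
  define H where "H = [:k * B 0, 2 * b:] + smult 2 dp - [:0, 2:] * sp' - ep"
  have eval: "s1 n = poly sp (of_nat n)" "s1 (Suc n) = poly sp' (of_nat n)"
    "d1 n = poly dp (of_nat n)" "d1 (Suc n) = poly dp' (of_nat n)" for n
    by (simp_all add: s1_def d1_def sp_def sp'_def dp_def dp'_def field_simps)
  have e: "e (Suc n) = poly ep (of_nat (Suc n))" for n
    unfolding e_eq[OF V Z] ep_def by (simp add: algebra_simps)
  have f1: "f n * (2 * v2 * of_nat n + z3) = poly G (of_nat n)" if n: "n \<ge> 2" for n
  proof -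
    obtain i where i: "n = Suc (Suc i)" using n by (metis One_nat_def Suc_1 Suc_le_D Suc_le_mono)
    show ?thesis
      unfolding i f_closed[OF V Z] e[of "Suc i"] eval(2,4)[of "Suc (Suc i)"]
      unfolding eval(1,3) G_def poly_add poly_diff poly_mult poly_smult poly_pCons poly_0 of_nat_Suc by algebra
  qed
  have f2: "(2 * of_nat n - k) * f (Suc n) = (2 * (of_nat n - 1) - k) * f n + poly H (of_nat n)" if n: "n \<ge> 2" for n
  proof -
    obtain i where i: "n = Suc (Suc i)" using n by (metis One_nat_def Suc_1 Suc_le_D Suc_le_mono)
    show ?thesis
      unfolding i f_recurrence e[of "Suc i"] eval(2)[of "Suc (Suc i)"]
      unfolding eval(1,3) H_def poly_add poly_diff poly_mult poly_smult poly_pCons poly_0 of_nat_Suc by algebra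
  qed
  define G' where "G' = G \<circ>\<^sub>p [:1, 1:]"
  have G': "poly G' (of_nat n) = poly G (of_nat (Suc n))" for n
    by (simp add: G'_def poly_pcompose)
  define q where "q = [:z3, 2 * v2:]"
  define q' where "q' = [:z3 + 2 * v2, 2 * v2:]"
  \<comment> \<open>Multiplying \<open>f_recurrence\<close> by the factors of \<open>f\<close> in
    \<open>f_closed\<close> at n and n + 1 eliminates \<open>f\<close>. The result holds for all n
    \<ge> 2, hence identically, and its coefficient of n^5 is - 32 \<beta>
    \<open>v2\<close>^2.\<close>
  have "[:- k, 2:] * G' * q - [:- 2 - k, 2:] * G * q' - H * q * q' = 0"
  proof (rule poly_eq_0_if_nat_roots)
    fix n :: nat assume n: "n \<ge> 2"
    note f1' = f1[OF n, symmetric] f1[of "Suc n", OF le_SucI, OF n, symmetric]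
    show "poly ([:- k, 2:] * G' * q - [:- 2 - k, 2:] * G * q' - H * q * q') (of_nat n) = 0"
      unfolding poly_diff poly_mult G' f1' q_def q'_def poly_pCons poly_0
      using f2[OF n] unfolding of_nat_Suc by algebra
  qed
  then have "coeff ([:- k, 2:] * G' * q - [:- 2 - k, 2:] * G * q' - H * q * q') 5 = 0"
    by simp
  moreover have "coeff ([:- k, 2:] * G' * q - [:- 2 - k, 2:] * G * q' - H * q * q') 5 = - 32 * \<beta> * v2 * v2"
    by (simp add: G'_def G_def H_def q_def q'_def sp_def sp'_def dp_def dp'_def ep_def pcompose_pCons
        eval_nat_numeral algebra_simps) (simp add: field_simps)?
  ultimately have v2: "v2 = 0" by (auto simp: v2_def)
  then show "\<beta> = 0 \<or> k = - 3" unfolding v2_def by (metis add.commute add_eq_0_iff mult_eq_0_iff neg_equal_0_iff_equal zero_neq_numeral)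
  \<comment> \<open>For \<open>v2 = 0\<close> the factor of \<open>f\<close> is the constant
    \<open>z3\<close>, and the same elimination has the coefficient - 8 \<beta> \<open>z3\<close> at
    n^3.\<close>
  have "[:- k, 2:] * G' - [:- 2 - k, 2:] * G - smult z3 H = 0"
  proof (rule poly_eq_0_if_nat_roots)
    fix n :: nat assume n: "n \<ge> 2"
    note f1' = f1[OF n, symmetric] f1[of "Suc n", OF le_SucI, OF n, symmetric]
    show "poly ([:- k, 2:] * G' - [:- 2 - k, 2:] * G - smult z3 H) (of_nat n) = 0"
      unfolding poly_diff poly_mult poly_smult G' f1' v2 poly_pCons poly_0
      using f2[OF n] unfolding of_nat_Suc by algebra
  qed
  then have "coeff ([:- k, 2:] * G' - [:- 2 - k, 2:] * G - smult z3 H) 3 = 0"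
    by simp
  moreover have "coeff ([:- k, 2:] * G' - [:- 2 - k, 2:] * G - smult z3 H) 3 = - 8 * \<beta> * z3"
    by (simp add: v2 G'_def G_def H_def q_def q'_def sp_def sp'_def dp_def dp'_def ep_def pcompose_pCons
        eval_nat_numeral algebra_simps) (simp add: field_simps)?
  ultimately have "\<beta> = 0 \<or> z3 = 0" by auto
  moreover have "z3 = 0" if "\<beta> = 0"
    using that unfolding z3_def u1_def n3_def m1_def by simp
  ultimately show "u1 + b - n3 = 0" unfolding z3_def by blast
qed

text \<open>Now \<open>e\<close> vanishes, so \<open>V * D (\<Theta> n) + Z * D (P n) = 0\<close>.
  The leading coefficients of \<open>D (\<Theta> n)\<close> and \<open>D (P n)\<close> have ratio n
  + 1, so \<open>n = 1\<close> and \<open>n = 2\<close> give independent equations for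
  \<open>v1\<close>, \<open>z2\<close>, and then for \<open>v0\<close>, \<open>z1\<close>.\<close>

lemma V_zero: "V = 0" and e_zero: "e (Suc n) = 0"
proof -
  obtain v0 v1 where V: "V = [:v0, v1, 0:]" using V_eq v2_zero by auto
  obtain z0 z1 z2 where Z: "Z = [:z0, z1, z2, 0:]" using Z_eq z3_zero by auto
  show e: "e (Suc n) = 0" for n by (simp add: e_eq[OF V Z])
  have rel: "V * D (\<Theta> (Suc n)) + Z * D (P (Suc n)) = 0" for n
    using main_relation[of n] by (simp add: e)
  have D1: "D (P (Suc 0)) = 1" by (simp add: P_1 D_pCons one_pCons)
  have T1: "coeff (D (\<Theta> (Suc 0))) (Suc 0) = 2" "coeff (D (\<Theta> 2)) 2 = 6" "coeff (D (P 2)) 1 = 2"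
    "coeff (D (\<Theta> (Suc 0))) (Suc (Suc 0)) = 0" "coeff (D (\<Theta> 2)) 3 = 0" "coeff (D (P 2)) 2 = 0" "coeff (D (P 2)) 3 = 0"
    using coeff_D_\<Theta>[of 0] coeff_D_\<Theta>[of 1] coeff_SD_P(3)[of 1] high_D_\<Theta>[of 0] high_D_\<Theta>[of 1] coeff_SD_P(5)[of 1]
    by (simp_all add: numeral_2_eq_2 numeral_3_eq_3)
  have "coeff (V * D (\<Theta> (Suc 0)) + Z * D (P (Suc 0))) 2 = 0" "coeff (V * D (\<Theta> 2) + Z * D (P 2)) 3 = 0"
    using rel[of 0] rel[of 1] by (simp_all add: numeral_2_eq_2)
  then have "2 * v1 + z2 = 0" "6 * v1 + 2 * z2 = 0"
    using T1 by (simp_all add: V Z D1 numeral_2_eq_2 numeral_3_eq_3 algebra_simps)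
  then have 0: "v1 = 0" "z2 = 0" by algebra+
  have "coeff (V * D (\<Theta> (Suc 0)) + Z * D (P (Suc 0))) 1 = 0" "coeff (V * D (\<Theta> 2) + Z * D (P 2)) 2 = 0"
    using rel[of 0] rel[of 1] by (simp_all add: numeral_2_eq_2)
  then have "2 * v0 + z1 = 0" "6 * v0 + 2 * z1 = 0"
    using T1 0 by (simp_all add: V Z D1 numeral_2_eq_2 numeral_3_eq_3 algebra_simps)
  then have 1: "v0 = 0" "z1 = 0" by algebra+
  then show "V = 0" using 0 V by simp
qed

end

section \<open>\<open>S\<close> and \<open>D\<close> in degrees up to four\<close>

context quadratic_lattice
begin

lemma SD_quartic:
  "S [:p0, p1, p2, p3, p4:] = [:p0 + \<beta> * p1 + (\<beta>\<^sup>2 + \<omega>) * p2 + (\<beta>^3 + 3 * \<beta> * \<omega>) * p3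
      + (\<beta>^4 + 6 * \<beta>\<^sup>2 * \<omega> + \<omega>\<^sup>2) * p4,
    p1 + 6 * \<beta> * p2 + (15 * \<beta>\<^sup>2 + 3 * \<omega>) * p3 + (28 * \<beta>^3 + 20 * \<beta> * \<omega>) * p4,
    p2 + 15 * \<beta> * p3 + (70 * \<beta>\<^sup>2 + 6 * \<omega>) * p4, p3 + 28 * \<beta> * p4, p4:]"
  "D [:p0, p1, p2, p3, p4:] = [:p1 + 2 * \<beta> * p2 + (3 * \<beta>\<^sup>2 + \<omega>) * p3 + (4 * \<beta>^3 + 4 * \<beta> * \<omega>) * p4,
    2 * p2 + 10 * \<beta> * p3 + (28 * \<beta>\<^sup>2 + 4 * \<omega>) * p4, 3 * p3 + 28 * \<beta> * p4, 4 * p4:]"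
  by (simp_all add: S_pCons D_pCons w2_def eval_nat_numeral algebra_simps)

lemma SD_cubic:
  "S [:p0, p1, p2, p3:] = [:p0 + \<beta> * p1 + (\<beta>\<^sup>2 + \<omega>) * p2 + (\<beta>^3 + 3 * \<beta> * \<omega>) * p3,
    p1 + 6 * \<beta> * p2 + (15 * \<beta>\<^sup>2 + 3 * \<omega>) * p3, p2 + 15 * \<beta> * p3, p3:]"
  "D [:p0, p1, p2, p3:] = [:p1 + 2 * \<beta> * p2 + (3 * \<beta>\<^sup>2 + \<omega>) * p3, 2 * p2 + 10 * \<beta> * p3, 3 * p3:]"
  by (simp_all add: S_pCons D_pCons w2_def eval_nat_numeral algebra_simps)

lemma SD_quadratic:
  "S [:p0, p1, p2:] = [:p0 + \<beta> * p1 + (\<beta>\<^sup>2 + \<omega>) * p2, p1 + 6 * \<beta> * p2, p2:]"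
  "D [:p0, p1, p2:] = [:p1 + 2 * \<beta> * p2, 2 * p2:]"
  by (simp_all add: S_pCons D_pCons w2_def eval_nat_numeral algebra_simps)

lemma SD_linear: "S [:p0, p1:] = [:p0 + \<beta> * p1, p1:]" "D [:p0, p1:] = [:p1:]"
  by (simp_all add: S_pCons D_pCons w2_def)

end

section \<open>The structure relation for n = 1, 2, 3 in coefficients\<close>

context structured_OPS
begin

text \<open>The letters \<open>f\<close>, \<open>g\<close>, \<open>h\<close>, \<open>i\<close>
  followed by n stand for the coefficients of z^(n-1), z^(n-2), z^(n-3), z^(n-4) in
  \<open>P n\<close>.\<close>

definition f2 where "f2 = - (B 0 + B 1)"
definition g2 where "g2 = B 0 * B 1 - C 1"
definition f3 where "f3 = f2 - B 2"
definition g3 where "g3 = g2 - B 2 * f2 - C 2"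
definition h3 where "h3 = C 2 * B 0 - B 2 * g2"
definition f4 where "f4 = f3 - B 3"
definition g4 where "g4 = g3 - B 3 * f3 - C 3"
definition h4 where "h4 = h3 - B 3 * g3 - C 3 * f2"
definition i4 where "i4 = - B 3 * h3 - C 3 * g2"

lemma P2: "P 2 = [:g2, f2, 1:]" and P3: "P 3 = [:h3, g3, f3, 1:]" and P4: "P 4 = [:i4, h4, g4, f4, 1:]"
proof -
  have rec: "P 2 = [:- B 1, 1:] * P 1 - smult (C 1) 1" "P 3 = [:- B 2, 1:] * P 2 - smult (C 2) (P 1)"
    "P 4 = [:- B 3, 1:] * P 3 - smult (C 3) (P 2)"
    using P_Suc[of 0] P_Suc[of 1] P_Suc[of 2] by (simp_all add: numeral_eq_Suc)
  show P2: "P 2 = [:g2, f2, 1:]"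
    by (simp add: rec(1) P_1 f2_def g2_def algebra_simps)
  show P3: "P 3 = [:h3, g3, f3, 1:]"
    by (simp add: rec(2) P2 P_1 f3_def g3_def h3_def algebra_simps)
  show "P 4 = [:i4, h4, g4, f4, 1:]"
    by (simp add: rec(3) P2 P3 f4_def g4_def h4_def i4_def algebra_simps)
qed

lemma relation_1:
  "b = 6 * \<beta> * a + a * f2 + bn 1"
  "c = a * (g2 + \<beta> * f2 + (\<beta>\<^sup>2 + \<omega>)) + bn 1 * (\<beta> - B 0) + cn 1"
proof -
  have "[:c, b, a:] = smult a (S (P 2)) + smult (bn 1) (S (P 1)) + smult (cn 1) 1"
    using structure_rel[of 1] P_1 by (simp add: an_eq shift_seq_def numeral_2_eq_2 SD_linear one_pCons)
  then show "b = 6 * \<beta> * a + a * f2 + bn 1"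
    "c = a * (g2 + \<beta> * f2 + (\<beta>\<^sup>2 + \<omega>)) + bn 1 * (\<beta> - B 0) + cn 1"
    by (simp_all add: P2 P_1 SD_quadratic SD_linear one_pCons algebra_simps)
qed

lemma relation_2:
  "a * (f2 + 2 * \<beta>) + 2 * b = 2 * a * (f3 + 15 * \<beta>) + bn 2"
  "b * (f2 + 2 * \<beta>) + 2 * c = 2 * a * (g3 + 6 * \<beta> * f3 + (15 * \<beta>\<^sup>2 + 3 * \<omega>)) + bn 2 * (f2 + 6 * \<beta>) + cn 2"
  "c * (f2 + 2 * \<beta>) = 2 * a * (h3 + \<beta> * g3 + (\<beta>\<^sup>2 + \<omega>) * f3 + (\<beta>^3 + 3 * \<beta> * \<omega>))
    + bn 2 * (g2 + \<beta> * f2 + (\<beta>\<^sup>2 + \<omega>)) + cn 2 * (\<beta> - B 0)"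
proof -
  have "[:c, b, a:] * D (P 2) = smult (2 * a) (S (P 3)) + smult (bn 2) (S (P 2)) + smult (cn 2) (S (P 1))"
    using structure_rel[of 2] by (simp only: an_eq shift_seq_def) (simp add: numeral_eq_Suc algebra_simps)
  then have *: "[:c * (f2 + 2 * \<beta>), b * (f2 + 2 * \<beta>) + 2 * c, a * (f2 + 2 * \<beta>) + 2 * b, 2 * a:] =
    [:2 * a * (h3 + \<beta> * g3 + (\<beta>\<^sup>2 + \<omega>) * f3 + (\<beta>^3 + 3 * \<beta> * \<omega>))
      + bn 2 * (g2 + \<beta> * f2 + (\<beta>\<^sup>2 + \<omega>)) + cn 2 * (\<beta> - B 0),
      2 * a * (g3 + 6 * \<beta> * f3 + (15 * \<beta>\<^sup>2 + 3 * \<omega>)) + bn 2 * (f2 + 6 * \<beta>) + cn 2,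
      2 * a * (f3 + 15 * \<beta>) + bn 2, 2 * a:]"
    by (simp add: P2 P3 P_1 SD_cubic SD_quadratic SD_linear algebra_simps)
  then show "a * (f2 + 2 * \<beta>) + 2 * b = 2 * a * (f3 + 15 * \<beta>) + bn 2"
    "b * (f2 + 2 * \<beta>) + 2 * c = 2 * a * (g3 + 6 * \<beta> * f3 + (15 * \<beta>\<^sup>2 + 3 * \<omega>)) + bn 2 * (f2 + 6 * \<beta>) + cn 2"
    "c * (f2 + 2 * \<beta>) = 2 * a * (h3 + \<beta> * g3 + (\<beta>\<^sup>2 + \<omega>) * f3 + (\<beta>^3 + 3 * \<beta> * \<omega>))
      + bn 2 * (g2 + \<beta> * f2 + (\<beta>\<^sup>2 + \<omega>)) + cn 2 * (\<beta> - B 0)"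
    by (simp_all only: pCons_eq_iff)
qed

lemma relation_3:
  "a * (2 * f3 + 10 * \<beta>) + 3 * b = 3 * a * (f4 + 28 * \<beta>) + bn 3"
  "a * (g3 + 2 * \<beta> * f3 + (3 * \<beta>\<^sup>2 + \<omega>)) + b * (2 * f3 + 10 * \<beta>) + 3 * c
    = 3 * a * (g4 + 15 * \<beta> * f4 + (70 * \<beta>\<^sup>2 + 6 * \<omega>)) + bn 3 * (f3 + 15 * \<beta>) + cn 3"
  "b * (g3 + 2 * \<beta> * f3 + (3 * \<beta>\<^sup>2 + \<omega>)) + c * (2 * f3 + 10 * \<beta>)
    = 3 * a * (h4 + 6 * \<beta> * g4 + (15 * \<beta>\<^sup>2 + 3 * \<omega>) * f4 + (28 * \<beta>^3 + 20 * \<beta> * \<omega>))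
      + bn 3 * (g3 + 6 * \<beta> * f3 + (15 * \<beta>\<^sup>2 + 3 * \<omega>)) + cn 3 * (f2 + 6 * \<beta>)"
  "c * (g3 + 2 * \<beta> * f3 + (3 * \<beta>\<^sup>2 + \<omega>))
    = 3 * a * (i4 + \<beta> * h4 + (\<beta>\<^sup>2 + \<omega>) * g4 + (\<beta>^3 + 3 * \<beta> * \<omega>) * f4 + (\<beta>^4 + 6 * \<beta>\<^sup>2 * \<omega> + \<omega>\<^sup>2))
      + bn 3 * (h3 + \<beta> * g3 + (\<beta>\<^sup>2 + \<omega>) * f3 + (\<beta>^3 + 3 * \<beta> * \<omega>)) + cn 3 * (g2 + \<beta> * f2 + (\<beta>\<^sup>2 + \<omega>))"
proof -
  have "[:c, b, a:] * D (P 3) = smult (3 * a) (S (P 4)) + smult (bn 3) (S (P 3)) + smult (cn 3) (S (P 2))"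
    using structure_rel[of 3] by (simp only: an_eq shift_seq_def) (simp add: numeral_eq_Suc algebra_simps)
  then have *: "[:c * (g3 + 2 * \<beta> * f3 + (3 * \<beta>\<^sup>2 + \<omega>)),
      b * (g3 + 2 * \<beta> * f3 + (3 * \<beta>\<^sup>2 + \<omega>)) + c * (2 * f3 + 10 * \<beta>),
      a * (g3 + 2 * \<beta> * f3 + (3 * \<beta>\<^sup>2 + \<omega>)) + b * (2 * f3 + 10 * \<beta>) + 3 * c,
      a * (2 * f3 + 10 * \<beta>) + 3 * b, 3 * a:] =
    [:3 * a * (i4 + \<beta> * h4 + (\<beta>\<^sup>2 + \<omega>) * g4 + (\<beta>^3 + 3 * \<beta> * \<omega>) * f4 + (\<beta>^4 + 6 * \<beta>\<^sup>2 * \<omega> + \<omega>\<^sup>2))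
        + bn 3 * (h3 + \<beta> * g3 + (\<beta>\<^sup>2 + \<omega>) * f3 + (\<beta>^3 + 3 * \<beta> * \<omega>)) + cn 3 * (g2 + \<beta> * f2 + (\<beta>\<^sup>2 + \<omega>)),
      3 * a * (h4 + 6 * \<beta> * g4 + (15 * \<beta>\<^sup>2 + 3 * \<omega>) * f4 + (28 * \<beta>^3 + 20 * \<beta> * \<omega>))
        + bn 3 * (g3 + 6 * \<beta> * f3 + (15 * \<beta>\<^sup>2 + 3 * \<omega>)) + cn 3 * (f2 + 6 * \<beta>),
      3 * a * (g4 + 15 * \<beta> * f4 + (70 * \<beta>\<^sup>2 + 6 * \<omega>)) + bn 3 * (f3 + 15 * \<beta>) + cn 3,
      3 * a * (f4 + 28 * \<beta>) + bn 3, 3 * a:]"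
    by (simp add: P2 P3 P4 SD_quartic SD_cubic SD_quadratic algebra_simps)
  show "a * (2 * f3 + 10 * \<beta>) + 3 * b = 3 * a * (f4 + 28 * \<beta>) + bn 3"
    "a * (g3 + 2 * \<beta> * f3 + (3 * \<beta>\<^sup>2 + \<omega>)) + b * (2 * f3 + 10 * \<beta>) + 3 * c
      = 3 * a * (g4 + 15 * \<beta> * f4 + (70 * \<beta>\<^sup>2 + 6 * \<omega>)) + bn 3 * (f3 + 15 * \<beta>) + cn 3"
    "b * (g3 + 2 * \<beta> * f3 + (3 * \<beta>\<^sup>2 + \<omega>)) + c * (2 * f3 + 10 * \<beta>)
      = 3 * a * (h4 + 6 * \<beta> * g4 + (15 * \<beta>\<^sup>2 + 3 * \<omega>) * f4 + (28 * \<beta>^3 + 20 * \<beta> * \<omega>))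
        + bn 3 * (g3 + 6 * \<beta> * f3 + (15 * \<beta>\<^sup>2 + 3 * \<omega>)) + cn 3 * (f2 + 6 * \<beta>)"
    "c * (g3 + 2 * \<beta> * f3 + (3 * \<beta>\<^sup>2 + \<omega>))
      = 3 * a * (i4 + \<beta> * h4 + (\<beta>\<^sup>2 + \<omega>) * g4 + (\<beta>^3 + 3 * \<beta> * \<omega>) * f4 + (\<beta>^4 + 6 * \<beta>\<^sup>2 * \<omega> + \<omega>\<^sup>2))
        + bn 3 * (h3 + \<beta> * g3 + (\<beta>\<^sup>2 + \<omega>) * f3 + (\<beta>^3 + 3 * \<beta> * \<omega>)) + cn 3 * (g2 + \<beta> * f2 + (\<beta>\<^sup>2 + \<omega>))"
    using * by (simp_all only: pCons_eq_iff)
qed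

end

section \<open>Exclusion of the degenerate family\<close>

context quadratic_structure
begin

lemma bn_eq: "bn (Suc n) = k * (B (Suc n) - B 0) / 2"
  using e_zero[of n] by (simp add: e_def field_simps)

lemmas f_defs = f2_def g2_def f3_def g3_def h3_def f4_def g4_def h4_def i4_def

lemma contradiction: False
proof -
  have bn: "bn 1 = k * (B 1 - B 0) / 2" "bn 2 = k * (B 2 - B 0) / 2" "bn 3 = k * (B 3 - B 0) / 2"
    using bn_eq[of 0] bn_eq[of 1] bn_eq[of 2] by (simp_all add: numeral_2_eq_2 numeral_3_eq_3)
  have cn: "cn 1 = C 1 * k" "cn 2 = C 2 * (k - 1)" "cn 3 = C 3 * (k - 2)"
    using cn_eq[of 0] cn_eq[of 1] cn_eq[of 2] by (simp_all add: numeral_2_eq_2 numeral_3_eq_3)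
  note rels = relation_1 relation_2 relation_3
  \<comment> \<open>The two coefficients of \<open>V = 0\<close> that tie \<open>b\<close>,
    \<open>c\<close> and \<open>k\<close> to the lattice.\<close>
  have V: "4 * \<beta> * m0 = \<omega> * \<mu>0" "4 * \<beta> * m1 - 4 * \<beta> * \<mu>0 = \<omega> * (4 + k)"
    using V_zero unfolding V_eq by (simp_all del: mult_eq_0_iff)
  show False
  proof (cases "\<beta> = 0")
    case True
    have \<omega>: "\<omega> \<noteq> 0" using \<omega>_nonzero True by blast
    have k: "k = - 4" using V(2) \<omega> True by (simp add: add_eq_0_iff)
    have "\<mu>0 = 0" using V(1) \<omega> True by simp
    then have b: "b = - 2 * B 0" using True k unfolding \<mu>0_def by (simp add: algebra_simps) algebra
    note rels = rels[unfolded bn cn f_defs k b power2_eq_square True power_zero_numeral mult_zero_left mult_zero_right add_0_left add_0_right mult_1_left]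
    \<comment> \<open>The relations for n \<le> 3 are solved successively, leaving
      \<open>C 1\<close> free; the constant term for n = 3 is then contradictory.\<close>
    have B1: "B 1 = B 0" using rels(1) by algebra
    have B2: "B 2 = B 0" using rels(3) B1 by algebra
    have B3: "B 3 = B 0" using rels(6) B1 B2 by algebra
    have c: "c = \<omega> - 5 * C 1 + B 0 * B 0" using rels(2) B1 by algebra
    have C2: "7 * C 2 = 4 * \<omega> + 8 * C 1" using rels(4) B1 B2 c by algebra
    have C3: "21 * C 3 = 30 * \<omega> + 25 * C 1" using rels(7) B1 B2 B3 c C2 by algebra
    have "\<omega> * \<omega> = 0" using rels(9) B1 B2 B3 c C2 C3 by algebra
    then show False using \<omega> by simp
  next
    case False
    have k: "k = - 3" using v2_zero False by simp
    \<comment> \<open>The free parameter of the family: the value of \<open>w2\<close> at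
      \<open>B 0\<close>, scaled. The constant term for n = 2 forces 4t = 1, and the coefficient of
      z for n = 3 then forces \<beta> = 0.\<close>
    define t where "t = (\<omega> + 4 * \<beta> * B 0) / (16 * \<beta>\<^sup>2)"
    have \<omega>: "\<omega> = 16 * \<beta>\<^sup>2 * t - 4 * \<beta> * B 0"
      using False by (simp add: t_def field_simps)
    have b: "b = - \<beta> - 2 * B 0 - 4 * \<beta> * t"
    proof -
      have "4 * \<beta> * (b + \<beta> + 3 * B 0) + \<omega> = 0"
        using V(2) k unfolding m1_def \<mu>0_def by algebra
      then have "4 * \<beta> * (b - (- \<beta> - 2 * B 0 - 4 * \<beta> * t)) = 0"
        unfolding \<omega> by algebra
      then show ?thesis using False by simp
    qed
    have c: "c = B 0 * B 0 + B 0 * (\<beta> + 4 * \<beta> * t) - 4 * \<beta>\<^sup>2 * t * (8 * t + 1)"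
    proof -
      have "4 * \<beta> * (c - (B 0 * B 0 + B 0 * (\<beta> + 4 * \<beta> * t) - 4 * \<beta>\<^sup>2 * t * (8 * t + 1))) = 0"
        using V(1) k b \<omega> unfolding m0_def \<mu>0_def by algebra
      then show ?thesis using False by simp
    qed
    note rels = rels[unfolded bn cn f_defs k]
    have B1: "5 * B 1 = 5 * B 0 + \<beta> * (14 + 8 * t)" using rels(1) b by algebra
    have B2: "35 * B 2 = 35 * B 0 + \<beta> * (272 + 64 * t)" using rels(3) B1 b by algebra
    have B3: "42 * B 3 = 42 * B 0 + \<beta> * (620 + 80 * t)" using rels(6) B1 B2 b by algebra
    have C1: "2 * C 1 = \<beta>\<^sup>2 * (- 3 + 8 * t + 16 * t\<^sup>2)" using rels(2) B1 b c \<omega> by algebra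
    have C2: "50 * C 2 = \<beta>\<^sup>2 * (- 737 + 792 * t + 432 * t\<^sup>2)" using rels(4) B1 B2 C1 b c \<omega> by algebra
    have C3: "49 * C 3 = \<beta>\<^sup>2 * (- 2921 + 1656 * t + 432 * t\<^sup>2)" using rels(7) B1 B2 B3 C1 C2 b c \<omega> by algebra
    have "\<beta>^3 * (4 * t - 1) = 0" using rels(5) B1 B2 C1 C2 b c \<omega> by algebra
    then have t4: "4 * t = 1" using False by simp
    have "\<beta>^3 = 0" using rels(8) B1 B2 B3 C1 C2 C3 b c \<omega> t4 by algebra
    then show False using False by simp
  qed
qed

end

section \<open>Linear coefficient\<close>

locale linear_structure = structured_OPS where a = 0 +
  assumes side_condition: "b * C 2 = cn 2 / 2 * (B 1 - B 0)"
begin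

lemma bn_eq: "bn n = b * of_nat n"
proof (cases n)
  case 0
  then show ?thesis by (simp add: an_bn_0)
next
  case (Suc m)
  have "coeff ([:c, b, 0:] * D (P n)) n = b * of_nat n"
    using coeff_SD(3)[of "P n" n] coeff_SD_high[of "P n" n] Suc by (simp add: coeff_lin_mult)
  moreover have "coeff (smult (bn n) (S (P n)) + smult (cn n) (S (shift_seq P n))) n = bn n"
    using coeff_SD(1)[of "P n" "n"] coeff_SD_high[of "P m" m] Suc
    by (simp add: shift_seq_def)
  moreover have "[:c, b, 0:] * D (P n) = smult (bn n) (S (P n)) + smult (cn n) (S (shift_seq P n))"
    using structure_rel[of n] by (simp only: an_eq mult_zero_left smult_0_left add_0)
  ultimately show ?thesis by metis
qed

text \<open>With \<sigma> constant the relation is c D P_n = c_n S P_(n-1). Its coefficients for n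
  \<le> 4 determine \<open>B 1\<close>, \<open>B 2\<close>, \<open>B 3\<close> and
  \<open>C 3\<close>, and the constant term for n = 4 leaves \<beta> \<open>C 2\<close> = 0.\<close>

lemma case_b_zero:
  assumes "b = 0" shows "\<beta> = 0"
proof -
  have c: "c \<noteq> 0" using relation_1 cn_nonzero[of 1] by (auto simp: bn_eq assms)
  have r2: "2 * c = cn 2" "f2 = - 2 * B 0"
  proof -
    show "2 * c = cn 2" using relation_2(2) by (simp add: bn_eq assms)
    moreover have "c * (f2 + 2 * \<beta>) = cn 2 * (\<beta> - B 0)" using relation_2(3) by (simp add: bn_eq assms)
    ultimately have "c * (f2 + 2 * \<beta>) = 2 * c * (\<beta> - B 0)" by simp
    then have "c * (f2 + 2 * B 0) = 0" by algebra
    then show "f2 = - 2 * B 0" using c by (simp add: eq_neg_iff_add_eq_0)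
  qed
  have r3: "2 * f3 + 10 * \<beta> = 3 * (f2 + 6 * \<beta>)"
    "g3 + 2 * \<beta> * f3 + (3 * \<beta>\<^sup>2 + \<omega>) = 3 * (g2 + \<beta> * f2 + (\<beta>\<^sup>2 + \<omega>))"
  proof -
    have "3 * c = cn 3" using relation_3(2) by (simp add: bn_eq assms)
    moreover have "c * (2 * f3 + 10 * \<beta>) = cn 3 * (f2 + 6 * \<beta>)" using relation_3(3) by (simp add: bn_eq assms)
    moreover have "c * (g3 + 2 * \<beta> * f3 + (3 * \<beta>\<^sup>2 + \<omega>)) = cn 3 * (g2 + \<beta> * f2 + (\<beta>\<^sup>2 + \<omega>))"
      using relation_3(4) by (simp add: bn_eq assms)
    ultimately have "c * (2 * f3 + 10 * \<beta>) = c * (3 * (f2 + 6 * \<beta>))"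
      "c * (g3 + 2 * \<beta> * f3 + (3 * \<beta>\<^sup>2 + \<omega>)) = c * (3 * (g2 + \<beta> * f2 + (\<beta>\<^sup>2 + \<omega>)))"
      by (metis mult.assoc mult.commute)+
    then show "2 * f3 + 10 * \<beta> = 3 * (f2 + 6 * \<beta>)"
      "g3 + 2 * \<beta> * f3 + (3 * \<beta>\<^sup>2 + \<omega>) = 3 * (g2 + \<beta> * f2 + (\<beta>\<^sup>2 + \<omega>))" using c by simp_all
  qed
  have "[:c, 0, 0:] * D (P 4) = smult (cn 4) (S (P 3))"
    using structure_rel[of 4] assms by (simp add: an_eq bn_eq shift_seq_def) (simp add: numeral_eq_Suc)?
  then have *: "[:c * (h4 + 2 * \<beta> * g4 + (3 * \<beta>\<^sup>2 + \<omega>) * f4 + (4 * \<beta>^3 + 4 * \<beta> * \<omega>)),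
      c * (2 * g4 + 10 * \<beta> * f4 + (28 * \<beta>\<^sup>2 + 4 * \<omega>)), c * (3 * f4 + 28 * \<beta>), c * 4:] =
    [:cn 4 * (h3 + \<beta> * g3 + (\<beta>\<^sup>2 + \<omega>) * f3 + (\<beta>^3 + 3 * \<beta> * \<omega>)),
      cn 4 * (g3 + 6 * \<beta> * f3 + (15 * \<beta>\<^sup>2 + 3 * \<omega>)), cn 4 * (f3 + 15 * \<beta>), cn 4:]"
    by (simp add: P3 P4 SD_quartic SD_cubic algebra_simps)
  then have "c * 4 = cn 4" "c * (3 * f4 + 28 * \<beta>) = cn 4 * (f3 + 15 * \<beta>)"
    "c * (2 * g4 + 10 * \<beta> * f4 + (28 * \<beta>\<^sup>2 + 4 * \<omega>)) = cn 4 * (g3 + 6 * \<beta> * f3 + (15 * \<beta>\<^sup>2 + 3 * \<omega>))"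
    "c * (h4 + 2 * \<beta> * g4 + (3 * \<beta>\<^sup>2 + \<omega>) * f4 + (4 * \<beta>^3 + 4 * \<beta> * \<omega>))
      = cn 4 * (h3 + \<beta> * g3 + (\<beta>\<^sup>2 + \<omega>) * f3 + (\<beta>^3 + 3 * \<beta> * \<omega>))"
    by (simp_all only: pCons_eq_iff)
  then have "c * (3 * f4 + 28 * \<beta>) = c * (4 * (f3 + 15 * \<beta>))"
    "c * (2 * g4 + 10 * \<beta> * f4 + (28 * \<beta>\<^sup>2 + 4 * \<omega>)) = c * (4 * (g3 + 6 * \<beta> * f3 + (15 * \<beta>\<^sup>2 + 3 * \<omega>)))"
    "c * (h4 + 2 * \<beta> * g4 + (3 * \<beta>\<^sup>2 + \<omega>) * f4 + (4 * \<beta>^3 + 4 * \<beta> * \<omega>))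
      = c * (4 * (h3 + \<beta> * g3 + (\<beta>\<^sup>2 + \<omega>) * f3 + (\<beta>^3 + 3 * \<beta> * \<omega>)))"
    by (metis mult.assoc)+
  then have r4: "3 * f4 + 28 * \<beta> = 4 * (f3 + 15 * \<beta>)"
    "2 * g4 + 10 * \<beta> * f4 + (28 * \<beta>\<^sup>2 + 4 * \<omega>) = 4 * (g3 + 6 * \<beta> * f3 + (15 * \<beta>\<^sup>2 + 3 * \<omega>))"
    "h4 + 2 * \<beta> * g4 + (3 * \<beta>\<^sup>2 + \<omega>) * f4 + (4 * \<beta>^3 + 4 * \<beta> * \<omega>)
      = 4 * (h3 + \<beta> * g3 + (\<beta>\<^sup>2 + \<omega>) * f3 + (\<beta>^3 + 3 * \<beta> * \<omega>))" using c by simp_all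
  have B1: "B 1 = B 0" using r2(2) unfolding f2_def by algebra
  have B2: "B 2 = B 0 - 4 * \<beta>" using r3(1) B1 unfolding f3_def f2_def by algebra
  have B3: "B 3 = B 0 - 12 * \<beta>" using r4(1) B1 B2 unfolding f4_def f3_def f2_def by algebra
  have C3: "C 3 = 64 * \<beta>\<^sup>2 + C 1 + C 2 - 4 * (\<omega> + 4 * \<beta> * B 0)" using r4(2) r3(2) B1 B2 B3
    unfolding f4_def g4_def f3_def g3_def f2_def g2_def by algebra
  have "\<beta> * C 2 = 0" using r4(3) r3(2) C3 B1 B2 B3
    unfolding f4_def g4_def h4_def f3_def g3_def h3_def f2_def g2_def by algebra
  then show ?thesis using C_nonzero[of 2] by simp
qed

text \<open>The equation says that \<sigma> and \<open>w2\<close> are linearly dependent. For b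
  \<noteq> 0 it comes out of the relations for n = 2, 3 and the side condition, up to the factors b
  and \<open>B 1 - B 0\<close>.\<close>

lemma sigma_proportional: "b * \<omega> = 4 * \<beta> * c"
proof (cases "b = 0")
  case True
  then show ?thesis using case_b_zero by simp
next
  case False
  have bn: "bn 1 = b" "bn 2 = 2 * b" "bn 3 = 3 * b" by (simp_all add: bn_eq)
  note rels = relation_1 relation_2 relation_3
  note rels = rels[unfolded bn]
  define y where "y = B 1 - B 0"
  have y: "B 1 = B 0 + y" by (simp add: y_def)
  have c2: "cn 2 = b * (y - 10 * \<beta>) + 2 * (c + b * B 0)"
    using rels(4) y unfolding f2_def by algebra
  have "b * (2 * C 1) = b * (2 * \<omega>) - 8 * b * \<beta>\<^sup>2 - b * y * \<beta> + c * y + b * B 0 * y + 8 * b * \<beta> * B 0"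
    using rels(5) c2 y unfolding f2_def g2_def by algebra
  have "b * b * (y * (b * \<omega> - 4 * \<beta> * c)) = 0"
    using rels(4-9) side_condition y unfolding f2_def g2_def f3_def g3_def h3_def by algebra
  \<comment> \<open>The side condition equates a multiple of \<open>y\<close> with
    \<open>b * C 2\<close>, which is nonzero.\<close>
  moreover have "y \<noteq> 0" using side_condition False C_nonzero[of 2] by (auto simp: y_def)
  ultimately show ?thesis using False by simp
qed

end

section \<open>The difference equation\<close>

context quadratic_lattice
begin

text \<open>The solutions turn out to have the recurrence coefficients \<open>B\<^sub>n = BB \<nu> B\<^sub>0 n\<close> and
  \<open>C\<^sub>n = \<gamma> \<nu> B\<^sub>0 n (\<nu> - n)\<close>, where \<open>\<nu>\<close> is a free parameter.\<close>

definition BB :: "complex \<Rightarrow> complex \<Rightarrow> nat \<Rightarrow> complex" where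
  "BB \<nu> B0 n = B0 + 8 * \<beta> * of_nat n * (\<nu> - of_nat n - 1)"
definition \<gamma> :: "complex \<Rightarrow> complex \<Rightarrow> nat \<Rightarrow> complex" where
  "\<gamma> \<nu> B0 n = of_nat n * (4 * \<beta> * B0 + \<omega> - 4 * \<beta>\<^sup>2 - 16 * \<beta>\<^sup>2 * (of_nat n - 1) * (of_nat n + 1 - \<nu>))"

text \<open>The operator \<phi> D D + \<psi> S D for \<aa> = 0: in terms of \<nu>, \<bb> is
  \<open>4 * \<beta> * \<nu> - 6 * \<beta>\<close> and \<open>C 1\<close> is
  \<open>(\<nu> - 1) * \<gamma> \<nu> B0 1\<close>.\<close>

definition L :: "complex \<Rightarrow> complex \<Rightarrow> complex poly \<Rightarrow> complex poly" where
  "L \<nu> B0 p = ([:B0, -1:] * [:4 * \<beta> * \<nu> - 6 * \<beta>:] - [:(\<nu> - 1) * \<gamma> \<nu> B0 1:]) * D (D p) + [:- B0, 1:] * S (D p)"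
text \<open>The commutator of \<open>L\<close> with multiplication by z.\<close>

definition L' :: "complex \<Rightarrow> complex \<Rightarrow> complex poly \<Rightarrow> complex poly" where
  "L' \<nu> B0 p = L \<nu> B0 ([:0, 1:] * p) - [:0, 1:] * L \<nu> B0 p"

lemma L_linear: "L \<nu> B0 (p + q) = L \<nu> B0 p + L \<nu> B0 q" "L \<nu> B0 (smult t p) = smult t (L \<nu> B0 p)"
  "L \<nu> B0 (p - q) = L \<nu> B0 p - L \<nu> B0 q"
  by (simp_all add: L_def algebra_simps smult_add_right smult_diff_right)

lemma L'_linear: "L' \<nu> B0 (p + q) = L' \<nu> B0 p + L' \<nu> B0 q" "L' \<nu> B0 (smult t p) = smult t (L' \<nu> B0 p)"
  "L' \<nu> B0 (p - q) = L' \<nu> B0 p - L' \<nu> B0 q"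
  unfolding L'_def distrib_left right_diff_distrib mult_smult_right L_linear smult_diff_right
  by (rule refl | simp only: algebra_simps)+

lemma DD_var: "D (D ([:0, 1:] * p)) = smult 2 (S (D p)) + [:4 * \<beta>, 1:] * D (D p)"
  and SD_var_mult: "S (D ([:0, 1:] * p)) = p + [:4 * \<beta>, 1:] * S (D p) + smult 2 (w2 * D (D p))"
proof -
  have bS: "S [:\<beta>, 1:] = [:2 * \<beta>, 1:]" and bD: "D [:\<beta>, 1:] = 1"
    by (simp_all add: S_pCons D_pCons one_pCons)
  have [simp]: "poly w2 t = \<omega> + 4 * \<beta> * t" for t by (simp add: w2_def)
  show "D (D ([:0, 1:] * p)) = smult 2 (S (D p)) + [:4 * \<beta>, 1:] * D (D p)"
    unfolding D_var_mult D_add D_mult[of "[:\<beta>, 1:]"] bS bD D_S by (rule poly_ext) (simp add: algebra_simps)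
  show "S (D ([:0, 1:] * p)) = p + [:4 * \<beta>, 1:] * S (D p) + smult 2 (w2 * D (D p))"
    unfolding D_var_mult S_add S_mult[of "[:\<beta>, 1:]"] bS bD S_S by (rule poly_ext) (simp add: algebra_simps)
qed

text \<open>The double commutator relation, with the outer commutator written out; it expresses
  \<open>L'\<close> at z p through \<open>L'\<close> and \<open>L\<close> at p.\<close>

lemma L'_var: "L' \<nu> B0 ([:0, 1:] * p) = [:8 * \<beta>, 1:] * L' \<nu> B0 p + smult 4 ((w2 - [:4 * \<beta>\<^sup>2:]) * L \<nu> B0 p)
    + (smult 2 ([:B0, -1:] * [:4 * \<beta> * \<nu> - 6 * \<beta>:] - [:(\<nu> - 1) * \<gamma> \<nu> B0 1:]) - smult (4 * \<beta>) [:- B0, 1:]) * p"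
proof -
  define \<phi> where "\<phi> = [:B0, -1:] * [:4 * \<beta> * \<nu> - 6 * \<beta>:] - [:(\<nu> - 1) * \<gamma> \<nu> B0 1:]"
  define \<psi> where "\<psi> = [:- B0, 1:]"
  have w: "poly w2 t = \<omega> + 4 * \<beta> * t" for t by (simp add: w2_def)
  show ?thesis
    unfolding L'_def L_def DD_var SD_var_mult unfolding \<phi>_def[symmetric] \<psi>_def[symmetric]
    by (rule poly_ext)
      (simp only: poly_add poly_diff poly_mult poly_smult poly_pCons poly_0 w; algebra)
qed

lemma L_eigen:
  assumes P0: "P 0 = 1" and P1: "P 1 = [:- B0, 1:]"
    and P_Suc: "\<And>n. P (Suc (Suc n)) = [:- BB \<nu> B0 (Suc n), 1:] * P (Suc n) - smult (\<gamma> \<nu> B0 (Suc n) * (\<nu> - of_nat (Suc n))) (P n)"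
  shows "L \<nu> B0 (P n) = smult (of_nat n) (P n)"
proof -
  have zP: "[:0, 1:] * P (Suc n) = P (Suc (Suc n)) + smult (BB \<nu> B0 (Suc n)) (P (Suc n)) + smult (\<gamma> \<nu> B0 (Suc n) * (\<nu> - of_nat (Suc n))) (P n)" for n
    by (simp add: P_Suc)
  \<comment> \<open>The eigenvalues n force the commutator to map P_n to P_(n+1) - C_n P_(n-1). Both
    statements are carried along for two consecutive indices, as the three-term recurrence
    requires.\<close>
  have *: "L \<nu> B0 (P n) = smult (of_nat n) (P n) \<and> L \<nu> B0 (P (Suc n)) = smult (of_nat (Suc n)) (P (Suc n)) \<and>
     L' \<nu> B0 (P (Suc n)) = P (Suc (Suc n)) - smult (\<gamma> \<nu> B0 (Suc n) * (\<nu> - of_nat (Suc n))) (P n) \<and>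
     (\<forall>m. n = Suc m \<longrightarrow> L' \<nu> B0 (P n) = P (Suc n) - smult (\<gamma> \<nu> B0 n * (\<nu> - of_nat n)) (P m))" for n
  proof (induction n)
    case 0
    have L0: "L \<nu> B0 1 = 0" by (simp add: L_def)
    have L1: "L \<nu> B0 [:- B0, 1:] = [:- B0, 1:]" by (simp add: L_def D_pCons)
    have L'0: "L' \<nu> B0 1 = P 1"
    proof -
      have "L' \<nu> B0 1 = L \<nu> B0 ([:- B0, 1:] + smult B0 1)"
        by (simp add: L'_def L0)
      also have "\<dots> = P 1" unfolding L_linear L0 L1 P1 by simp
      finally show ?thesis .
    qed
    have "L' \<nu> B0 (P 1) = L' \<nu> B0 ([:0, 1:] * 1) - smult B0 (L' \<nu> B0 1)"
    proof -
      have "P 1 = [:0, 1:] * 1 - smult B0 1" unfolding P1 by simp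
      then show ?thesis by (simp only: L'_linear)
    qed
    also have "\<dots> = P 2 - smult (\<gamma> \<nu> B0 1 * (\<nu> - 1)) 1"
      unfolding L'_var L'0 L0 P1
      by (simp add: numeral_2_eq_2 P_Suc P0 P1[unfolded One_nat_def] BB_def \<gamma>_def w2_def power2_eq_square algebra_simps)
    finally have L'1: "L' \<nu> B0 (P (Suc 0)) = P (Suc (Suc 0)) - smult (\<gamma> \<nu> B0 (Suc 0) * (\<nu> - 1)) 1"
      by (simp add: numeral_2_eq_2)
    have "P (Suc 0) = [:- B0, 1:]" using P1 by (simp only: One_nat_def)
    then have "L \<nu> B0 (P (Suc 0)) = P (Suc 0)" using L1 by (simp only:)
    then show ?case by (simp add: P0 L0 L'1)
  next
    case (Suc n)
    let ?B = "BB \<nu> B0" and ?C = "\<lambda>n. \<gamma> \<nu> B0 n * (\<nu> - of_nat n)"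
    have L_n: "L \<nu> B0 (P n) = smult (of_nat n) (P n)"
      and L_Sn: "L \<nu> B0 (P (Suc n)) = smult (of_nat (Suc n)) (P (Suc n))"
      and L'_Sn: "L' \<nu> B0 (P (Suc n)) = P (Suc (Suc n)) - smult (?C (Suc n)) (P n)"
      using Suc by auto
    have "L \<nu> B0 ([:0, 1:] * P (Suc n)) = L' \<nu> B0 (P (Suc n)) + [:0, 1:] * L \<nu> B0 (P (Suc n))"
      by (simp add: L'_def)
    then have "L \<nu> B0 (P (Suc (Suc n))) + smult (?B (Suc n)) (smult (of_nat (Suc n)) (P (Suc n))) + smult (?C (Suc n)) (smult (of_nat n) (P n))
        = P (Suc (Suc n)) - smult (?C (Suc n)) (P n) + smult (of_nat (Suc n)) ([:0, 1:] * P (Suc n))"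
      unfolding L_Sn L'_Sn mult_smult_right unfolding zP L_linear L_Sn L_n .
    note rel = this[unfolded zP]
    have L_SSn: "L \<nu> B0 (P (Suc (Suc n))) = smult (of_nat (Suc (Suc n))) (P (Suc (Suc n)))"
    proof (rule poly_ext)
      fix t
      show "poly (L \<nu> B0 (P (Suc (Suc n)))) t = poly (smult (of_nat (Suc (Suc n))) (P (Suc (Suc n)))) t"
        using arg_cong[OF rel, of "\<lambda>p. poly p t"]
        unfolding poly_add poly_diff poly_smult of_nat_Suc by algebra
    qed
    have "L' \<nu> B0 ([:0, 1:] * P (Suc n)) = [:8 * \<beta>, 1:] * (P (Suc (Suc n)) - smult (?C (Suc n)) (P n)) + 
        smult 4 ((w2 - [:4 * \<beta>\<^sup>2:]) * smult (of_nat (Suc n)) (P (Suc n)))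
        + (smult 2 ([:B0, -1:] * [:4 * \<beta> * \<nu> - 6 * \<beta>:] - [:(\<nu> - 1) * \<gamma> \<nu> B0 1:]) - smult (4 * \<beta>) [:- B0, 1:]) * P (Suc n)"
      unfolding L'_var L_Sn L'_Sn ..
    moreover have "L' \<nu> B0 ([:0, 1:] * P (Suc n)) = L' \<nu> B0 (P (Suc (Suc n))) + smult (?B (Suc n)) (P (Suc (Suc n)) - smult (?C (Suc n)) (P n))
        + smult (?C (Suc n)) (L' \<nu> B0 (P n))"
      unfolding zP L'_linear L'_Sn ..
    ultimately have rel: "[:8 * \<beta>, 1:] * (P (Suc (Suc n)) - smult (?C (Suc n)) (P n)) + 
        smult 4 ((w2 - [:4 * \<beta>\<^sup>2:]) * smult (of_nat (Suc n)) (P (Suc n)))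
        + (smult 2 ([:B0, -1:] * [:4 * \<beta> * \<nu> - 6 * \<beta>:] - [:(\<nu> - 1) * \<gamma> \<nu> B0 1:]) - smult (4 * \<beta>) [:- B0, 1:]) * P (Suc n)
       = L' \<nu> B0 (P (Suc (Suc n))) + smult (?B (Suc n)) (P (Suc (Suc n)) - smult (?C (Suc n)) (P n))
        + smult (?C (Suc n)) (L' \<nu> B0 (P n))"
      by (simp only:)
    have eq: "poly (L' \<nu> B0 (P (Suc (Suc n)))) t = (8 * \<beta> + t) * (poly (P (Suc (Suc n))) t - ?C (Suc n) * poly (P n) t) + 
        4 * (\<omega> + 4 * \<beta> * t - 4 * \<beta>\<^sup>2) * of_nat (Suc n) * poly (P (Suc n)) t
        + (2 * ((B0 - t) * (4 * \<beta> * \<nu> - 6 * \<beta>) - (\<nu> - 1) * \<gamma> \<nu> B0 1) - 4 * \<beta> * (t - B0)) * poly (P (Suc n)) t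
        - ?B (Suc n) * (poly (P (Suc (Suc n))) t - ?C (Suc n) * poly (P n) t) - ?C (Suc n) * poly (L' \<nu> B0 (P n)) t" for t
      using arg_cong[OF rel, of "\<lambda>p. poly p t"]
      unfolding w2_def poly_add poly_diff poly_smult poly_mult poly_pCons poly_0 by algebra
    have z2: "t * poly (P (Suc (Suc n))) t = poly (P (Suc (Suc (Suc n)))) t + ?B (Suc (Suc n)) * poly (P (Suc (Suc n))) t + ?C (Suc (Suc n)) * poly (P (Suc n)) t" 
      and z1: "t * poly (P (Suc n)) t = poly (P (Suc (Suc n))) t + ?B (Suc n) * poly (P (Suc n)) t + ?C (Suc n) * poly (P n) t" for t
      using arg_cong[OF zP[of "Suc n"], of "\<lambda>p. poly p t"] arg_cong[OF zP[of n], of "\<lambda>p. poly p t"] by simp_all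
    have L'_SSn: "L' \<nu> B0 (P (Suc (Suc n))) = P (Suc (Suc (Suc n))) - smult (?C (Suc (Suc n))) (P (Suc n))"
    proof (rule poly_ext)
      fix t
      show "poly (L' \<nu> B0 (P (Suc (Suc n)))) t = poly (P (Suc (Suc (Suc n))) - smult (?C (Suc (Suc n))) (P (Suc n))) t"
      proof -
        \<comment> \<open>\<open>pm\<close> is P_(n-1) at \<open>t\<close>. For \<open>n = 0\<close>
          any value works, here 0, because \<open>\<gamma> \<nu> B0 0 = 0\<close>.\<close>
        obtain pm where pm: "poly (L' \<nu> B0 (P n)) t = poly (P (Suc n)) t - ?C n * pm"
            "t * poly (P n) t = poly (P (Suc n)) t + ?B n * poly (P n) t + ?C n * pm"
        proof (cases n)
          case 0
          have "L' \<nu> B0 1 = [:- B0, 1:]"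
            by (simp add: L'_def L_def D_pCons)
          then show ?thesis using that[of 0] 0 P0 P1 by (simp add: BB_def)
        next
          case (Suc m)
          have "L' \<nu> B0 (P n) = P (Suc n) - smult (?C n) (P m)" using Suc.IH Suc by blast
          then have "poly (L' \<nu> B0 (P n)) t = poly (P (Suc n)) t - ?C n * poly (P m) t" by simp
          moreover have "t * poly (P n) t = poly (P (Suc n)) t + ?B n * poly (P n) t + ?C n * poly (P m) t"
            using arg_cong[OF zP[of m], of "\<lambda>p. poly p t"] Suc by simp
          ultimately show ?thesis by (rule that)
        qed
        \<comment> \<open>\<zeta> t + \<eta> collects the factor of P_(n+1) in \<open>eq\<close>,
          which comes from 4(w2 - 4\<beta>^2)(n + 1) + 2\<phi> - 4\<beta>\<psi>. The identities
          \<open>i\<close> and \<open>ii\<close> are the coefficient conditions under which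
          everything else cancels.\<close>
        define \<zeta> where "\<zeta> = 16 * \<beta> * of_nat (Suc n) - 2 * (4 * \<beta> * \<nu> - 6 * \<beta>) - 4 * \<beta>"
        define \<eta> where "\<eta> = 4 * (\<omega> - 4 * \<beta>\<^sup>2) * of_nat (Suc n) + 2 * (B0 * (4 * \<beta> * \<nu> - 6 * \<beta>) - (\<nu> - 1) * \<gamma> \<nu> B0 1) + 4 * \<beta> * B0"
        have i: "?B (Suc (Suc n)) = ?B (Suc n) - 8 * \<beta> - \<zeta>" "?B n = ?B (Suc n) - 8 * \<beta> + \<zeta>"
          by (simp_all add: BB_def \<zeta>_def algebra_simps)
        have ii: "2 * ?C (Suc (Suc n)) = 2 * ?C (Suc n) - \<zeta> * ?B (Suc n) - \<eta>"
          by (simp add: BB_def \<zeta>_def \<eta>_def \<gamma>_def power2_eq_square algebra_simps)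
        define b0 b1 b2 c0 c1 c2 where c: "b0 = ?B n" "b1 = ?B (Suc n)" "b2 = ?B (Suc (Suc n))" "c0 = ?C n" "c1 = ?C (Suc n)" "c2 = ?C (Suc (Suc n))"
        have "poly (L' \<nu> B0 (P (Suc (Suc n)))) t = (8 * \<beta> + t) * (poly (P (Suc (Suc n))) t - c1 * poly (P n) t) + 
          (\<zeta> * t + \<eta>) * poly (P (Suc n)) t - b1 * (poly (P (Suc (Suc n))) t - c1 * poly (P n) t) - c1 * poly (L' \<nu> B0 (P n)) t"
          unfolding eq[of t] c \<zeta>_def \<eta>_def by (simp add: algebra_simps)
        then show ?thesis
          using pm z1[of t] z2[of t] i ii unfolding poly_diff poly_smult c[symmetric] by algebra
      qed
    qed
    show ?case using L_Sn L_SSn L'_SSn L'_Sn by simp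
  qed
  then show ?thesis by blast
qed

end

section \<open>Recurrence coefficients\<close>

context linear_structure
begin

text \<open>With \<sigma> = \<rho> \<open>w2\<close>, the commutation relation of
  \<open>A / \<rho>\<close> with z, read in the basis \<open>P n\<close>, becomes recurrences for
  \<open>B\<close>, \<open>C\<close> and the scaled \<open>cn\<close> that can be solved.\<close>

lemma closed_form:
  obtains \<nu> where "\<And>n. B n = BB \<nu> (B 0) n" "\<And>n. C (Suc n) = \<gamma> \<nu> (B 0) (Suc n) * (\<nu> - of_nat (Suc n))"
proof -
  obtain \<rho> where \<rho>: "b = 4 * \<beta> * \<rho>" "c = \<omega> * \<rho>"
  proof (cases "\<beta> = 0")
    case True
    then have "b = 0" using sigma_proportional \<omega>_nonzero by simp
    then show ?thesis using that[of "c / \<omega>"] \<omega>_nonzero True by simp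
  next
    case False
    then have "c = \<omega> * (b / (4 * \<beta>))" using sigma_proportional by (simp add: field_simps)
    then show ?thesis using that[of "b / (4 * \<beta>)"] False by simp
  qed
  have \<rho>0: "\<rho> \<noteq> 0"
  proof
    assume "\<rho> = 0"
    then have "cn 1 = 0" using relation_1 bn_eq[of 1] \<rho> by simp
    then show False using cn_nonzero by blast
  qed
  \<comment> \<open>The structure relation leaves \<open>cn 0\<close> arbitrary, since it multiplies
    P_(-1) = 0; the value 0 makes the recurrence for \<open>g\<close> start at
    \<open>n = 0\<close>.\<close>
  define g where "g n = (if n = 0 then 0 else cn n / \<rho>)" for n
  have g0: "g n \<noteq> 0" if "n > 0" for n using that cn_nonzero \<rho>0 by (simp add: g_def)
  define A where "A n = smult (4 * \<beta> * of_nat n) (P n) + smult (g n) (shift_seq P n)" for n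
  have SA: "S (A n) = w2 * D (P n)" for n
  proof -
    have "[:c, b, 0:] = smult \<rho> w2" by (simp add: \<rho> w2_def)
    then have "smult \<rho> (w2 * D (P n)) = smult (b * of_nat n) (S (P n)) + smult (cn n) (S (shift_seq P n))"
      using structure_rel[of n] by (simp only: an_eq bn_eq mult_zero_left smult_0_left add_0 mult_smult_left)
    also have "\<dots> = smult \<rho> (S (A n))"
      using \<rho>0 by (cases n) (simp_all add: A_def g_def \<rho> smult_add_right shift_seq_def algebra_simps)
    finally show ?thesis using \<rho>0 smult_cancel by metis
  qed
  have zP: "[:0, 1:] * P n = P (Suc n) + smult (B n) (P n) + smult (C n) (shift_seq P n)" for n
    using rec by (simp add: recurrence_coeffs_def)
  \<comment> \<open>[A, X] = 4\<beta>(X - A - \<beta>) + \<omega> - A^2 applied to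
    \<open>P n\<close>, for the operator with S A = \<open>w2\<close> D. It is checked after
    applying the injective \<open>S\<close>.\<close>
  have comm: "A (Suc n) + smult (B n) (A n) + smult (C n) (case n of 0 \<Rightarrow> 0 | Suc i \<Rightarrow> A i) - [:0, 1:] * A n
     = smult (4 * \<beta>) ([:0, 1:] * P n) - smult (4 * \<beta>) (A n) + smult (\<omega> - 4 * \<beta>\<^sup>2) (P n)
       - smult (4 * \<beta> * of_nat n) (A n) - smult (g n) (case n of 0 \<Rightarrow> 0 | Suc i \<Rightarrow> A i)" for n
  proof (rule S_inj)
    let ?A = "case n of 0 \<Rightarrow> 0 | Suc i \<Rightarrow> A i"
    have A': "S ?A = w2 * D (shift_seq P n)" by (simp add: shift_seq_def SA split: nat.split)
    have 1: "S (A (Suc n) + smult (B n) (A n) + smult (C n) ?A) = w2 * D ([:0, 1:] * P n)"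
      unfolding zP by (simp add: SA A' algebra_simps)
    have "w2 * D (A n) = smult (4 * \<beta> * of_nat n) (w2 * D (P n)) + smult (g n) (w2 * D (shift_seq P n))"
      unfolding A_def D_add D_smult by (simp add: algebra_simps)
    then have 2: "S (smult (4 * \<beta> * of_nat n) (A n) + smult (g n) ?A) = w2 * D (A n)"
      by (simp add: SA A')
    have "S (A (Suc n) + smult (B n) (A n) + smult (C n) ?A - [:0, 1:] * A n) = w2 * S (P n) - w2 * D (A n)"
      unfolding S_diff 1 S_var_mult D_var_mult SA by (simp add: algebra_simps)
    also have "\<dots> = S (smult (4 * \<beta>) ([:0, 1:] * P n) - smult (4 * \<beta>) (A n) + smult (\<omega> - 4 * \<beta>\<^sup>2) (P n)
       - (smult (4 * \<beta> * of_nat n) (A n) + smult (g n) ?A))"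
      unfolding S_diff[of _ "_ + _"] 2 unfolding S_add S_diff S_smult S_var_mult SA
      by (rule poly_ext) (simp add: w2_def power2_eq_square algebra_simps)
    finally show "S (A (Suc n) + smult (B n) (A n) + smult (C n) ?A - [:0, 1:] * A n)
      = S (smult (4 * \<beta>) ([:0, 1:] * P n) - smult (4 * \<beta>) (A n) + smult (\<omega> - 4 * \<beta>\<^sup>2) (P n)
       - smult (4 * \<beta> * of_nat n) (A n) - smult (g n) ?A)"
      by (simp add: diff_diff_eq)
  qed
  have indep: "x2 = 0" "x1 = 0" "x0 = 0"
    if "smult x2 (P (Suc (Suc i))) + smult x1 (P (Suc i)) + smult x0 (P i) = 0" for x2 x1 x0 i
  proof -
    have "u (P j * (smult x2 (P (Suc (Suc i))) + smult x1 (P (Suc i)) + smult x0 (P i))) = 0" for j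
      unfolding that by (simp add: lin)
    then have *: "x2 * u (P j * P (Suc (Suc i))) + x1 * u (P j * P (Suc i)) + x0 * u (P j * P i) = 0" for j
      by (simp add: distrib_left lin)
    show "x2 = 0" "x1 = 0" "x0 = 0"
      using *[of "Suc (Suc i)"] *[of "Suc i"] *[of i] h_nonzero by (simp_all add: orth)
  qed
  \<comment> \<open>For index n the coefficients of P_n, P_(n-1), P_(n-2) in \<open>comm\<close> are
    \<open>y2 n\<close>, \<open>y1 (n - 1)\<close>, \<open>y0 (n - 2)\<close>; those of P_(n+1)
    cancel. For n < 2 fewer terms occur, hence the separate cases \<open>zero\<close> and
    \<open>one\<close>.\<close>
  define y2 where "y2 n = g (Suc n) - (g n + 4 * \<beta> * (B n - 4 * \<beta> * of_nat n - \<beta>) + \<omega> - 16 * \<beta>\<^sup>2 * (of_nat n)\<^sup>2)" for n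
  define y1 where "y1 n = g (Suc n) * (B (Suc n) - B n) - 8 * \<beta> * (C (Suc n) - of_nat (Suc n) * g (Suc n))" for n
  define y0 where "y0 n = C (Suc (Suc n)) * g (Suc n) - g (Suc (Suc n)) * C (Suc n) + g (Suc (Suc n)) * g (Suc n)" for n
  have zero: "y2 0 = 0"
  proof -
    have "A 0 = 0" "A (Suc 0) = smult (4 * \<beta>) (P (Suc 0)) + [:g 1:]"
      by (simp_all add: A_def g_def shift_seq_def)
    then have "smult (4 * \<beta>) [:- B 0, 1:] + [:g 1:] = smult (4 * \<beta>) [:0, 1:] + [:\<omega> - 4 * \<beta>\<^sup>2:]"
      using comm[of 0] by (simp add: g_def P_1)
    then show ?thesis by (simp add: y2_def g_def[of 0] power2_eq_square algebra_simps)
  qed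
  have one: "y2 1 = 0" "y1 0 = 0"
  proof -
    have A: "A 0 = 0" "A (Suc 0) = smult (4 * \<beta>) (P (Suc 0)) + [:g 1:]"
      "A (Suc (Suc 0)) = smult (8 * \<beta>) (P (Suc (Suc 0))) + smult (g 2) (P (Suc 0))"
      by (simp_all add: A_def g_def shift_seq_def numeral_2_eq_2)
    have z: "[:0, 1:] * P (Suc 0) = P (Suc (Suc 0)) + smult (B 1) (P (Suc 0)) + [:C 1:]"
      using zP[of "Suc 0"] by (simp add: shift_seq_def)
    have "smult (y2 1) (P (Suc 0)) + [:y1 0:] = 0"
    proof (rule poly_ext)
      fix t
      have 1: "t * poly (P (Suc 0)) t = poly (P (Suc (Suc 0))) t + B 1 * poly (P (Suc 0)) t + C 1"
        using arg_cong[OF z, of "\<lambda>p. poly p t"] by simp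
      have 2: "poly (P (Suc 0)) t = t - B 0" by (simp add: P_1)
      show "poly (smult (y2 1) (P (Suc 0)) + [:y1 0:]) t = poly 0 t"
        using arg_cong[OF comm[of "Suc 0", unfolded nat.case A], of "\<lambda>p. poly p t"] 1 2
        unfolding y1_def y2_def power2_eq_square unfolding numeral_2_eq_2 One_nat_def of_nat_Suc of_nat_0
          poly_add poly_diff poly_smult poly_mult poly_pCons poly_0 by algebra
    qed
    then show "y2 1 = 0" "y1 0 = 0"
      by (simp_all add: P_1)
  qed
  have step: "y2 (Suc (Suc i)) = 0" "y1 (Suc i) = 0" "y0 i = 0" for i
  proof -
    have A: "A (Suc n) = smult (4 * \<beta> * of_nat (Suc n)) (P (Suc n)) + smult (g (Suc n)) (P n)" for n
      by (simp add: A_def shift_seq_def)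
    have zA: "[:0, 1:] * A (Suc (Suc i)) = smult (4 * \<beta> * of_nat (Suc (Suc i))) (P (Suc (Suc (Suc i)))
        + smult (B (Suc (Suc i))) (P (Suc (Suc i))) + smult (C (Suc (Suc i))) (P (Suc i)))
        + smult (g (Suc (Suc i))) (P (Suc (Suc i)) + smult (B (Suc i)) (P (Suc i)) + smult (C (Suc i)) (P i))"
      by (simp only: A distrib_left mult_smult_right var_mult_P)
    note rel = comm[of "Suc (Suc i)", unfolded nat.case zA var_mult_P, unfolded A]
    have "smult (y2 (Suc (Suc i))) (P (Suc (Suc i))) + smult (y1 (Suc i)) (P (Suc i)) + smult (y0 i) (P i) = 0"
    proof (rule poly_ext)
      fix t
      show "poly (smult (y2 (Suc (Suc i))) (P (Suc (Suc i))) + smult (y1 (Suc i)) (P (Suc i)) + smult (y0 i) (P i)) t = poly 0 t"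
        using arg_cong[OF rel, of "\<lambda>p. poly p t"]
        unfolding y0_def y1_def y2_def poly_add poly_diff poly_smult poly_0 of_nat_Suc power2_eq_square
        by (simp add: algebra_simps)
    qed
    then show "y2 (Suc (Suc i)) = 0" "y1 (Suc i) = 0" "y0 i = 0" by (rule indep)+
  qed
  have g_Suc: "g (Suc n) = g n + 4 * \<beta> * (B n - 4 * \<beta> * of_nat n - \<beta>) + \<omega> - 16 * \<beta>\<^sup>2 * (of_nat n)\<^sup>2" for n
  proof -
    have "y2 n = 0"
    proof (cases n)
      case 0
      then show ?thesis using zero by simp
    next
      case (Suc m)
      then show ?thesis using one step(1) by (cases m) simp_all
    qed
    then show ?thesis by (simp add: y2_def)
  qed
  have B_Suc: "g (Suc n) * (B (Suc n) - B n) = 8 * \<beta> * (C (Suc n) - of_nat (Suc n) * g (Suc n))" for n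
    using one(2) step(2) by (cases n) (simp_all add: y1_def)
  have C_Suc: "C (Suc (Suc n)) * g (Suc n) - g (Suc (Suc n)) * C (Suc n) = - g (Suc (Suc n)) * g (Suc n)" for n
    using step(3)[of n] by (simp add: y0_def eq_neg_iff_add_eq_0)
  \<comment> \<open>Divided by the two values of \<open>g\<close>, \<open>C_Suc\<close> says that
    C_n / g_n drops by 1 at each step; \<nu> is its extrapolation to n = 0.\<close>
  define \<nu> where "\<nu> = C 1 / g 1 + 1"
  have C: "C (Suc n) = g (Suc n) * (\<nu> - of_nat (Suc n))" for n
  proof (induction n)
    case 0
    then show ?case using g0[of 1] by (simp add: \<nu>_def)
  next
    case (Suc n)
    have "g (Suc n) * C (Suc (Suc n)) = g (Suc n) * (g (Suc (Suc n)) * (\<nu> - of_nat (Suc (Suc n))))"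
      using C_Suc[of n] unfolding Suc by (simp add: algebra_simps)
    then show ?case using g0[of "Suc n"] by simp
  qed
  have B': "B (Suc n) = B n + 8 * \<beta> * (\<nu> - 2 * of_nat (Suc n))" for n
  proof -
    have "g (Suc n) * B (Suc n) = g (Suc n) * (B n + 8 * \<beta> * (\<nu> - 2 * of_nat (Suc n)))"
      using B_Suc[of n] unfolding C by (simp add: algebra_simps)
    then show ?thesis using g0[of "Suc n"] by simp
  qed
  have B: "B n = BB \<nu> (B 0) n" for n
    by (induction n) (simp_all add: BB_def B' algebra_simps)
  have "g n = \<gamma> \<nu> (B 0) n" for n
  proof (induction n)
    case 0
    show ?case by (simp add: g_def \<gamma>_def)
  next
    case (Suc n)
    have Bn: "B n = B 0 + 8 * \<beta> * of_nat n * (\<nu> - of_nat n - 1)"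
      using B[of n] by (simp only: BB_def)
    show ?case unfolding g_Suc Suc.IH Bn by (simp add: \<gamma>_def power2_eq_square algebra_simps)
  qed
  then have "C (Suc n) = \<gamma> \<nu> (B 0) (Suc n) * (\<nu> - of_nat (Suc n))" for n
    by (simp only: C)
  with B show ?thesis by (rule that)
qed

end

section \<open>Continuous dual Hahn polynomials\<close>

lemma add_of_nat_eq_0_imp_nonpos_Int:
  assumes "X + of_nat j = (0 :: complex)" shows "X \<in> \<int>\<^sub>\<le>\<^sub>0"
proof -
  have "X = of_int (- int j)" using assms by (simp add: add_eq_0_iff)
  then show ?thesis unfolding nonpos_Ints_def by (intro CollectI exI[of _ "- int j"]) simp
qed

text \<open>The series with a1 = 1/2; \<open>X\<close> and \<open>Y\<close> are the denominator
  parameters a1 + a2 and a1 + a3.\<close>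

definition hahn_coeff :: "complex \<Rightarrow> complex \<Rightarrow> nat \<Rightarrow> nat \<Rightarrow> complex" where
  "hahn_coeff X Y n k = pochhammer (- of_nat n) k / (pochhammer X k * pochhammer Y k * fact k)"

definition hahn_basis :: "complex \<Rightarrow> nat \<Rightarrow> complex" where
  "hahn_basis y k = pochhammer (1/2 + \<i> * y) k * pochhammer (1/2 - \<i> * y) k"

lemma hahn_coeff_zero: "k > n \<Longrightarrow> hahn_coeff X Y n k = 0"
  using pochhammer_of_nat_eq_0_lemma[of n k, where 'a = complex] by (simp add: hahn_coeff_def)

text \<open>The free upper bound \<open>N\<close> allows the functions of three consecutive indices
  to be summed over one range.\<close>

lemma cont_dual_hahn_fun_sum:
  assumes "n \<le> N"
  shows "cont_dual_hahn_fun (1/2) (X - 1/2) (Y - 1/2) n y = (\<Sum>k\<le>N. hahn_coeff X Y n k * hahn_basis y k)"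
proof -
  have "cont_dual_hahn_fun (1/2) (X - 1/2) (Y - 1/2) n y = (\<Sum>k. hahn_coeff X Y n k * hahn_basis y k)"
    by (simp add: cont_dual_hahn_fun_def eval_fps_def hahn_coeff_def hahn_basis_def mult_ac)
  also have "\<dots> = (\<Sum>k\<le>N. hahn_coeff X Y n k * hahn_basis y k)"
    by (rule suminf_finite) (use assms hahn_coeff_zero in auto)
  finally show ?thesis .
qed

lemma hahn_basis_Suc: "(1/4 + y\<^sup>2) * hahn_basis y k = hahn_basis y (Suc k) - of_nat k * (of_nat k + 1) * hahn_basis y k"
proof -
  have "(1/2 + \<i> * y + of_nat k) * (1/2 - \<i> * y + of_nat k) = 1/4 + y\<^sup>2 + of_nat k * (of_nat k + 1)"
    by (simp add: algebra_simps power2_eq_square)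
  then have "hahn_basis y (Suc k) = hahn_basis y k * (1/4 + y\<^sup>2 + of_nat k * (of_nat k + 1))"
    unfolding hahn_basis_def pochhammer_Suc by algebra
  then show ?thesis by (simp add: algebra_simps)
qed

text \<open>All terms are multiples of (-n)_j divided by (X)_k (Y)_k k!, with k = j + 1, which
  leaves a polynomial identity in n and j.\<close>

lemma hahn_coeff_recurrence:
  assumes "X \<notin> \<int>\<^sub>\<le>\<^sub>0" "Y \<notin> \<int>\<^sub>\<le>\<^sub>0"
    and A: "A = (of_nat n + X) * (of_nat n + Y)" and C: "C = of_nat n * (of_nat n + X + Y - 2)"
  shows "A * hahn_coeff X Y (Suc n) k - (A + C) * hahn_coeff X Y n k + C * hahn_coeff X Y (n - 1) k
    - of_nat k * (of_nat k + 1) * hahn_coeff X Y n k + (case k of 0 \<Rightarrow> 0 | Suc j \<Rightarrow> hahn_coeff X Y n j) = 0"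
proof (cases k)
  case 0
  then show ?thesis by (simp add: hahn_coeff_def)
next
  case (Suc j)
  define E where "E = pochhammer (- of_nat n :: complex) j"
  define T where "T = 1 / (pochhammer X k * pochhammer Y k * fact k)"
  have nz: "X + of_nat j \<noteq> 0" "Y + of_nat j \<noteq> 0"
    using assms(1,2) add_of_nat_eq_0_imp_nonpos_Int by blast+
  have "pochhammer (- of_nat (Suc n) :: complex) k = - of_nat (Suc n) * pochhammer (- of_nat (Suc n) + 1) j"
    unfolding Suc by (rule pochhammer_rec)
  also have "- of_nat (Suc n) + 1 = (- of_nat n :: complex)" by simp
  finally have 1: "hahn_coeff X Y (Suc n) k = - (of_nat n + 1) * E * T"
    by (simp add: hahn_coeff_def T_def E_def)
  have 2: "hahn_coeff X Y n k = E * (of_nat j - of_nat n) * T"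
    by (simp add: hahn_coeff_def T_def E_def Suc pochhammer_Suc[of "- of_nat n"])
  \<comment> \<open>The factor n, supplied by \<open>C\<close>, keeps the formula valid for
    \<open>n = 0\<close>, where \<open>n - 1\<close> is 0.\<close>
  have 3: "of_nat n * hahn_coeff X Y (n - 1) k = - E * (of_nat j - of_nat n) * (of_nat j + 1 - of_nat n) * T"
  proof (cases n)
    case 0
    then show ?thesis by (cases j) (simp_all add: E_def pochhammer_rec[of 0])
  next
    case (Suc i)
    have "of_nat n * pochhammer (- of_nat i :: complex) k = - pochhammer (- of_nat n) (Suc k)"
      unfolding pochhammer_rec[of "- of_nat n"] by (simp add: Suc algebra_simps)
    also have "\<dots> = - E * (of_nat j - of_nat n) * (of_nat j + 1 - of_nat n)"
      by (simp add: pochhammer_Suc E_def \<open>k = Suc j\<close> algebra_simps)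
    finally show ?thesis by (simp add: hahn_coeff_def T_def Suc)
  qed
  have 4: "hahn_coeff X Y n j = E * ((X + of_nat j) * (Y + of_nat j) * (of_nat j + 1)) * T"
  proof -
    have "(X + of_nat j) * (Y + of_nat j) * (of_nat j + 1) * T = 1 / (pochhammer X j * pochhammer Y j * fact j)"
      using nz of_nat_neq_0[of j, where 'a = complex]
      unfolding T_def Suc pochhammer_Suc fact_Suc of_nat_Suc by (simp add: add.commute)
    then show ?thesis unfolding hahn_coeff_def E_def by (simp add: mult.assoc)
  qed
  have "C * hahn_coeff X Y (n - 1) k = (of_nat n + X + Y - 2) * (of_nat n * hahn_coeff X Y (n - 1) k)"
    by (simp add: C)
  then show ?thesis
    unfolding 1 2 3 unfolding Suc nat.case 4 A C of_nat_Suc by algebra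
qed

text \<open>The classical three-term recurrence. In \<open>hahn_basis\<close> multiplication by 1/4
  + y^2 is bidiagonal, so the recurrence follows coefficient by coefficient.\<close>

lemma cont_dual_hahn_fun_recurrence:
  assumes "X \<notin> \<int>\<^sub>\<le>\<^sub>0" "Y \<notin> \<int>\<^sub>\<le>\<^sub>0"
    and F: "F = (\<lambda>n. cont_dual_hahn_fun (1/2) (X - 1/2) (Y - 1/2) n y)"
    and A: "A = (of_nat n + X) * (of_nat n + Y)" and C: "C = of_nat n * (of_nat n + X + Y - 2)"
  shows "A * F (Suc n) = (A + C - 1/4 - y\<^sup>2) * F n - C * F (n - 1)"
proof -
  let ?c = "hahn_coeff X Y" and ?b = "hahn_basis y"
  have F': "F m = (\<Sum>k\<le>Suc n. ?c m k * ?b k)" if "m \<le> Suc n" for m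
    unfolding F by (rule cont_dual_hahn_fun_sum[OF that])
  have "(1/4 + y\<^sup>2) * F n = (\<Sum>k\<le>Suc n. ?c n k * ?b (Suc k)) - (\<Sum>k\<le>Suc n. of_nat k * (of_nat k + 1) * ?c n k * ?b k)"
    unfolding F'[OF le_SucI[OF order.refl]] sum_distrib_left sum_subtractf[symmetric]
  proof (rule sum.cong[OF refl])
    fix k
    have "(1/4 + y\<^sup>2) * (?c n k * ?b k) = ?c n k * ((1/4 + y\<^sup>2) * ?b k)" by simp
    then show "(1/4 + y\<^sup>2) * (?c n k * ?b k) = ?c n k * ?b (Suc k) - of_nat k * (of_nat k + 1) * ?c n k * ?b k"
      unfolding hahn_basis_Suc by (simp add: algebra_simps)
  qed
  also have "(\<Sum>k\<le>Suc n. ?c n k * ?b (Suc k)) = (\<Sum>k\<le>Suc n. (case k of 0 \<Rightarrow> 0 | Suc j \<Rightarrow> ?c n j) * ?b k)"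
    unfolding sum.atMost_Suc_shift[of "\<lambda>k. (case k of 0 \<Rightarrow> 0 | Suc j \<Rightarrow> ?c n j) * ?b k"]
    by (simp add: hahn_coeff_zero)
  finally have 3: "(1/4 + y\<^sup>2) * F n = (\<Sum>k\<le>Suc n. (case k of 0 \<Rightarrow> 0 | Suc j \<Rightarrow> ?c n j) * ?b k)
      - (\<Sum>k\<le>Suc n. of_nat k * (of_nat k + 1) * ?c n k * ?b k)" .
  have 1: "F (Suc n) = (\<Sum>k\<le>Suc n. ?c (Suc n) k * ?b k)" "F n = (\<Sum>k\<le>Suc n. ?c n k * ?b k)"
    "F (n - 1) = (\<Sum>k\<le>Suc n. ?c (n - 1) k * ?b k)"
    by (rule F'; simp)+
  have 2: "(A * p - G * q + C * r - t + o') * b = A * (p * b) - G * (q * b) + C * (r * b) - t * b + o' * b"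
    for p q r t o' b G :: complex by (simp add: algebra_simps)
  have "(\<Sum>k\<le>Suc n. (A * ?c (Suc n) k - (A + C) * ?c n k + C * ?c (n - 1) k
      - of_nat k * (of_nat k + 1) * ?c n k + (case k of 0 \<Rightarrow> 0 | Suc j \<Rightarrow> ?c n j)) * ?b k)
    = A * F (Suc n) - (A + C) * F n + C * F (n - 1) + (1/4 + y\<^sup>2) * F n"
    unfolding 2 sum.distrib sum_subtractf sum_distrib_left[symmetric] 1[symmetric] 3 by simp
  moreover have "(\<Sum>k\<le>Suc n. (A * ?c (Suc n) k - (A + C) * ?c n k + C * ?c (n - 1) k
      - of_nat k * (of_nat k + 1) * ?c n k + (case k of 0 \<Rightarrow> 0 | Suc j \<Rightarrow> ?c n j)) * ?b k) = 0"
    by (intro sum.neutral ballI) (simp only: hahn_coeff_recurrence[OF assms(1,2) A C] mult_zero_left)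
  ultimately show ?thesis by (simp add: algebra_simps)
qed

section \<open>Monic sequences given by recurrence coefficients, and their limits\<close>

fun rec_seq :: "(nat \<Rightarrow> complex) \<Rightarrow> (nat \<Rightarrow> complex) \<Rightarrow> nat \<Rightarrow> complex poly" where
  "rec_seq B C 0 = 1"
| "rec_seq B C (Suc 0) = [:- B 0, 1:]"
| "rec_seq B C (Suc (Suc n)) = [:- B (Suc n), 1:] * rec_seq B C (Suc n) - smult (C (Suc n)) (rec_seq B C n)"

lemma rec_seq_unique: "recurrence_coeffs P B C \<Longrightarrow> P n = rec_seq B C n"
  by (induction B C n rule: rec_seq.induct) (simp_all add: recurrence_coeffs_def shift_seq_def)

lemma degree_rec_seq: "degree (rec_seq B C n) = n"
proof (induction B C n rule: rec_seq.induct)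
  case (3 B C n)
  have nz: "rec_seq B C (Suc n) \<noteq> 0" using 3(1) by auto
  have "degree ([:- B (Suc n), 1:] * rec_seq B C (Suc n)) = Suc (Suc n)"
    using nz 3(1) by (subst degree_mult_eq) simp_all
  moreover have "degree (smult (C (Suc n)) (rec_seq B C n)) < Suc (Suc n)"
    using 3(2) by (intro le_less_trans[OF degree_smult_le]) simp
  ultimately show ?case
    unfolding rec_seq.simps diff_conv_add_uminus by (subst degree_add_eq_left) simp_all
qed simp_all

lemma rec_seq_tendsto:
  assumes "\<And>n. (\<lambda>m. B' m n) \<longlonglongrightarrow> B n" "\<And>n. (\<lambda>m. C' m n) \<longlonglongrightarrow> C n"
  shows "(\<lambda>m. coeff (rec_seq (B' m) (C' m) n) k) \<longlonglongrightarrow> coeff (rec_seq B C n) k"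
proof -
  have lin: "(\<lambda>m. coeff ([:- b' m, 1:] * p' m) k) \<longlonglongrightarrow> coeff ([:- b, 1:] * p) k"
    if "b' \<longlonglongrightarrow> b" "\<And>k. (\<lambda>m. coeff (p' m) k) \<longlonglongrightarrow> coeff p k" for b' b p' k and p :: "complex poly"
    using that by (cases k) (auto intro!: tendsto_intros)
  have "(\<forall>k. (\<lambda>m. coeff (rec_seq (B' m) (C' m) n) k) \<longlonglongrightarrow> coeff (rec_seq B C n) k) \<and>
    (\<forall>k. (\<lambda>m. coeff (rec_seq (B' m) (C' m) (Suc n)) k) \<longlonglongrightarrow> coeff (rec_seq B C (Suc n)) k)"
  proof (induction n)
    case 0
    show ?case
      using lin[OF assms(1)[of 0], of "\<lambda>_. 1" 1] by simp
  next
    case (Suc n)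
    then show ?case
      unfolding rec_seq.simps coeff_diff coeff_smult by (intro conjI allI tendsto_intros lin assms) auto
  qed
  then show ?thesis by blast
qed

context quadratic_lattice
begin

abbreviation hahn_seq :: "complex \<Rightarrow> complex \<Rightarrow> nat \<Rightarrow> complex poly" where
  "hahn_seq \<nu> B0 \<equiv> rec_seq (BB \<nu> B0) (\<lambda>n. \<gamma> \<nu> B0 n * (\<nu> - of_nat n))"

text \<open>Up to scaling, the recurrence of \<open>hahn_seq\<close> is that of continuous dual Hahn
  polynomials with a1 = 1/2. Nonvanishing of \<gamma> is what keeps the denominator parameters away
  from the nonpositive integers.\<close>

lemma hahn_seq_in_cont_dual_hahn_seqs:
  assumes \<beta>: "\<beta> \<noteq> 0" and nz: "\<And>n. \<gamma> \<nu> B0 (Suc n) \<noteq> 0"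
  shows "hahn_seq \<nu> B0 \<in> cont_dual_hahn_seqs"
proof -
  define q where "q = - (4 * \<beta> * B0 + \<omega> - 4 * \<beta>\<^sup>2) / (16 * \<beta>\<^sup>2)"
  have q: "4 * \<beta> * B0 + \<omega> - 4 * \<beta>\<^sup>2 = - 16 * \<beta>\<^sup>2 * q"
    using \<beta> by (simp add: q_def)
  \<comment> \<open>\<open>X\<close> and \<open>Y\<close> are the numbers with sum 2 - \<nu> and
    product \<open>q\<close>, so that \<gamma> factorises.\<close>
  define X where "X = (2 - \<nu> + csqrt ((2 - \<nu>)\<^sup>2 - 4 * q)) / 2"
  define Y where "Y = 2 - \<nu> - X"
  have XY: "X * Y = q"
  proof -
    have "4 * (X * Y) = (2 - \<nu>)\<^sup>2 - (csqrt ((2 - \<nu>)\<^sup>2 - 4 * q))\<^sup>2"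
      by (simp add: X_def Y_def field_simps power2_eq_square del: power2_csqrt)
    then show ?thesis by simp
  qed
  have \<gamma>_eq: "\<gamma> \<nu> B0 n = - 16 * \<beta>\<^sup>2 * of_nat n * (of_nat n - 1 + X) * (of_nat n - 1 + Y)" for n
  proof -
    have \<nu>: "\<nu> = 2 - X - Y" by (simp add: Y_def)
    show ?thesis
      using \<nu> unfolding \<gamma>_def q XY[symmetric] by algebra
  qed
  have X: "X \<notin> \<int>\<^sub>\<le>\<^sub>0" and Y: "Y \<notin> \<int>\<^sub>\<le>\<^sub>0"
  proof -
    show "X \<notin> \<int>\<^sub>\<le>\<^sub>0"
    proof
      assume "X \<in> \<int>\<^sub>\<le>\<^sub>0"
      then obtain j where "X = - of_nat j" by (elim nonpos_Ints_cases')
      then show False using nz[of j] by (simp add: \<gamma>_eq)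
    qed
    show "Y \<notin> \<int>\<^sub>\<le>\<^sub>0"
    proof
      assume "Y \<in> \<int>\<^sub>\<le>\<^sub>0"
      then obtain j where "Y = - of_nat j" by (elim nonpos_Ints_cases')
      then show False using nz[of j] by (simp add: \<gamma>_eq)
    qed
  qed
  define F where "F y n = cont_dual_hahn_fun (1/2) (X - 1/2) (Y - 1/2) n y" for y n
  \<comment> \<open>The normalisation to monic polynomials: 4\<beta> times the factor of
    \<open>F y (Suc n)\<close> in the recurrence, multiplied up.\<close>
  define \<kappa> where "\<kappa> n = (\<Prod>j<n. 4 * \<beta> * (of_nat j + X) * (of_nat j + Y))" for n
  have \<kappa>_Suc: "\<kappa> (Suc n) = 4 * \<beta> * (of_nat n + X) * (of_nat n + Y) * \<kappa> n" for n
    by (simp add: \<kappa>_def)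
  have \<kappa>_nz: "\<kappa> n \<noteq> 0" for n
    using nz \<beta> unfolding \<kappa>_def by (auto simp: \<gamma>_eq)
  have F0: "F y 0 = 1" for y
    unfolding F_def cont_dual_hahn_fun_sum[OF order.refl] by (simp add: hahn_coeff_def hahn_basis_def)
  have F_rec: "(of_nat n + X) * (of_nat n + Y) * F y (Suc n) =
      ((of_nat n + X) * (of_nat n + Y) + of_nat n * (of_nat n - \<nu>) - 1/4 - y\<^sup>2) * F y n - of_nat n * (of_nat n - \<nu>) * F y (n - 1)" for n y
    using cont_dual_hahn_fun_recurrence[OF X Y refl refl refl, of n y]
    by (simp add: F_def Y_def)
  \<comment> \<open>The affine variable is chosen so that w^2 = 4\<beta>z + \<omega> becomes -16
    \<beta>^2 y^2.\<close>
  have z: "- 4 * \<beta> * y\<^sup>2 - \<omega> / (4 * \<beta>) - BB \<nu> B0 n =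
      4 * \<beta> * ((of_nat n + X) * (of_nat n + Y) + of_nat n * (of_nat n - \<nu>) - 1/4 - y\<^sup>2)" for y n
  proof -
    define t where "t = \<omega> / (4 * \<beta>)"
    have "4 * \<beta> * t = \<omega>" using \<beta> by (simp add: t_def)
    then have "4 * \<beta> * B0 + 4 * \<beta> * t - 4 * \<beta>\<^sup>2 = - 16 * \<beta>\<^sup>2 * q" using q by simp
    then have "4 * \<beta> * (t + B0 - \<beta>) = 4 * \<beta> * (- 4 * \<beta> * q)" by algebra
    then have "t + B0 - \<beta> = - 4 * \<beta> * q" using \<beta> by (metis mult_cancel_left mult_eq_0_iff zero_neq_numeral)
    moreover have "\<nu> = 2 - X - Y" by (simp add: Y_def)
    ultimately show ?thesis
      using XY unfolding BB_def t_def[symmetric] by algebra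
  qed
  have main: "poly (hahn_seq \<nu> B0 n) (- 4 * \<beta> * y\<^sup>2 - \<omega> / (4 * \<beta>)) = \<kappa> n * F y n \<and>
      poly (hahn_seq \<nu> B0 (Suc n)) (- 4 * \<beta> * y\<^sup>2 - \<omega> / (4 * \<beta>)) = \<kappa> (Suc n) * F y (Suc n)" for n y
  proof (induction n)
    case 0
    show ?case
      using z[of y 0] F_rec[of 0 y] by (simp add: F0 \<kappa>_def mult.assoc)
  next
    case (Suc n)
    let ?z = "- 4 * \<beta> * y\<^sup>2 - \<omega> / (4 * \<beta>)"
    have "poly (hahn_seq \<nu> B0 (Suc (Suc n))) ?z = (?z - BB \<nu> B0 (Suc n)) * (\<kappa> (Suc n) * F y (Suc n))
        - \<gamma> \<nu> B0 (Suc n) * (\<nu> - of_nat (Suc n)) * (\<kappa> n * F y n)"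
      using Suc by (simp add: left_diff_distrib)
    also have "\<gamma> \<nu> B0 (Suc n) * (\<nu> - of_nat (Suc n)) * (\<kappa> n * F y n) =
        4 * \<beta> * \<kappa> (Suc n) * (of_nat (Suc n) * (of_nat (Suc n) - \<nu>) * F y n)"
      unfolding \<gamma>_eq \<kappa>_Suc by (simp add: algebra_simps power2_eq_square)
    also have "(?z - BB \<nu> B0 (Suc n)) * (\<kappa> (Suc n) * F y (Suc n)) - \<dots> = 4 * \<beta> * \<kappa> (Suc n) *
       (((of_nat (Suc n) + X) * (of_nat (Suc n) + Y) + of_nat (Suc n) * (of_nat (Suc n) - \<nu>) - 1/4 - y\<^sup>2) * F y (Suc n)
         - of_nat (Suc n) * (of_nat (Suc n) - \<nu>) * F y (Suc n - 1))"
      unfolding z diff_Suc_1 by algebra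
    also have "\<dots> = \<kappa> (Suc (Suc n)) * F y (Suc (Suc n))"
      unfolding F_rec[symmetric] \<kappa>_Suc[of "Suc n"] by (simp only: mult_ac)
    finally show ?case using Suc by blast
  qed
  have "(\<forall>n. degree (hahn_seq \<nu> B0 n) = n) \<and> - 4 * \<beta> \<noteq> 0 \<and>
      1/2 + (X - 1/2) \<notin> \<int>\<^sub>\<le>\<^sub>0 \<and> 1/2 + (Y - 1/2) \<notin> \<int>\<^sub>\<le>\<^sub>0 \<and>
      (\<forall>n. \<exists>\<kappa>. \<kappa> \<noteq> 0 \<and> (\<forall>y. poly (hahn_seq \<nu> B0 n) (- 4 * \<beta> * y\<^sup>2 + - \<omega> / (4 * \<beta>))
        = \<kappa> * cont_dual_hahn_fun (1/2) (X - 1/2) (Y - 1/2) n y))"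
  proof (intro conjI allI)
    fix n
    have "poly (hahn_seq \<nu> B0 n) (- 4 * \<beta> * y\<^sup>2 + - \<omega> / (4 * \<beta>))
        = \<kappa> n * cont_dual_hahn_fun (1/2) (X - 1/2) (Y - 1/2) n y" for y
      using main[of n y] by (simp add: F_def)
    then show "\<exists>\<kappa>. \<kappa> \<noteq> 0 \<and> (\<forall>y. poly (hahn_seq \<nu> B0 n) (- 4 * \<beta> * y\<^sup>2 + - \<omega> / (4 * \<beta>))
        = \<kappa> * cont_dual_hahn_fun (1/2) (X - 1/2) (Y - 1/2) n y)"
      using \<kappa>_nz[of n] by blast
  qed (use X Y \<beta> degree_rec_seq in simp_all)
  then show ?thesis
    unfolding cont_dual_hahn_seqs_def by blast
qed

text \<open>For each n the excluded values are roots of a quadratic with nonzero constant term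
  \<omega>; countably many finite sets cannot cover an interval.\<close>

lemma exists_small_parameter:
  assumes "\<epsilon> > 0" and "\<omega> \<noteq> 0"
  obtains r :: real where "0 < r" "r < \<epsilon>"
    "\<And>n. of_nat (Suc n) * (4 * of_real r * B0 + \<omega> - 4 * (of_real r)\<^sup>2 - 16 * (of_real r)\<^sup>2 * (of_nat (Suc n) - 1) * (of_nat (Suc n) + 1 - \<nu>)) \<noteq> 0"
proof -
  define p where "p n = [:\<omega>, 4 * B0, - 4 - 16 * of_nat n * (of_nat n + 2 - \<nu>):]" for n :: nat
  have "countable {z. poly (p n) z = 0}" for n
    using poly_roots_finite[of "p n"] assms(2) by (intro countable_finite) (simp add: p_def)
  then have "countable (\<Union>n. {z. poly (p n) z = 0})" by blast
  then have "countable {r. complex_of_real r \<in> (\<Union>n. {z. poly (p n) z = 0})}"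
    by (rule countable_image_inj) (rule inj_of_real)
  then have "\<not> {0<..<\<epsilon>} \<subseteq> {r. complex_of_real r \<in> (\<Union>n. {z. poly (p n) z = 0})}"
    using uncountable_open_interval[of 0 \<epsilon>] assms(1) countable_subset by auto
  then obtain r where "r \<in> {0<..<\<epsilon>}" "r \<notin> {r. complex_of_real r \<in> (\<Union>n. {z. poly (p n) z = 0})}"
    by blast
  then have r: "0 < r" "r < \<epsilon>" "\<And>n. poly (p n) (of_real r) \<noteq> 0" by auto
  show ?thesis
  proof (rule that[OF r(1,2)])
    fix n
    show "of_nat (Suc n) * (4 * of_real r * B0 + \<omega> - 4 * (of_real r)\<^sup>2 - 16 * (of_real r)\<^sup>2 * (of_nat (Suc n) - 1) * (of_nat (Suc n) + 1 - \<nu>)) \<noteq> 0"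
    proof -
      have "4 * of_real r * B0 + \<omega> - 4 * (of_real r)\<^sup>2 - 16 * (of_real r)\<^sup>2 * (of_nat (Suc n) - 1) * (of_nat (Suc n) + 1 - \<nu>)
        = poly (p n) (of_real r)"
        by (simp add: p_def algebra_simps power2_eq_square)
      then show ?thesis using r(3)[of n] of_nat_neq_0[of n, where 'a = complex] by simp
    qed
  qed
qed

text \<open>Replace \<beta> = 0 by small positive \<open>r m\<close>, with \<open>c5\<close>, \<nu>
  and \<open>B0\<close> fixed. Each such sequence is of continuous dual Hahn type, and the
  recurrence coefficients converge, hence also the polynomials.\<close>

lemma hahn_seq_limiting_case:
  assumes \<beta>: "\<beta> = 0"
  shows "limiting_case (wilson_seqs \<union> cont_dual_hahn_seqs) (hahn_seq \<nu> B0)"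
proof -
  have \<omega>: "\<omega> \<noteq> 0" using \<omega>_nonzero \<beta> by blast
  have "\<exists>r::real. 0 < r \<and> r < inverse (of_nat (Suc m)) \<and> (\<forall>n. of_nat (Suc n) * (4 * of_real r * B0 + \<omega> - 4 * (of_real r)\<^sup>2 - 16 * (of_real r)\<^sup>2 * (of_nat (Suc n) - 1) * (of_nat (Suc n) + 1 - \<nu>)) \<noteq> 0)" for m
    by (rule exists_small_parameter[OF _ \<omega>, of "inverse (of_nat (Suc m))" B0 \<nu>]) auto
  then obtain r :: "nat \<Rightarrow> real" where r: "\<And>m. 0 < r m" "\<And>m. r m < inverse (of_nat (Suc m))"
    "\<And>m n. of_nat (Suc n) * (4 * of_real (r m) * B0 + \<omega> - 4 * (of_real (r m))\<^sup>2 - 16 * (of_real (r m))\<^sup>2 * (of_nat (Suc n) - 1) * (of_nat (Suc n) + 1 - \<nu>)) \<noteq> 0"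
    by metis
  have "r \<longlonglongrightarrow> 0"
    by (rule tendsto_sandwich[OF _ _ tendsto_const LIMSEQ_inverse_real_of_nat])
      (use r in \<open>auto intro!: always_eventually less_imp_le\<close>)
  then have r0: "(\<lambda>m. complex_of_real (r m)) \<longlonglongrightarrow> 0"
    using tendsto_of_real[of r 0 sequentially] by simp
  define B' where "B' m n = B0 + 8 * of_real (r m) * of_nat n * (\<nu> - of_nat n - 1)" for m n
  define g where "g m n = of_nat n * (4 * of_real (r m) * B0 + \<omega> - 4 * (of_real (r m))\<^sup>2 - 16 * (of_real (r m))\<^sup>2 * (of_nat n - 1) * (of_nat n + 1 - \<nu>))" for m n
  have "rec_seq (B' m) (\<lambda>n. g m n * (\<nu> - of_nat n)) \<in> cont_dual_hahn_seqs" for m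
  proof -
    interpret Q: quadratic_lattice "of_real (r m)" c5
      by unfold_locales (use r(1)[of m] in auto)
    have "rec_seq (Q.BB \<nu> B0) (\<lambda>n. Q.\<gamma> \<nu> B0 n * (\<nu> - of_nat n)) \<in> cont_dual_hahn_seqs"
      using r(1)[of m] r(3)[of _ m] by (intro Q.hahn_seq_in_cont_dual_hahn_seqs) (simp_all only: Q.\<gamma>_def, auto)
    moreover have "Q.BB \<nu> B0 = B' m" "Q.\<gamma> \<nu> B0 = g m"
      by (simp_all add: fun_eq_iff Q.BB_def Q.\<gamma>_def B'_def g_def)
    ultimately show ?thesis by simp
  qed
  moreover have "(\<lambda>m. coeff (rec_seq (B' m) (\<lambda>n. g m n * (\<nu> - of_nat n)) n) k) \<longlonglongrightarrow> coeff (hahn_seq \<nu> B0 n) k" for n k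
  proof (rule rec_seq_tendsto)
    fix n
    show "(\<lambda>m. B' m n) \<longlonglongrightarrow> BB \<nu> B0 n"
      unfolding B'_def BB_def unfolding \<beta> by (intro tendsto_intros r0)
    show "(\<lambda>m. g m n * (\<nu> - of_nat n)) \<longlonglongrightarrow> \<gamma> \<nu> B0 n * (\<nu> - of_nat n)"
      unfolding g_def \<gamma>_def unfolding \<beta> by (intro tendsto_intros r0)
  qed
  ultimately show ?thesis
    unfolding limiting_case_def by (intro exI[of _ "\<lambda>m. rec_seq (B' m) (\<lambda>n. g m n * (\<nu> - of_nat n))"]) auto
qed

end

theorem theorem3p3:
  fixes \<beta> c5 a b c :: complex
    and u :: "complex poly \<Rightarrow> complex"
    and P :: "nat \<Rightarrow> complex poly"
    and B C an bn cn :: "nat \<Rightarrow> complex"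
  defines "r \<equiv> \<lambda>i. cn i + 2 * a * C i"
    and "b' \<equiv> b + 2 * a * \<beta>"
  defines "\<aa> \<equiv> a * C 3 / (r 3 * C 1)"
    and "\<bb> \<equiv> (B 1 - B 0 + 4 * \<beta>) / 2"
  defines "\<phi> \<equiv> [:B 0, -1:] * [:\<bb> - \<aa> * B 1, \<aa>:] - [:(\<aa> + 1) * C 1:]"
    and "\<psi> \<equiv> [:- B 0, 1:]"
    and "eig \<equiv> \<lambda>n::nat. of_nat n * (1 + (of_nat n - 1) * \<aa>)"
  assumes "(\<beta>, c5) \<noteq> (0, 0)"
    and "monic_OPS u P"
    and "recurrence_coeffs P B C"
    and "\<And>n. cn n \<noteq> 0"
    and "\<And>n. [:c, b, a:] * Dx \<beta> c5 (P n) =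
           smult (an n) (Sx \<beta> c5 (P (Suc n))) + smult (bn n) (Sx \<beta> c5 (P n))
             + smult (cn n) (Sx \<beta> c5 (shift_seq P n))"
    and "a \<noteq> 0 \<Longrightarrow>
           6 * a * C 2 * C 3 + 2 * (1 + inverse a) * r 3 * (C 1 - c5\<^sup>2 / 4)
             + r 3 * ((B 1 - B 0)\<^sup>2 - 8 * \<beta> * (B 0 + B 1 - 2 * \<beta>) - 2 * C 2) = 0"
    and "a * C 2 * C 3 * (bn 2 + 2 * a * B 2 + b')
           - r 3 * (a * (B 2 + B 1) * C 2 + b' * C 2 - r 2 / 2 * (B 1 - B 0)) = 0"
  shows "(P \<in> cont_dual_hahn_seqs \<or> P \<in> wilson_seqs \<or>
            limiting_case (wilson_seqs \<union> cont_dual_hahn_seqs) P) \<and>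
         (\<forall>n. \<phi> * Dx \<beta> c5 (Dx \<beta> c5 (P n)) + \<psi> * Sx \<beta> c5 (Dx \<beta> c5 (P n))
                = smult (eig n) (P n))"
proof -
  have a: "a = 0"
  proof (rule ccontr)
    assume a: "a \<noteq> 0"
    \<comment> \<open>The relation divided by \<open>a\<close>.\<close>
    interpret quadratic_structure \<beta> c5 u P B C "\<lambda>n. an n / a" "\<lambda>n. bn n / a" "\<lambda>n. cn n / a" "b / a" "c / a"
    proof (unfold_locales)
      fix n
      have "[:c / a, b / a, 1:] = smult (1 / a) [:c, b, a:]" using a by simp
      then have "[:c / a, b / a, 1:] * Dx \<beta> c5 (P n) = smult (1 / a) ([:c, b, a:] * Dx \<beta> c5 (P n))"
        by (simp only: mult_smult_left)
      then show "[:c / a, b / a, 1:] * Dx \<beta> c5 (P n) =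
          smult (an n / a) (Sx \<beta> c5 (P (Suc n))) + smult (bn n / a) (Sx \<beta> c5 (P n))
          + smult (cn n / a) (Sx \<beta> c5 (shift_seq P n))"
        unfolding assms(12) by (simp add: smult_add_right)
    qed (use a assms(8-11) in auto)
    show False by (rule contradiction)
  qed
  interpret linear_structure \<beta> c5 u P B C an bn cn b c
  proof unfold_locales
    \<comment> \<open>For \<open>a = 0\<close> the second side condition is a product with the
      nonzero factor \<open>r 3 = cn 3\<close>.\<close>
    show "b * C 2 = cn 2 / 2 * (B 1 - B 0)"
      using assms(14) assms(11)[of 3] by (simp add: r_def b'_def a)
  qed (use assms(8-12) a in auto)
  obtain \<nu> where BB: "\<And>n. B n = BB \<nu> (B 0) n"
    and \<gamma>: "\<And>n. C (Suc n) = \<gamma> \<nu> (B 0) (Suc n) * (\<nu> - of_nat (Suc n))"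
    using closed_form by blast
  have P: "P = hahn_seq \<nu> (B 0)"
  proof -
    \<comment> \<open>\<open>C 0\<close> may differ from the closed form at 0, but it multiplies
      P_(-1) = 0.\<close>
    have "recurrence_coeffs P (BB \<nu> (B 0)) (\<lambda>n. \<gamma> \<nu> (B 0) n * (\<nu> - of_nat n))"
      unfolding recurrence_coeffs_def
    proof (intro conjI allI impI)
      fix n
      show "P (Suc n) = [:- BB \<nu> (B 0) n, 1:] * P n - smult (\<gamma> \<nu> (B 0) n * (\<nu> - of_nat n)) (shift_seq P n)"
        using rec \<gamma> unfolding recurrence_coeffs_def BB[symmetric] by (cases n) (simp_all add: shift_seq_def)
      assume "1 \<le> n"
      then show "\<gamma> \<nu> (B 0) n * (\<nu> - of_nat n) \<noteq> 0"
        using \<gamma>[of "n - 1"] C_nonzero[of n] by simp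
    qed simp
    then show ?thesis using rec_seq_unique by blast
  qed
  have nz: "\<gamma> \<nu> (B 0) (Suc n) \<noteq> 0" for n
    using \<gamma>[of n] C_nonzero[of "Suc n"] by auto
  have "P \<in> cont_dual_hahn_seqs \<or> limiting_case (wilson_seqs \<union> cont_dual_hahn_seqs) P"
    unfolding P using hahn_seq_in_cont_dual_hahn_seqs[OF _ nz] hahn_seq_limiting_case by blast
  moreover have "\<phi> * D (D (P n)) + \<psi> * S (D (P n)) = smult (eig n) (P n)" for n
  proof -
    have "L \<nu> (B 0) (P n) = smult (of_nat n) (P n)"
    proof (rule L_eigen[where P = P])
      fix n
      show "P (Suc (Suc n)) = [:- BB \<nu> (B 0) (Suc n), 1:] * P (Suc n)
          - smult (\<gamma> \<nu> (B 0) (Suc n) * (\<nu> - of_nat (Suc n))) (P n)"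
        using P_Suc[of n] unfolding BB[symmetric] \<gamma>[symmetric] .
    qed (simp_all add: P_1)
    \<comment> \<open>The coefficients in the statement agree with those built into
      \<open>L\<close>.\<close>
    moreover have "\<bb> = 4 * \<beta> * \<nu> - 6 * \<beta>"
      using BB[of 1] by (simp add: \<bb>_def BB_def field_simps)
    moreover have "C 1 = (\<nu> - 1) * \<gamma> \<nu> (B 0) 1"
      using \<gamma>[of 0] by simp
    moreover have "\<aa> = 0" by (simp add: \<aa>_def a)
    ultimately show ?thesis by (simp add: L_def \<phi>_def \<psi>_def eig_def)
  qed
  ultimately show ?thesis by blast
qed

end
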